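(* Let $\mu,k,r,s,t$ be positive integers with $s,t,\mu\geq 2$. There exist positive constants $C$ and $C'$ depending on $\mu,k,r,s,t$ such that the following holds. Let $G$ be a $\mu$-almost-biregular $K_{s,t}^{(2k)}(r)$-free bipartite graph with an ordered bipartition $(M,N)$ where $|M|\leq |N|$. Then \[e(G)\leq C\left(|M|^{\frac{1}{2}+\frac{1}{2k}}|N|^{\frac{1}{2}}+|M|+|N|\right).\] Furthermore, if $G$ is a $\mu$-almost-biregular $K_{s,t}^{(2k)}$-free bipartite graph with ordered bipartition $(M,N)$, $|M|\le |N|$, then \[e(G)\leq C'\left(|M|^{\frac{1}{2}+\frac{1}{2k}-\frac{1}{2ks}}|N|^{\frac{1}{2}}+|M|+|N|\right).\]
   Context: A bipartite graph with bipartition $(A,B)$ is $\mu$-almost-biregular if $\Delta_A\leq \mu\delta_A$ and $\Delta_B\leq\mu\delta_B$, where $\Delta_A,\delta_A$ (resp. $\Delta_B,\delta_B$) are the maximum and minimum degrees of vertices in $A$ (resp. $B$). For a graph $H$ and positive integers $k,r$, $H^{(k)}(r)$ is obtained from $H$ by replacing each edge $uv$ by $r$ paths of length $k$ from $u$ to $v$, all $r\,e(H)$ paths pairwise internally vertex-disjoint; $H^{(k)}=H^{(k)}(1)$. *)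

theory Defs
  imports Complex_Main
begin

type_synonym 'a ugraph = "'a set \<times> 'a set set"

abbreviation verts :: "'a ugraph \<Rightarrow> 'a set" where "verts \<equiv> fst"
abbreviation edges :: "'a ugraph \<Rightarrow> 'a set set" where "edges \<equiv> snd"

definition bipartite_graph :: "'a ugraph \<Rightarrow> 'a set \<Rightarrow> 'a set \<Rightarrow> bool" where
  "bipartite_graph G A B \<longleftrightarrow>
     finite A \<and> finite B \<and> A \<inter> B = {} \<and> verts G = A \<union> B \<and>
     (\<forall>e \<in> edges G. \<exists>a \<in> A. \<exists>b \<in> B. e = {a, b})"

definition vdegree :: "'a ugraph \<Rightarrow> 'a \<Rightarrow> nat" where
  "vdegree G v = card {e \<in> edges G. v \<in> e}"

definition max_degree_on :: "'a ugraph \<Rightarrow> 'a set \<Rightarrow> nat" where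
  "max_degree_on G A = Max (vdegree G ` A)"

definition min_degree_on :: "'a ugraph \<Rightarrow> 'a set \<Rightarrow> nat" where
  "min_degree_on G A = Min (vdegree G ` A)"

text \<open>The guards are there because \<open>Max {}\<close> and \<open>Min {}\<close> are unspecified:
  an empty part imposes no condition.\<close>

definition almost_biregular :: "nat \<Rightarrow> 'a ugraph \<Rightarrow> 'a set \<Rightarrow> 'a set \<Rightarrow> bool" where
  "almost_biregular \<mu> G A B \<longleftrightarrow>
     (A \<noteq> {} \<longrightarrow> max_degree_on G A \<le> \<mu> * min_degree_on G A) \<and>
     (B \<noteq> {} \<longrightarrow> max_degree_on G B \<le> \<mu> * min_degree_on G B)"

text \<open>Containment is as a not necessarily induced subgraph.\<close>

definition contains_copy :: "'a ugraph \<Rightarrow> 'b ugraph \<Rightarrow> bool" where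
  "contains_copy G H \<longleftrightarrow>
     (\<exists>f. inj_on f (verts H) \<and> f ` verts H \<subseteq> verts G \<and> (\<forall>e \<in> edges H. f ` e \<in> edges G))"

definition free_of :: "'b ugraph \<Rightarrow> 'a ugraph \<Rightarrow> bool" where
  "free_of H G \<longleftrightarrow> \<not> contains_copy G H"

definition complete_bipartite :: "nat \<Rightarrow> nat \<Rightarrow> nat ugraph" where
  "complete_bipartite s t =
     ({..<s + t}, {{u, v} | u v. u \<in> {..<s} \<and> v \<in> {s..<s + t}})"

text \<open>\<open>Inner e i j\<close> is the vertex at distance \<open>j\<close> from \<open>Min e\<close> on the \<open>i\<close>-th path replacing
  the edge \<open>e\<close>. The linear order on the vertices serves only to direct the numbering along
  the path; another order gives an isomorphic graph.\<close>

datatype 'a subdiv_vertex = Branch 'a | Inner "'a set" nat nat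

definition path_vertex :: "nat \<Rightarrow> 'a::linorder set \<Rightarrow> nat \<Rightarrow> nat \<Rightarrow> 'a subdiv_vertex" where
  "path_vertex k e i j =
     (if j = 0 then Branch (Min e) else if j = k then Branch (Max e) else Inner e i j)"

text \<open>The graph $H^{(k)}(r)$. For \<open>k = 1\<close> the \<open>r\<close> parallel edges are identified.\<close>

definition subdivision :: "nat \<Rightarrow> nat \<Rightarrow> 'a::linorder ugraph \<Rightarrow> 'a subdiv_vertex ugraph" where
  "subdivision k r H =
     (Branch ` verts H \<union> {Inner e i j | e i j. e \<in> edges H \<and> i < r \<and> 0 < j \<and> j < k},
      {{path_vertex k e i j, path_vertex k e i (Suc j)} | e i j. e \<in> edges H \<and> i < r \<and> j < k})"

end

theory Submission
  imports Defs "HOL-Library.FuncSet"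
begin

text \<open>
  Let \<open>D\<close>, \<open>d\<close> be the minimum degrees of the two sides. If one of them is bounded, the linear terms
  suffice. Otherwise, a spider with centre in \<open>M\<close> and legs of length \<open>2k\<close> has its leaves in \<open>M\<close>, and
  there are about \<open>|M| (Dd)\<^sup>k\<^sup>p\<close> of them with \<open>p\<close> legs. If all but few of these share their leaves with boundedly
  many others, comparing with the number of leaf tuples gives \<open>(Dd)\<^sup>k \<le> C |M|\<close> (paths of length \<open>2k\<close>,
  with both ends prescribed) and \<open>(Dd)\<^sup>k\<^sup>s \<le> C |M|\<^sup>s\<^sup>-\<^sup>1\<close> (\<open>s\<close> legs), and \<open>e(G)\<^sup>2 \<le> \<mu>\<^sup>2 |M| |N| D d\<close> finishes.

  If this fails, take a minimal type of spiders of which a positive proportion is heavy. By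
  minimality the heavy ones can be cleaned to a family in which every leaf tuple is realised by spiders avoiding
  any given bounded vertex set and in which every leaf can be replaced by many others. Walking up and
  down one edge at a leaf lengthens a leg by two, so heavy spiders of any shorter
  type yield many disjoint spiders with legs of length exactly \<open>2k\<close> on common leaves, i.e. the forbidden subdivision.
\<close>

section \<open>Spiders in almost biregular neighbourhood systems\<close>

text \<open>Heaviness alone is not enough: all spiders on the same leaves might pass through one
  vertex, and then no two of them are disjoint. Minimality of the type removes this. A member of a
  class through a given vertex off the key decomposes into pieces of shorter types with prescribed
  keys, of which there are boundedly many, so a bounded set off the key hits only boundedly many
  members. Paths have to be settled before spiders, because the piece cut off at a leaf is a path.
  Parity is the second obstacle. Growing by two keeps the parity of a leg, so odd legs only reach
  \<open>2 * k - 1\<close> and the last edge must come from elsewhere: for paths, from vertices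
  \<open>y\<close> having many neighbours \<open>z\<close> that end members of the family; for
  spiders, from taking the predecessor of the leaf as branch vertex. Thresholds for heaviness are
  fixed from shorter to longer types and never depend on the graph.\<close>

text \<open>A spider with \<open>p\<close> legs of lengths \<open>b 0, \<dots>, b (p - 1)\<close> is an injective map on \<open>Pos p b\<close>:
  \<open>(0, 0)\<close> is the centre and \<open>(i, j)\<close> with \<open>j > 0\<close> is the vertex at distance \<open>j\<close> from the centre on
  leg \<open>i\<close>. A path is a spider with one leg.\<close>

definition lpos :: "nat \<Rightarrow> nat \<Rightarrow> nat \<times> nat" where
  "lpos i j = (if j = 0 then (0, 0) else (i, j))"

definition Pos :: "nat \<Rightarrow> (nat \<Rightarrow> nat) \<Rightarrow> (nat \<times> nat) set" where
  "Pos p b = insert (0, 0) {(i, j). i < p \<and> 0 < j \<and> j \<le> b i}"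

definition spiders :: "'a set \<Rightarrow> ('a \<Rightarrow> 'a set) \<Rightarrow> nat \<Rightarrow> (nat \<Rightarrow> nat) \<Rightarrow> (nat \<times> nat \<Rightarrow> 'a) set" where
  "spiders S nb p b = {\<sigma> \<in> extensional (Pos p b). inj_on \<sigma> (Pos p b) \<and> \<sigma> (0, 0) \<in> S \<and>
     (\<forall>i<p. \<forall>j<b i. \<sigma> (i, Suc j) \<in> nb (\<sigma> (lpos i j)))}"

text \<open>Spiders are classified by their leaves; for paths (\<open>fx = True\<close>) the centre, i.e. the other end,
  is part of the key as well.\<close>

definition Keys :: "bool \<Rightarrow> nat \<Rightarrow> (nat \<Rightarrow> nat) \<Rightarrow> (nat \<times> nat) set" where
  "Keys fx p b = (\<lambda>i. (i, b i)) ` {..<p} \<union> (if fx then {(0, 0)} else {})"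

text \<open>The ambient family \<open>A\<close> is a parameter because heaviness refers to all
  spiders of a type, whereas robustness refers to a cleaned subfamily.\<close>

definition key_class :: "bool \<Rightarrow> nat \<Rightarrow> (nat \<Rightarrow> nat) \<Rightarrow> (nat \<times> nat \<Rightarrow> 'a) set \<Rightarrow> (nat \<times> nat \<Rightarrow> 'a) \<Rightarrow> (nat \<times> nat \<Rightarrow> 'a) set" where
  "key_class fx p b A \<sigma> = {\<sigma>' \<in> A. \<forall>q\<in>Keys fx p b. \<sigma>' q = \<sigma> q}"

definition paths :: "('a \<Rightarrow> 'a set) \<Rightarrow> nat \<Rightarrow> 'a \<Rightarrow> 'a \<Rightarrow> (nat \<times> nat \<Rightarrow> 'a) set" where
  "paths nb m x z = {\<tau> \<in> spiders {x} nb 1 (\<lambda>_. m). \<tau> (0, m) = z}"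

text \<open>With \<open>D\<close> and \<open>d\<close> the minimum degrees of the two sides, \<open>growth D d a\<close> is up to constants the number
  of walks of length \<open>a\<close> from a vertex of the first side.\<close>

definition sdeg :: "nat \<Rightarrow> nat \<Rightarrow> nat \<Rightarrow> nat" where
  "sdeg D d j = (if even j then D else d)"

definition growth :: "nat \<Rightarrow> nat \<Rightarrow> nat \<Rightarrow> nat" where
  "growth D d a = (\<Prod>j<a. sdeg D d j)"

text \<open>The normalisation of all densities: with \<open>B\<close> the total leg length, the
  number of spiders lies between \<open>card M * weight / 2 ^ B\<close> and
  \<open>\<mu> ^ B * card M * weight\<close>, the former once both degrees are large.\<close>

definition weight :: "nat \<Rightarrow> nat \<Rightarrow> nat \<Rightarrow> (nat \<Rightarrow> nat) \<Rightarrow> real" where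
  "weight D d p b = (\<Prod>i<p. real (growth D d (b i)))"

abbreviation spider_total :: "'a set \<Rightarrow> nat \<Rightarrow> nat \<Rightarrow> nat \<Rightarrow> (nat \<Rightarrow> nat) \<Rightarrow> real" where
  "spider_total S D d p b \<equiv> real (card S) * weight D d p b"

abbreviation heavy_spiders :: "bool \<Rightarrow> nat \<Rightarrow> 'a set \<Rightarrow> ('a \<Rightarrow> 'a set) \<Rightarrow> nat \<Rightarrow> (nat \<Rightarrow> nat) \<Rightarrow> (nat \<times> nat \<Rightarrow> 'a) set" where
  "heavy_spiders fx K S nb p b \<equiv> {\<sigma> \<in> spiders S nb p b. K < card (key_class fx p b (spiders S nb p b) \<sigma>)}"

section \<open>Positions, truncation and extension of spiders\<close>

lemma finite_Pos [simp]: "finite (Pos p b)"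
proof -
  have "Pos p b \<subseteq> insert (0,0) (Sigma {..<p} (\<lambda>i. {..b i}))"
    by (auto simp: Pos_def)
  then show ?thesis
    by (rule finite_subset) auto
qed

lemma card_Pos_le: "card (Pos p b) \<le> Suc (\<Sum>i<p. b i)"
proof -
  have "Pos p b = insert (0,0) (Sigma {..<p} (\<lambda>i. {1..b i}))"
    by (auto simp: Pos_def)
  then have "card (Pos p b) \<le> Suc (card (Sigma {..<p} (\<lambda>i. {1..b i})))"
    by (simp add: card_insert_le_m1 card_insert_if)
  then show ?thesis by simp
qed

lemma zero_in_Pos [simp]: "(0, 0) \<in> Pos p b"
  by (simp add: Pos_def)

lemma in_Pos: "(i, j) \<in> Pos p b \<longleftrightarrow> (i = 0 \<and> j = 0) \<or> (i < p \<and> 0 < j \<and> j \<le> b i)"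
  by (auto simp: Pos_def)

lemma lpos_in_Pos: "i < p \<Longrightarrow> j \<le> b i \<Longrightarrow> lpos i j \<in> Pos p b"
  by (auto simp: lpos_def in_Pos)

lemma lpos_0 [simp]: "lpos i 0 = (0, 0)" and lpos_Suc [simp]: "lpos i (Suc j) = (i, Suc j)"
  by (auto simp: lpos_def)

lemma lpos_zero_leg [simp]: "lpos 0 j = (0, j)"
  by (auto simp: lpos_def)

lemma Pos_cases:
  assumes "q \<in> Pos p b"
  obtains "q = (0, 0)" | i j where "i < p" "0 < j" "j \<le> b i" "q = (i, j)"
  using assms by (auto simp: Pos_def)

lemma Pos_mono: "(\<And>i. i < p \<Longrightarrow> b' i \<le> b i) \<Longrightarrow> Pos p b' \<subseteq> Pos p b"
  by (force simp: Pos_def)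

lemma Pos_cong: "(\<And>i. i < p \<Longrightarrow> b' i = b i) \<Longrightarrow> Pos p b' = Pos p b"
  by (auto simp: Pos_def)

lemma Pos_upd_Suc: "i < p \<Longrightarrow> Pos p (b(i := Suc (b i))) = insert (i, Suc (b i)) (Pos p b)"
  by (auto simp: Pos_def split: if_splits)

lemma spiders_ext: "\<sigma> \<in> spiders S nb p b \<Longrightarrow> \<sigma> \<in> extensional (Pos p b)"
  and spiders_inj: "\<sigma> \<in> spiders S nb p b \<Longrightarrow> inj_on \<sigma> (Pos p b)"
  and spiders_center: "\<sigma> \<in> spiders S nb p b \<Longrightarrow> \<sigma> (0, 0) \<in> S"
  and spiders_step: "\<sigma> \<in> spiders S nb p b \<Longrightarrow> i < p \<Longrightarrow> j < b i \<Longrightarrow> \<sigma> (i, Suc j) \<in> nb (\<sigma> (lpos i j))"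
  by (auto simp: spiders_def)

lemma spiders_cong: "(\<And>i. i < p \<Longrightarrow> b' i = b i) \<Longrightarrow> spiders S nb p b' = spiders S nb p b"
  by (simp add: spiders_def Pos_cong[of p b' b])

lemma spiders_eqI:
  assumes "\<sigma> \<in> spiders S nb p b" "\<sigma>' \<in> spiders S' nb' p b" "\<And>q. q \<in> Pos p b \<Longrightarrow> \<sigma> q = \<sigma>' q"
  shows "\<sigma> = \<sigma>'"
  by (rule extensionalityI[OF spiders_ext[OF assms(1)] spiders_ext[OF assms(2)]]) (rule assms(3))

lemma restrict_spiders:
  assumes "\<sigma> \<in> spiders S nb p b" "\<And>i. i < p \<Longrightarrow> b' i \<le> b i"
  shows "restrict \<sigma> (Pos p b') \<in> spiders S nb p b'"
proof -
  have sub: "Pos p b' \<subseteq> Pos p b" using assms(2) by (rule Pos_mono)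
  have "inj_on (restrict \<sigma> (Pos p b')) (Pos p b')"
    using inj_on_subset[OF spiders_inj[OF assms(1)] sub] by (simp add: inj_on_def)
  moreover have "restrict \<sigma> (Pos p b') (i, Suc j) \<in> nb (restrict \<sigma> (Pos p b') (lpos i j))"
    if "i < p" "j < b' i" for i j
  proof -
    have "j < b i" using assms(2)[OF that(1)] that by simp
    then show ?thesis
      using spiders_step[OF assms(1) that(1)] that by (simp add: lpos_in_Pos in_Pos)
  qed
  ultimately show ?thesis
    using spiders_center[OF assms(1)] by (simp add: spiders_def)
qed

lemma spiders_upd:
  assumes "\<sigma> \<in> spiders S nb p b" "i < p" "v \<in> nb (\<sigma> (lpos i (b i)))" "v \<notin> \<sigma> ` Pos p b"
  shows "\<sigma>((i, Suc (b i)) := v) \<in> spiders S nb p (b(i := Suc (b i)))" (is "?s \<in> _")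
proof -
  let ?q = "(i, Suc (b i))"
  have q: "?q \<notin> Pos p b" by (simp add: in_Pos)
  have P: "Pos p (b(i := Suc (b i))) = insert ?q (Pos p b)"
    using Pos_upd_Suc[OF assms(2)] .
  have "inj_on ?s (insert ?q (Pos p b))"
    using spiders_inj[OF assms(1)] assms(4) q by (auto simp: inj_on_def)
  moreover have "?s \<in> extensional (insert ?q (Pos p b))"
    using spiders_ext[OF assms(1)] by (auto simp: extensional_def)
  moreover have "?s (i', Suc j) \<in> nb (?s (lpos i' j))"
    if "i' < p" "j < (b(i := Suc (b i))) i'" for i' j
  proof (cases "i' = i \<and> j = b i")
    case True
    then have "lpos i' j \<noteq> ?q" by (auto simp: lpos_def)
    then show ?thesis using True assms(3) by simp
  next
    case False
    then have j: "j < b i'" using that by (auto split: if_splits)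
    then have "lpos i' j \<noteq> ?q" "(i', Suc j) \<noteq> ?q" by (auto simp: lpos_def)
    then show ?thesis using spiders_step[OF assms(1) that(1) j] by (simp only: fun_upd_other not_False_eq_True)
  qed
  ultimately show ?thesis
    using spiders_center[OF assms(1)] unfolding spiders_def P by simp
qed

lemma sum_neq_0_ex: "(\<Sum>i<p. f i) \<noteq> (0::nat) \<Longrightarrow> \<exists>i<p. f i \<noteq> 0"
  by (rule ccontr) simp

lemma sum_upd_pred:
  fixes i p :: nat
  assumes "i < p" "b i \<noteq> (0::nat)"
  shows "(\<Sum>i'<p. b i') = Suc (\<Sum>i'<p. (b(i := b i - 1)) i')"
proof -
  let ?b = "b(i := b i - 1)"
  have "(\<Sum>i'\<in>{..<p}-{i}. ?b i') = (\<Sum>i'\<in>{..<p}-{i}. b i')"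
    by (rule sum.cong) auto
  moreover have "(\<Sum>i'<p. b i') = b i + (\<Sum>i'\<in>{..<p}-{i}. b i')"
    by (rule sum.remove) (use assms(1) in auto)
  moreover have "(\<Sum>i'<p. ?b i') = ?b i + (\<Sum>i'\<in>{..<p}-{i}. ?b i')"
    by (rule sum.remove) (use assms(1) in auto)
  moreover have "b i = Suc (?b i)" using assms(2) by simp
  ultimately show ?thesis by linarith
qed

section \<open>Weights, and counting spiders in an almost biregular system\<close>

lemma growth_Suc: "growth D d (Suc a) = growth D d a * sdeg D d a" and growth_0 [simp]: "growth D d 0 = 1"
  by (simp_all add: growth_def)

lemma sdeg_pos: "0 < D \<Longrightarrow> 0 < d \<Longrightarrow> 0 < sdeg D d j"
  by (simp add: sdeg_def)

lemma growth_pos: "0 < D \<Longrightarrow> 0 < d \<Longrightarrow> 0 < growth D d a"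
  by (simp add: growth_def sdeg_def)

lemma weight_pos: "0 < D \<Longrightarrow> 0 < d \<Longrightarrow> 0 < weight D d p b"
  by (auto simp: weight_def growth_pos intro!: prod_pos)

lemma weight_upd:
  assumes "i < p"
  shows "weight D d p (b(i := Suc (b i))) = weight D d p b * real (sdeg D d (b i))"
proof -
  have "weight D d p (b(i := Suc (b i)))
      = real (growth D d (Suc (b i))) * (\<Prod>i'\<in>{..<p}-{i}. real (growth D d ((b(i := Suc (b i))) i')))"
    unfolding weight_def using assms by (subst prod.remove[of _ i]) auto
  also have "(\<Prod>i'\<in>{..<p}-{i}. real (growth D d ((b(i := Suc (b i))) i')))
      = (\<Prod>i'\<in>{..<p}-{i}. real (growth D d (b i')))"
    by (rule prod.cong) auto
  also have "real (growth D d (Suc (b i))) * (\<Prod>i'\<in>{..<p}-{i}. real (growth D d (b i')))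
      = real (sdeg D d (b i)) * (\<Prod>i'<p. real (growth D d (b i')))"
    using assms by (subst prod.remove[of "{..<p}" i]) (auto simp: growth_Suc)
  finally show ?thesis by (simp add: weight_def)
qed

lemma weight_1: "weight D d 1 b = real (growth D d (b 0))"
  by (simp add: weight_def)

text \<open>The assumptions are symmetric under exchanging \<open>(M, D)\<close> with
  \<open>(N, d)\<close>. This symmetry (\<open>swap\<close>) is what allows paths to be read from
  either side.\<close>

locale bireg =
  fixes \<mu> :: nat and M N :: "'a set" and nb :: "'a \<Rightarrow> 'a set" and D d :: nat
  assumes finM: "finite M" and finN: "finite N" and disj: "M \<inter> N = {}"
    and nbM: "v \<in> M \<Longrightarrow> nb v \<subseteq> N" and nbN: "v \<in> N \<Longrightarrow> nb v \<subseteq> M"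
    and sym: "u \<in> nb v \<Longrightarrow> v \<in> nb u"
    and degM: "v \<in> M \<Longrightarrow> D \<le> card (nb v) \<and> card (nb v) \<le> \<mu> * D"
    and degN: "v \<in> N \<Longrightarrow> d \<le> card (nb v) \<and> card (nb v) \<le> \<mu> * d"
    and mu: "1 \<le> \<mu>" and Dpos: "0 < D" and dpos: "0 < d"
begin

lemma swap: "bireg \<mu> N M nb d D"
  by unfold_locales (use finM finN disj nbM nbN sym degM degN mu Dpos dpos in auto)

lemma sum_card_nb: "(\<Sum>v\<in>M. card (nb v)) = (\<Sum>v\<in>N. card (nb v))"
proof -
  have "(\<Sum>v\<in>M. card (nb v)) = (\<Sum>v\<in>M. card {u \<in> N. u \<in> nb v})"
    using nbM by (intro sum.cong refl arg_cong[where f = card]) auto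
  also have "\<dots> = (\<Sum>u\<in>N. card {v \<in> M. u \<in> nb v})"
    by (rule sum_multicount_gen) (auto simp: finM finN)
  also have "\<dots> = (\<Sum>u\<in>N. card (nb u))"
    using nbN sym by (intro sum.cong refl arg_cong[where f = card]) auto
  finally show ?thesis .
qed

text \<open>The two sides enclose the number of edges, counted from \<open>M\<close> and from
  \<open>N\<close>.\<close>

lemma balance: "card M * D \<le> \<mu> * (card N * d)"
proof -
  have "card M * D \<le> (\<Sum>v\<in>M. card (nb v))"
    using sum_bounded_below[of M D "\<lambda>v. card (nb v)"] degM by simp
  also have "\<dots> \<le> card N * (\<mu> * d)"
    using sum_bounded_above[of N "\<lambda>v. card (nb v)" "\<mu> * d"] degN sum_card_nb by simp
  finally show ?thesis by (simp add: ac_simps)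
qed

lemma finite_nb: "v \<in> M \<union> N \<Longrightarrow> finite (nb v)"
  using finite_subset[OF nbM finN] finite_subset[OF nbN finM] by blast

lemma spiders_side:
  assumes "\<sigma> \<in> spiders S nb p b" "S \<subseteq> M" "i < p" "j \<le> b i"
  shows "\<sigma> (lpos i j) \<in> (if even j then M else N)"
  using assms(4)
proof (induction j)
  case 0
  then show ?case using spiders_center[OF assms(1)] assms(2) by auto
next
  case (Suc j)
  then have "\<sigma> (i, Suc j) \<in> nb (\<sigma> (lpos i j))"
    using spiders_step[OF assms(1,3)] by simp
  then show ?case using Suc nbM nbN by (auto split: if_splits)
qed

lemma spiders_range:
  assumes "\<sigma> \<in> spiders S nb p b" "S \<subseteq> M" "q \<in> Pos p b"
  shows "\<sigma> q \<in> M \<union> N"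
  using assms(3)
proof (cases rule: Pos_cases)
  case 1
  then show ?thesis using spiders_center[OF assms(1)] assms(2) by auto
next
  case (2 i j)
  then have "q = lpos i j" by (simp add: lpos_def)
  then show ?thesis using spiders_side[OF assms(1,2) 2(1,3)] by (auto split: if_splits)
qed

lemma finite_spiders: "S \<subseteq> M \<Longrightarrow> finite (spiders S nb p b)"
proof -
  assume S: "S \<subseteq> M"
  have "spiders S nb p b \<subseteq> (\<Pi>\<^sub>E q\<in>Pos p b. M \<union> N)"
    unfolding PiE_def using spiders_range[OF _ S] spiders_ext[of _ S nb p b] by blast
  then show ?thesis
    by (rule finite_subset) (simp add: finite_PiE finM finN)
qed

lemma spiders_nb_card:
  assumes "\<sigma> \<in> spiders M nb p b" "i < p" "j \<le> b i"
  shows "card (nb (\<sigma> (lpos i j))) \<le> \<mu> * sdeg D d j" "sdeg D d j \<le> card (nb (\<sigma> (lpos i j)))"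
    "finite (nb (\<sigma> (lpos i j)))"
proof -
  have "\<sigma> (lpos i j) \<in> (if even j then M else N)"
    using spiders_side[OF assms(1) subset_refl assms(2,3)] .
  then show "card (nb (\<sigma> (lpos i j))) \<le> \<mu> * sdeg D d j" "sdeg D d j \<le> card (nb (\<sigma> (lpos i j)))"
    "finite (nb (\<sigma> (lpos i j)))"
    using degM[of "\<sigma> (lpos i j)"] degN[of "\<sigma> (lpos i j)"] finite_nb[of "\<sigma> (lpos i j)"]
    by (cases "even j"; simp add: sdeg_def)+
qed

text \<open>A spider of the longer type is determined by its truncation and its new leaf, a
  neighbour of the old end of leg \<open>i\<close>; ignoring injectivity only enlarges the
  count.\<close>

lemma card_ext_step:
  assumes i: "i < p" and X: "X \<subseteq> spiders M nb p b"
  shows "card {\<sigma> \<in> spiders M nb p (b(i := Suc (b i))). restrict \<sigma> (Pos p b) \<in> X}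
    \<le> card X * (\<mu> * sdeg D d (b i))"
proof -
  let ?b = "b(i := Suc (b i))" and ?A = "\<lambda>\<rho>. nb (\<rho> (lpos i (b i)))"
  let ?L = "{\<sigma> \<in> spiders M nb p ?b. restrict \<sigma> (Pos p b) \<in> X}"
  let ?f = "\<lambda>\<sigma>. (restrict \<sigma> (Pos p b), \<sigma> (i, Suc (b i)))"
  have finX: "finite X" using X finite_spiders[OF subset_refl] by (rule finite_subset)
  have "inj_on ?f ?L"
  proof (rule inj_onI)
    fix \<sigma> \<sigma>' assume a: "\<sigma> \<in> ?L" "\<sigma>' \<in> ?L" "?f \<sigma> = ?f \<sigma>'"
    show "\<sigma> = \<sigma>'"
    proof (rule spiders_eqI)
      fix q assume "q \<in> Pos p ?b"
      then have "q = (i, Suc (b i)) \<or> q \<in> Pos p b" using Pos_upd_Suc[OF i] by auto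
      then show "\<sigma> q = \<sigma>' q" using a(3) by (metis prod.inject restrict_apply')
    qed (use a in auto)
  qed
  moreover have "?f ` ?L \<subseteq> Sigma X ?A"
    using spiders_step[where b = ?b and i = i and j = "b i"] i by (auto simp: lpos_in_Pos)
  moreover have finS: "finite (Sigma X ?A)"
    using finX X spiders_nb_card(3)[OF _ i] by (intro finite_SigmaI) auto
  ultimately have "card ?L \<le> card (Sigma X ?A)"
    by (rule card_inj_on_le)
  also have "\<dots> = (\<Sum>\<rho>\<in>X. card (?A \<rho>))"
    using finX X spiders_nb_card(3)[OF _ i] by (intro card_SigmaI) auto
  also have "\<dots> \<le> card X * (\<mu> * sdeg D d (b i))"
    using sum_bounded_above[of X "\<lambda>\<rho>. card (?A \<rho>)" "\<mu> * sdeg D d (b i)"] X spiders_nb_card(1)[OF _ i]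
    by auto
  finally show ?thesis .
qed

text \<open>Missing vertices are added one at a time, each costing a factor
  \<open>\<mu> * sdeg D d j\<close>. The factors \<open>sdeg\<close> multiply up to the quotient of
  the two weights, which is written crosswise to avoid division.\<close>

lemma card_ext:
  assumes "\<And>i. i < p \<Longrightarrow> b' i \<le> b i" and "X \<subseteq> spiders M nb p b'"
  shows "real (card {\<sigma> \<in> spiders M nb p b. restrict \<sigma> (Pos p b') \<in> X}) * weight D d p b'
    \<le> real (card X) * real \<mu> ^ (\<Sum>i<p. b i - b' i) * weight D d p b"
  using assms
proof (induction "\<Sum>i<p. b i - b' i" arbitrary: b' X)
  case 0
  then have eq: "b' i = b i" if "i < p" for i
    using that by (metis diff_is_0_eq finite_lessThan lessThan_iff order_antisym sum_eq_0_iff)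
  have "{\<sigma> \<in> spiders M nb p b. restrict \<sigma> (Pos p b') \<in> X} \<subseteq> X"
    using Pos_cong[OF eq] spiders_ext by (fastforce simp: extensional_restrict)
  then have "card {\<sigma> \<in> spiders M nb p b. restrict \<sigma> (Pos p b') \<in> X} \<le> card X"
    using 0 finite_spiders[OF subset_refl] by (meson card_mono finite_subset)
  moreover have "weight D d p b' = weight D d p b" by (simp add: weight_def eq)
  moreover have "0 \<le> weight D d p b" using weight_pos[of D d p b] Dpos dpos by simp
  ultimately show ?case unfolding 0(1)[symmetric] by (simp only: power_0 mult_1_right mult_right_mono of_nat_le_iff)
next
  case (Suc n)
  obtain i where i: "i < p" "b' i < b i"
    using sum_neq_0_ex[of "\<lambda>i. b i - b' i" p] Suc(2)[symmetric]
    by (metis nat.distinct(1) zero_less_diff not_gr_zero)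
  \<comment> \<open>One leg grows by one vertex and \<open>X'\<close> collects the resulting
    extensions of \<open>X\<close>; the induction hypothesis does the rest.\<close>
  define b'' where "b'' = b'(i := Suc (b' i))"
  define X' where "X' = {\<sigma> \<in> spiders M nb p b''. restrict \<sigma> (Pos p b') \<in> X}"
  have n: "n = (\<Sum>i<p. b i - b'' i)"
  proof -
    have "(\<Sum>i'<p. b i' - b' i') = (b i - b' i) + (\<Sum>i'\<in>{..<p}-{i}. b i' - b' i')"
      using i by (subst sum.remove[of _ i]) auto
    moreover have "(\<Sum>i'<p. b i' - b'' i') = (b i - Suc (b' i)) + (\<Sum>i'\<in>{..<p}-{i}. b i' - b'' i')"
      using i by (subst sum.remove[of _ i]) (auto simp: b''_def)
    moreover have "(\<Sum>i'\<in>{..<p}-{i}. b i' - b'' i') = (\<Sum>i'\<in>{..<p}-{i}. b i' - b' i')"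
      by (rule sum.cong) (auto simp: b''_def)
    ultimately show ?thesis using Suc(2) i by simp
  qed
  have le: "b'' i' \<le> b i'" if "i' < p" for i' using Suc(3)[OF that] i by (auto simp: b''_def)
  have IH: "real (card {\<sigma> \<in> spiders M nb p b. restrict \<sigma> (Pos p b'') \<in> X'}) * weight D d p b''
    \<le> real (card X') * real \<mu> ^ (\<Sum>i<p. b i - b'' i) * weight D d p b"
    by (rule Suc(1)[OF n le]) (auto simp: X'_def)
  have sub: "Pos p b' \<subseteq> Pos p b''" by (rule Pos_mono) (auto simp: b''_def)
  have "{\<sigma> \<in> spiders M nb p b. restrict \<sigma> (Pos p b') \<in> X}
      \<subseteq> {\<sigma> \<in> spiders M nb p b. restrict \<sigma> (Pos p b'') \<in> X'}"
    using restrict_spiders[OF _ le] sub by (auto simp: X'_def restrict_restrict Int_absorb1)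
  then have c: "card {\<sigma> \<in> spiders M nb p b. restrict \<sigma> (Pos p b') \<in> X}
      \<le> card {\<sigma> \<in> spiders M nb p b. restrict \<sigma> (Pos p b'') \<in> X'}"
    using finite_spiders[OF subset_refl] by (intro card_mono) auto
  have c2: "real (card X') \<le> real (card X) * (real \<mu> * real (sdeg D d (b' i)))"
    using of_nat_mono[OF card_ext_step[OF i(1) Suc(4)], where 'a = real]
    unfolding X'_def b''_def of_nat_mult .
  have T: "weight D d p b'' = weight D d p b' * real (sdeg D d (b' i))"
    unfolding b''_def using weight_upd[OF i(1)] .
  have g: "real (sdeg D d (b' i)) > 0" using sdeg_pos Dpos dpos by simp
  have Tp: "weight D d p b > 0" using weight_pos Dpos dpos by blast
  have Tp': "weight D d p b' > 0" using weight_pos Dpos dpos by blast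
  have "real (card {\<sigma> \<in> spiders M nb p b. restrict \<sigma> (Pos p b') \<in> X}) * weight D d p b' * real (sdeg D d (b' i))
     \<le> real (card {\<sigma> \<in> spiders M nb p b. restrict \<sigma> (Pos p b'') \<in> X'}) * weight D d p b''"
    unfolding T using c g Tp' by (simp add: mult_right_mono)
  also have "\<dots> \<le> real (card X') * (real \<mu> ^ n * weight D d p b)"
    using IH unfolding n by (simp add: mult.assoc)
  also have "\<dots> \<le> real (card X) * (real \<mu> * real (sdeg D d (b' i))) * (real \<mu> ^ n * weight D d p b)"
    using c2 Tp by (intro mult_right_mono) auto
  also have "\<dots> = (real (card X) * real \<mu> ^ Suc n * weight D d p b) * real (sdeg D d (b' i))"
    by simp
  finally show ?case using g Suc(2) by simp
qed

text \<open>Carries rarity upwards: spiders with an exceptional truncation are as rare, up to a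
  constant, as the exceptional ones of the shorter type. The exponent is the full leg sum so that
  the constant does not depend on \<open>b'\<close>.\<close>

lemma dens_ext:
  assumes "\<And>i. i < p \<Longrightarrow> b' i \<le> b i" and "X \<subseteq> spiders M nb p b'"
    and "real (card X) \<le> \<epsilon> * (spider_total M D d p b')"
  shows "real (card {\<sigma> \<in> spiders M nb p b. restrict \<sigma> (Pos p b') \<in> X})
    \<le> \<epsilon> * real \<mu> ^ (\<Sum>i<p. b i) * (spider_total M D d p b)"
proof -
  have Tp: "weight D d p b > 0" and Tp': "weight D d p b' > 0" using weight_pos Dpos dpos by blast+
  have "real (card {\<sigma> \<in> spiders M nb p b. restrict \<sigma> (Pos p b') \<in> X}) * weight D d p b'
    \<le> real (card X) * real \<mu> ^ (\<Sum>i<p. b i - b' i) * weight D d p b"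
    using card_ext[OF assms(1,2)] .
  also have "\<dots> \<le> real (card X) * real \<mu> ^ (\<Sum>i<p. b i) * weight D d p b"
    using Tp mu by (intro mult_right_mono mult_left_mono power_increasing sum_mono) auto
  also have "\<dots> \<le> (\<epsilon> * (spider_total M D d p b')) * real \<mu> ^ (\<Sum>i<p. b i) * weight D d p b"
    using Tp assms(3) by (intro mult_right_mono) auto
  also have "\<dots> = (\<epsilon> * real \<mu> ^ (\<Sum>i<p. b i) * (spider_total M D d p b)) * weight D d p b'"
    by simp
  finally show ?thesis using Tp' by simp
qed

lemma card_spiders_zero: "card (spiders M nb p (\<lambda>_. 0)) = card M"
proof -
  have P: "Pos p (\<lambda>_. 0) = {(0,0)}" by (auto simp: Pos_def)
  have "bij_betw (\<lambda>\<sigma>. \<sigma> (0,0)) (spiders M nb p (\<lambda>_. 0)) M"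
    by (rule bij_betwI[where g = "\<lambda>y. restrict (\<lambda>_. y) {(0,0)}"])
      (auto simp: spiders_def P extensional_def fun_eq_iff)
  then show ?thesis by (rule bij_betw_same_card)
qed

lemma card_spiders_le: "real (card (spiders M nb p b)) \<le> real \<mu> ^ (\<Sum>i<p. b i) * (spider_total M D d p b)"
proof -
  \<comment> \<open>Every spider extends its bare centre, a type of density 1.\<close>
  have "{\<sigma> \<in> spiders M nb p b. restrict \<sigma> (Pos p (\<lambda>_. 0)) \<in> spiders M nb p (\<lambda>_. 0)} = spiders M nb p b"
    using restrict_spiders[of _ M nb p b "\<lambda>_. 0"] by auto
  then show ?thesis
    using dens_ext[of p "\<lambda>_. 0" b "spiders M nb p (\<lambda>_. 0)" 1] card_spiders_zero by (simp add: weight_def)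
qed

text \<open>Greedy growth: at each step at most half of the candidates for the new vertex are
  already occupied, so every step loses at most a factor 2 against \<open>sdeg\<close>.\<close>

lemma card_spiders_ge:
  assumes "2 * Suc (\<Sum>i<p. b i) \<le> D" "2 * Suc (\<Sum>i<p. b i) \<le> d"
  shows "real (card M) * weight D d p b \<le> 2 ^ (\<Sum>i<p. b i) * real (card (spiders M nb p b))"
  using assms
proof (induction "\<Sum>i<p. b i" arbitrary: b)
  case 0
  then have "b i = 0" if "i < p" for i using that by simp
  then have "spiders M nb p b = spiders M nb p (\<lambda>_. 0)" "weight D d p b = 1"
    by (auto intro!: spiders_cong simp: weight_def)
  then show ?case using 0 card_spiders_zero by simp
next
  case (Suc n)
  obtain i where i: "i < p" "b i \<noteq> 0"
    using sum_neq_0_ex[of b p] Suc(2)[symmetric] by (metis nat.distinct(1))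
  define b' where "b' = b(i := b i - 1)"
  have b: "b = b'(i := Suc (b' i))" using i by (auto simp: b'_def)
  have n: "n = (\<Sum>i<p. b' i)" using sum_upd_pred[of i p b, OF i] Suc(2) unfolding b'_def by linarith
  have IH: "real (card M) * weight D d p b' \<le> 2 ^ n * real (card (spiders M nb p b'))"
    unfolding n using Suc(2-4) n by (intro Suc(1)[OF n]) auto
  let ?A = "\<lambda>\<rho>. nb (\<rho> (lpos i (b' i))) - \<rho> ` Pos p b'"
  let ?f = "\<lambda>(\<rho>, v). \<rho>((i, Suc (b' i)) := v)"
  have q: "(i, Suc (b' i)) \<notin> Pos p b'" by (simp add: in_Pos)
  have "inj_on ?f (Sigma (spiders M nb p b') ?A)"
  proof (rule inj_onI, clarify)
    fix \<rho> v \<rho>' v'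
    assume a: "\<rho> \<in> spiders M nb p b'" "\<rho>' \<in> spiders M nb p b'"
      "\<rho>((i, Suc (b' i)) := v) = \<rho>'((i, Suc (b' i)) := v')"
    have "\<rho> = \<rho>'"
      using a q by (intro spiders_eqI[OF a(1,2)]) (metis fun_upd_other)
    then show "\<rho> = \<rho>' \<and> v = v'" using a(3) by (metis fun_upd_same)
  qed
  moreover have "?f ` Sigma (spiders M nb p b') ?A \<subseteq> spiders M nb p b"
    using spiders_upd[OF _ i(1)] b by fastforce
  ultimately have "card (Sigma (spiders M nb p b') ?A) \<le> card (spiders M nb p b)"
    by (rule card_inj_on_le) (rule finite_spiders[OF subset_refl])
  moreover have "card (Sigma (spiders M nb p b') ?A) = (\<Sum>\<rho>\<in>spiders M nb p b'. card (?A \<rho>))"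
    using spiders_nb_card(3)[OF _ i(1)] finite_spiders by (intro card_SigmaI) auto
  moreover have "sdeg D d (b' i) - Suc n \<le> card (?A \<rho>)" if "\<rho> \<in> spiders M nb p b'" for \<rho>
  proof -
    have "card (\<rho> ` Pos p b') \<le> Suc n"
      using card_image_le[of "Pos p b'" \<rho>] card_Pos_le[of p b'] n by simp
    moreover have "card (nb (\<rho> (lpos i (b' i)))) - card (\<rho> ` Pos p b') \<le> card (?A \<rho>)"
      by (rule diff_card_le_card_Diff) simp
    ultimately show ?thesis
      using spiders_nb_card(2)[OF that i(1) order_refl] by linarith
  qed
  ultimately have "card (spiders M nb p b') * (sdeg D d (b' i) - Suc n) \<le> card (spiders M nb p b)"
    using sum_bounded_below[of "spiders M nb p b'" "sdeg D d (b' i) - Suc n" "\<lambda>\<rho>. card (?A \<rho>)"] by simp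
  moreover have "sdeg D d (b' i) \<le> 2 * (sdeg D d (b' i) - Suc n)"
    using Suc(2-4) by (auto simp: sdeg_def)
  ultimately have "card (spiders M nb p b') * sdeg D d (b' i) \<le> 2 * card (spiders M nb p b)"
    using mult_le_mono2[of "sdeg D d (b' i)" "2 * (sdeg D d (b' i) - Suc n)" "card (spiders M nb p b')"]
    unfolding mult.left_commute[of _ 2] by linarith
  then have "real (card (spiders M nb p b')) * real (sdeg D d (b' i)) \<le> 2 * real (card (spiders M nb p b))"
    using of_nat_mono[where 'a = real] by fastforce
  then have "2 ^ n * (real (card (spiders M nb p b')) * real (sdeg D d (b' i))) \<le> 2 ^ Suc n * real (card (spiders M nb p b))"
    by simp
  moreover have "real (card M) * weight D d p b \<le> 2 ^ n * (real (card (spiders M nb p b')) * real (sdeg D d (b' i)))"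
    unfolding b weight_upd[OF i(1)] using mult_right_mono[OF IH, of "real (sdeg D d (b' i))"]
    by (simp add: mult.assoc)
  ultimately show ?case using Suc(2) by simp
qed

end

section \<open>Heavy spiders and the cleaning argument\<close>

text \<open>Delete, as long as possible, a whole class of some \<open>\<kappa> i\<close> with fewer
  than \<open>w i\<close> members. Each deletion uses up one value of \<open>\<kappa> i\<close>, so
  all deletions together cost at most the subtracted sum.\<close>

lemma cleaning:
  fixes w :: "'i \<Rightarrow> real" and \<kappa> :: "'i \<Rightarrow> 's \<Rightarrow> 'c"
  assumes "finite S" "finite I" "\<And>i. i \<in> I \<Longrightarrow> 0 \<le> w i"
  shows "\<exists>A\<subseteq>S. real (card S) - (\<Sum>i\<in>I. w i * real (card (\<kappa> i ` S))) \<le> real (card A) \<and>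
    (\<forall>i\<in>I. \<forall>a\<in>A. w i \<le> real (card {a' \<in> A. \<kappa> i a' = \<kappa> i a}))"
  using assms(1)
proof (induction "card S" arbitrary: S rule: less_induct)
  case less
  show ?case
  proof (cases "\<forall>i\<in>I. \<forall>a\<in>S. w i \<le> real (card {a' \<in> S. \<kappa> i a' = \<kappa> i a})")
    case True
    have "0 \<le> (\<Sum>i\<in>I. w i * real (card (\<kappa> i ` S)))"
      using assms(3) by (intro sum_nonneg) auto
    then show ?thesis using True by (intro exI[of _ S]) auto
  next
    case False
    then obtain i a where ia: "i \<in> I" "a \<in> S" "real (card {a' \<in> S. \<kappa> i a' = \<kappa> i a}) < w i"
      by (auto simp: not_le)
    define C where "C = {a' \<in> S. \<kappa> i a' = \<kappa> i a}"
    define S' where "S' = S - C"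
    have C: "C \<subseteq> S" "a \<in> C" "finite C" using less(2) ia by (auto simp: C_def)
    have fin': "finite S'" using less(2) by (simp add: S'_def)
    have cS: "real (card S') = real (card S) - real (card C)"
      unfolding S'_def using C less(2) by (simp add: card_Diff_subset card_mono of_nat_diff)
    have lt: "card S' < card S"
      unfolding S'_def using C less(2) ia(2) by (intro psubset_card_mono) auto
    have mono: "w j * real (card (\<kappa> j ` S')) \<le> w j * real (card (\<kappa> j ` S))" if "j \<in> I" for j
      using assms(3)[OF that] less(2)
      by (intro mult_left_mono) (auto simp: S'_def intro!: card_mono)
    \<comment> \<open>The class is removed entirely, so exactly one value of
      \<open>\<kappa> i\<close> disappears; the other maps can only lose values.\<close>
    have "\<kappa> i ` S' = \<kappa> i ` S - {\<kappa> i a}" by (auto simp: S'_def C_def)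
    then have "real (card (\<kappa> i ` S')) = real (card (\<kappa> i ` S)) - 1"
      using ia(2) less(2) by (simp add: card_Diff_singleton) (metis Suc_pred card_gt_0_iff empty_iff finite_imageI image_eqI of_nat_Suc add_diff_cancel_left')
    then have "w i * real (card (\<kappa> i ` S')) = w i * real (card (\<kappa> i ` S)) - w i"
      by (simp add: right_diff_distrib)
    moreover have "(\<Sum>j\<in>I-{i}. w j * real (card (\<kappa> j ` S'))) \<le> (\<Sum>j\<in>I-{i}. w j * real (card (\<kappa> j ` S)))"
      using mono by (intro sum_mono) auto
    ultimately have "(\<Sum>j\<in>I. w j * real (card (\<kappa> j ` S'))) \<le> (\<Sum>j\<in>I. w j * real (card (\<kappa> j ` S))) - w i"
      using assms(2) ia(1) by (simp add: sum.remove[of I i])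
    then have key: "real (card S) - (\<Sum>j\<in>I. w j * real (card (\<kappa> j ` S)))
        \<le> real (card S') - (\<Sum>j\<in>I. w j * real (card (\<kappa> j ` S')))"
      using cS ia(3) unfolding C_def by linarith
    obtain A where A: "A \<subseteq> S'" "real (card S') - (\<Sum>i\<in>I. w i * real (card (\<kappa> i ` S'))) \<le> real (card A)"
      "\<forall>i\<in>I. \<forall>a\<in>A. w i \<le> real (card {a' \<in> A. \<kappa> i a' = \<kappa> i a})"
      using less(1)[OF lt fin'] by blast
    then show ?thesis using key S'_def by (intro exI[of _ A]) auto
  qed
qed

lemma card_UN_le_bound:
  assumes "finite A" "\<And>x. x \<in> A \<Longrightarrow> card (f x) \<le> c"
  shows "card (\<Union>x\<in>A. f x) \<le> card A * c"
  using card_UN_le[OF assms(1), of f] sum_bounded_above[of A "\<lambda>x. card (f x)" c] assms(2) by force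

section \<open>Reversed legs, and spiders of a class through a given vertex\<close>

lemma snd_lpos [simp]: "snd (lpos i j) = j"
  by (simp add: lpos_def)

lemma in_Pos_1 [simp]: "(i, j) \<in> Pos (Suc 0) b \<longleftrightarrow> i = 0 \<and> j \<le> b 0"
  by (auto simp: Pos_def)

lemma inj_lpos: "inj_on \<sigma> (Pos p b) \<Longrightarrow> i < p \<Longrightarrow> j \<le> b i \<Longrightarrow> j' \<le> b i \<Longrightarrow> \<sigma> (lpos i j) = \<sigma> (lpos i j') \<Longrightarrow> j = j'"
  by (metis inj_onD lpos_in_Pos snd_lpos)

text \<open>The last \<open>m\<close> edges of leg \<open>i\<close>, read from the leaf. Storing
  them as a spider with one leg makes them countable by the lemmas above, and decreasing
  \<open>m\<close> is again a truncation.\<close>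

definition reversed_leg :: "(nat \<Rightarrow> nat) \<Rightarrow> nat \<Rightarrow> nat \<Rightarrow> (nat \<times> nat \<Rightarrow> 'a) \<Rightarrow> nat \<times> nat \<Rightarrow> 'a" where
  "reversed_leg b i m \<sigma> = restrict (\<lambda>q. \<sigma> (lpos i (b i - snd q))) (Pos 1 (\<lambda>_. m))"

lemma reversed_leg_apply [simp]: "j \<le> m \<Longrightarrow> reversed_leg b i m \<sigma> (0, j) = \<sigma> (lpos i (b i - j))"
  by (simp add: reversed_leg_def)

lemma restrict_reversed_leg: "m \<le> m' \<Longrightarrow> restrict (reversed_leg b i m' \<sigma>) (Pos 1 (\<lambda>_. m)) = reversed_leg b i m \<sigma>"
  by (auto simp: reversed_leg_def fun_eq_iff)

lemma growth_even: "growth D d (2 * n) = (D * d) ^ n"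
  by (induction n) (auto simp: growth_Suc sdeg_def)

lemma growth_odd: "growth D d (Suc (2 * n)) = (D * d) ^ n * D"
  by (simp add: growth_Suc growth_even sdeg_def)

text \<open>Links two views of paths: with \<open>fx = True\<close>, a one-legged spider is heavy
  exactly when many paths join its ends.\<close>

lemma key_class_path:
  assumes "\<tau> (0, 0) \<in> S"
  shows "key_class True 1 (\<lambda>_. m) (spiders S nb 1 (\<lambda>_. m)) \<tau> = paths nb m (\<tau> (0, 0)) (\<tau> (0, m))"
  using assms by (auto simp: key_class_def paths_def Keys_def spiders_def lessThan_Suc)

context bireg
begin

lemma reversed_leg_paths:
  assumes "\<sigma> \<in> spiders S nb p b" "i < p" "m \<le> b i"
  shows "reversed_leg b i m \<sigma> \<in> paths nb m (\<sigma> (lpos i (b i))) (\<sigma> (lpos i (b i - m)))"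
proof -
  have "inj_on (reversed_leg b i m \<sigma>) (Pos 1 (\<lambda>_. m))"
  proof (rule inj_onI)
    fix q q' assume a: "q \<in> Pos 1 (\<lambda>_. m)" "q' \<in> Pos 1 (\<lambda>_. m)" "reversed_leg b i m \<sigma> q = reversed_leg b i m \<sigma> q'"
    then obtain j j' where j: "q = (0, j)" "q' = (0, j')" "j \<le> m" "j' \<le> m" by (cases q; cases q') auto
    then have "b i - j = b i - j'"
      using inj_lpos[OF spiders_inj[OF assms(1)] assms(2), of "b i - j" "b i - j'"] a(3) by simp
    then show "q = q'" using j assms(3) by simp
  qed
  moreover have "reversed_leg b i m \<sigma> (0, Suc j) \<in> nb (reversed_leg b i m \<sigma> (0, j))" if "j < m" for j
  proof -
    have e: "Suc (b i - Suc j) = b i - j" using that assms(3) by simp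
    have "\<sigma> (i, Suc (b i - Suc j)) \<in> nb (\<sigma> (lpos i (b i - Suc j)))"
      using spiders_step[OF assms(1,2)] that assms(3) by simp
    then have "\<sigma> (lpos i (b i - j)) \<in> nb (\<sigma> (lpos i (b i - Suc j)))"
      using e by (metis lpos_Suc)
    then show ?thesis using sym that by simp
  qed
  moreover have "reversed_leg b i m \<sigma> \<in> extensional (Pos 1 (\<lambda>_. m))" by (simp add: reversed_leg_def)
  ultimately show ?thesis by (simp add: paths_def spiders_def)
qed

text \<open>Reversal turns walks of odd length from \<open>N\<close> into walks from
  \<open>M\<close>. The two main terms share the factor \<open>(D * d) ^ n\<close>, and
  \<open>balance\<close> with the sides exchanged compares what is left.\<close>

lemma balance_odd:
  assumes "odd a"
  shows "real (card N) * real (growth d D a) \<le> real \<mu> * (real (card M) * real (growth D d a))"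
proof -
  interpret sw: bireg \<mu> N M nb d D by (rule swap)
  obtain n where n: "a = Suc (2 * n)" using assms by (metis oddE Suc_eq_plus1)
  have "card N * growth d D a = (card N * d) * (D * d) ^ n" unfolding n growth_odd by (simp add: ac_simps)
  also have "\<dots> \<le> \<mu> * (card M * D) * (D * d) ^ n" using sw.balance by (rule mult_right_mono) simp
  also have "\<dots> = \<mu> * (card M * growth D d a)" by (simp add: n growth_odd)
  finally show ?thesis by (metis of_nat_le_iff of_nat_mult)
qed

text \<open>A leg is read from its leaf, so that a heavy suffix becomes a heavy prefix; reversing a walk of odd
  length swaps the two sides, which costs a factor \<open>\<mu>\<close>.\<close>

lemma suffix_density:
  assumes i: "i < p" and m: "m \<le> b i" and eps: "0 \<le> \<epsilon>"
    and hM: "real (card {\<tau> \<in> spiders M nb 1 (\<lambda>_. m). K < card (paths nb m (\<tau> (0, 0)) (\<tau> (0, m)))})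
      \<le> \<epsilon> * (spider_total M D d 1 (\<lambda>_. m))"
    and hN: "real (card {\<tau> \<in> spiders N nb 1 (\<lambda>_. m). K < card (paths nb m (\<tau> (0, 0)) (\<tau> (0, m)))})
      \<le> \<epsilon> * (spider_total N d D 1 (\<lambda>_. m))"
  shows "real (card {\<sigma> \<in> spiders M nb p b. K < card (paths nb m (\<sigma> (lpos i (b i))) (\<sigma> (lpos i (b i - m))))})
    \<le> \<epsilon> * real \<mu> ^ b i * real \<mu> * real \<mu> ^ (\<Sum>i<p. b i) * (spider_total M D d p b)"
proof -
  interpret sw: bireg \<mu> N M nb d D by (rule swap)
  define a where "a = b i"
  \<comment> \<open>All other legs are cut to length 0, so that the reversed leg determines the
    spider; they are restored by \<open>dens_ext\<close> at the end.\<close>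
  define b' where "b' = (\<lambda>i'. if i' = i then a else 0)"
  \<comment> \<open>The side that contains the leaf, where the backward reading starts.\<close>
  define S' where "S' = (if even a then M else N)"
  define Y where "Y = {\<tau> \<in> spiders S' nb 1 (\<lambda>_. m). K < card (paths nb m (\<tau> (0, 0)) (\<tau> (0, m)))}"
  define X where "X = {\<rho> \<in> spiders M nb p b'. K < card (paths nb m (\<rho> (lpos i a)) (\<rho> (lpos i (a - m))))}"
  define Z where "Z = {\<tau> \<in> spiders S' nb 1 (\<lambda>_. a). restrict \<tau> (Pos 1 (\<lambda>_. m)) \<in> Y}"
  have b'i [simp]: "b' i = a" by (simp add: b'_def)
  have "inj_on (reversed_leg b' i a) X"
  proof (rule inj_onI)
    fix \<rho> \<rho>' assume a: "\<rho> \<in> X" "\<rho>' \<in> X" "reversed_leg b' i a \<rho> = reversed_leg b' i a \<rho>'"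
    have *: "\<rho> (lpos i j) = \<rho>' (lpos i j)" if "j \<le> a" for j
      using fun_cong[OF a(3), of "(0, a - j)"] that by simp
    show "\<rho> = \<rho>'"
    proof (rule spiders_eqI)
      fix q assume "q \<in> Pos p b'"
      then have "\<exists>j\<le>a. q = lpos i j" by (cases rule: Pos_cases) (auto simp: b'_def lpos_def split: if_splits)
      then show "\<rho> q = \<rho>' q" using * by blast
    qed (use a in \<open>auto simp: X_def\<close>)
  qed
  moreover have "reversed_leg b' i a ` X \<subseteq> Z"
  proof
    fix \<tau> assume "\<tau> \<in> reversed_leg b' i a ` X"
    then obtain \<rho> where r: "\<rho> \<in> X" "\<tau> = reversed_leg b' i a \<rho>" by auto
    then have \<rho>: "\<rho> \<in> spiders M nb p b'" by (simp add: X_def)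
    have side: "\<rho> (lpos i a) \<in> S'" using spiders_side[OF \<rho> subset_refl i, of a] by (simp add: S'_def)
    have in_S': "\<tau> \<in> spiders S' nb 1 (\<lambda>_. l)" if "\<tau> \<in> paths nb l (\<rho> (lpos i a)) z" for \<tau> l z
      using that side by (auto simp: paths_def spiders_def)
    have 1: "\<tau> \<in> spiders S' nb 1 (\<lambda>_. a)"
      using in_S'[OF reversed_leg_paths[OF \<rho> i, of a, simplified]] r(2) by simp
    have 2: "restrict \<tau> (Pos 1 (\<lambda>_. m)) = reversed_leg b' i m \<rho>"
      using m r(2) restrict_reversed_leg[of m a b' i \<rho>] by (simp add: a_def)
    have 3: "reversed_leg b' i m \<rho> \<in> spiders S' nb 1 (\<lambda>_. m)"
      using in_S'[of _ m "\<rho> (lpos i (a - m))"] reversed_leg_paths[OF \<rho> i, of m, simplified] m by (simp add: a_def)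
    have "reversed_leg b' i m \<rho> \<in> Y"
      using 3 r(1) m by (simp add: Y_def X_def a_def)
    then show "\<tau> \<in> Z"
      using 1 2 by (simp only: Z_def mem_Collect_eq)
  qed
  moreover have "finite Z"
    using finite_spiders[of M 1 "\<lambda>_. a"] sw.finite_spiders[of N 1 "\<lambda>_. a"]
    by (cases "even a") (simp_all add: Z_def S'_def)
  ultimately have "card X \<le> card Z" by (rule card_inj_on_le)
  moreover have "real (card Z) \<le> \<epsilon> * real \<mu> ^ a * real \<mu> * (spider_total M D d p b')"
  proof -
    have T: "weight D d p b' = real (growth D d a)"
    proof -
      have "weight D d p b' = (\<Prod>i'<p. if i' = i then real (growth D d a) else 1)"
        unfolding weight_def by (rule prod.cong) (auto simp: b'_def)
      then show ?thesis using i by simp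
    qed
    show ?thesis
    proof (cases "even a")
      case True
      have "real (card Z) \<le> \<epsilon> * real \<mu> ^ a * (real (card M) * real (growth D d a))"
        using dens_ext[of 1 "\<lambda>_. m" "\<lambda>_. a" Y \<epsilon>] hM True m
        by (simp add: Z_def Y_def S'_def a_def weight_1[simplified])
      also have "\<dots> \<le> \<epsilon> * real \<mu> ^ a * real \<mu> * (real (card M) * real (growth D d a))"
        using mult_left_mono[of 1 "real \<mu>" "\<epsilon> * real \<mu> ^ a"] eps mu by (intro mult_right_mono) simp_all
      finally show ?thesis using T by simp
    next
      case False
      have "real (card Z) \<le> \<epsilon> * real \<mu> ^ a * (real (card N) * real (growth d D a))"
        using sw.dens_ext[of 1 "\<lambda>_. m" "\<lambda>_. a" Y \<epsilon>] hN False m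
        by (simp add: Z_def Y_def S'_def a_def weight_1[simplified])
      also have "\<dots> \<le> \<epsilon> * real \<mu> ^ a * (real \<mu> * (real (card M) * real (growth D d a)))"
        using eps balance_odd[OF False] by (intro mult_left_mono) auto
      finally show ?thesis using T by (simp add: mult.assoc)
    qed
  qed
  ultimately have cX: "real (card X) \<le> \<epsilon> * real \<mu> ^ a * real \<mu> * (spider_total M D d p b')"
    by linarith
  have le: "b' i' \<le> b i'" for i' by (simp add: b'_def a_def)
  have "{\<sigma> \<in> spiders M nb p b. K < card (paths nb m (\<sigma> (lpos i (b i))) (\<sigma> (lpos i (b i - m))))}
     \<subseteq> {\<sigma> \<in> spiders M nb p b. restrict \<sigma> (Pos p b') \<in> X}"
  proof
    fix \<sigma> assume s: "\<sigma> \<in> {\<sigma> \<in> spiders M nb p b. K < card (paths nb m (\<sigma> (lpos i (b i))) (\<sigma> (lpos i (b i - m))))}"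
    have "restrict \<sigma> (Pos p b') \<in> spiders M nb p b'"
      using s le by (intro restrict_spiders[of _ _ _ _ b]) auto
    moreover have "restrict \<sigma> (Pos p b') (lpos i j) = \<sigma> (lpos i j)" if "j \<le> a" for j
      using that i by (simp add: lpos_in_Pos)
    ultimately show "\<sigma> \<in> {\<sigma> \<in> spiders M nb p b. restrict \<sigma> (Pos p b') \<in> X}"
      using s by (simp add: X_def a_def)
  qed
  then have "card {\<sigma> \<in> spiders M nb p b. K < card (paths nb m (\<sigma> (lpos i (b i))) (\<sigma> (lpos i (b i - m))))}
     \<le> card {\<sigma> \<in> spiders M nb p b. restrict \<sigma> (Pos p b') \<in> X}"
    using finite_spiders[OF subset_refl] by (intro card_mono) auto
  moreover have "real (card {\<sigma> \<in> spiders M nb p b. restrict \<sigma> (Pos p b') \<in> X})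
    \<le> \<epsilon> * real \<mu> ^ a * real \<mu> * real \<mu> ^ (\<Sum>i<p. b i) * (spider_total M D d p b)"
    using cX le by (intro dens_ext[of p b' b]) (auto simp: X_def)
  ultimately show ?thesis by (simp add: a_def)
qed

lemma finite_paths: "x \<in> M \<union> N \<Longrightarrow> finite (paths nb m x z)"
proof -
  interpret sw: bireg \<mu> N M nb d D by (rule swap)
  assume "x \<in> M \<union> N"
  then have "finite (spiders {x} nb 1 (\<lambda>_. m))" using finite_spiders[of "{x}"] sw.finite_spiders[of "{x}"] by blast
  then show ?thesis by (simp add: paths_def)
qed

text \<open>A spider of the class through \<open>w\<close> splits at \<open>w\<close> into a shorter spider and a path, both with
  prescribed keys.\<close>

lemma card_class_hitting_le:
  assumes S: "\<S> \<subseteq> spiders M nb p b" and p: "0 < p"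
    and trunc: "\<And>\<sigma> i j. \<sigma> \<in> \<S> \<Longrightarrow> i < p \<Longrightarrow> 0 < j \<Longrightarrow> j < b i \<Longrightarrow>
      card (key_class fx p (b(i := j)) (spiders M nb p (b(i := j))) (restrict \<sigma> (Pos p (b(i := j))))) \<le> K"
    and path: "\<And>\<sigma> i m. \<sigma> \<in> \<S> \<Longrightarrow> i < p \<Longrightarrow> 0 < m \<Longrightarrow> m \<le> b i \<Longrightarrow> (fx \<Longrightarrow> m < b i) \<Longrightarrow>
      card (paths nb m (\<sigma> (lpos i (b i))) (\<sigma> (lpos i (b i - m)))) \<le> K"
    and bpos: "\<And>i. i < p \<Longrightarrow> 0 < b i"
    and W: "finite W" "W \<inter> \<sigma>\<^sub>0 ` Keys fx p b = {}"
  shows "card {\<sigma> \<in> key_class fx p b \<S> \<sigma>\<^sub>0. \<sigma> ` Pos p b \<inter> W \<noteq> {}} \<le> card W * (card (Pos p b) * (K^2 + K^p))"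
proof -
  let ?C = "\<lambda>w q. {\<sigma> \<in> key_class fx p b \<S> \<sigma>\<^sub>0. \<sigma> q = w}"
  have finS: "finite \<S>" using S finite_spiders[OF subset_refl] by (rule finite_subset)
  have finK: "finite (key_class fx p b \<S> \<sigma>\<^sub>0)" using finS by (simp add: key_class_def)
  have agree: "\<sigma> q = \<sigma>' q" if "\<sigma> \<in> key_class fx p b \<S> \<sigma>\<^sub>0" "\<sigma>' \<in> key_class fx p b \<S> \<sigma>\<^sub>0" "q \<in> Keys fx p b" for \<sigma> \<sigma>' q
    using that by (simp add: key_class_def)
  have sub: "{\<sigma> \<in> key_class fx p b \<S> \<sigma>\<^sub>0. \<sigma> ` Pos p b \<inter> W \<noteq> {}} \<subseteq> (\<Union>w\<in>W. \<Union>q\<in>Pos p b - Keys fx p b. ?C w q)"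
  proof
    fix \<sigma> assume s: "\<sigma> \<in> {\<sigma> \<in> key_class fx p b \<S> \<sigma>\<^sub>0. \<sigma> ` Pos p b \<inter> W \<noteq> {}}"
    then obtain q where q: "q \<in> Pos p b" "\<sigma> q \<in> W" by auto
    have "q \<notin> Keys fx p b"
    proof
      assume "q \<in> Keys fx p b"
      then have "\<sigma> q = \<sigma>\<^sub>0 q" using s by (simp add: key_class_def)
      then show False using W(2) q \<open>q \<in> Keys fx p b\<close> by auto
    qed
    then show "\<sigma> \<in> (\<Union>w\<in>W. \<Union>q\<in>Pos p b - Keys fx p b. ?C w q)" using s q by auto
  qed
  have bd: "card (?C w q) \<le> K^2 + K^p" if "q \<in> Pos p b - Keys fx p b" for w q
  proof (cases "?C w q = {}")
    case True
    then show ?thesis by (simp only: card.empty)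
  next
    case False
    then obtain \<sigma>\<^sub>1 where s1: "\<sigma>\<^sub>1 \<in> ?C w q" by auto
    then have s1S: "\<sigma>\<^sub>1 \<in> \<S>" "\<sigma>\<^sub>1 \<in> spiders M nb p b" using S by (auto simp: key_class_def)
    have inSP: "\<sigma> \<in> spiders M nb p b" if "\<sigma> \<in> ?C w q" for \<sigma> using that S by (auto simp: key_class_def)
    have leaf: "(i, b i) \<in> Keys fx p b" if "i < p" for i using that by (auto simp: Keys_def)
    have leafeq: "\<sigma> (lpos i (b i)) = \<sigma>\<^sub>1 (lpos i (b i))" if "\<sigma> \<in> ?C w q" "i < p" for \<sigma> i
      using agree[of \<sigma> \<sigma>\<^sub>1 "(i, b i)"] that s1 leaf[OF that(2)] bpos[OF that(2)] by (simp add: lpos_def)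
    have qP: "q \<in> Pos p b" using that by auto
    from qP show ?thesis
    proof (cases rule: Pos_cases)
      case 1
      \<comment> \<open>The hit vertex is the centre. Every leg is then a path from its prescribed
        leaf to this vertex, with at most \<open>K\<close> choices, whence
        \<open>K ^ p\<close>.\<close>
      then have nfx: "\<not> fx" using that by (auto simp: Keys_def)
      let ?f = "\<lambda>\<sigma>. \<lambda>i\<in>{..<p}. reversed_leg b i (b i) \<sigma>"
      let ?R = "\<Pi>\<^sub>E i\<in>{..<p}. paths nb (b i) (\<sigma>\<^sub>1 (lpos i (b i))) (\<sigma>\<^sub>1 (0,0))"
      have "inj_on ?f (?C w q)"
      proof (rule inj_onI)
        fix \<sigma> \<sigma>' assume a: "\<sigma> \<in> ?C w q" "\<sigma>' \<in> ?C w q" "?f \<sigma> = ?f \<sigma>'"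
        have *: "\<sigma> (lpos i j) = \<sigma>' (lpos i j)" if "i < p" "j \<le> b i" for i j
        proof -
          have "reversed_leg b i (b i) \<sigma> = reversed_leg b i (b i) \<sigma>'"
            using fun_cong[OF a(3), of i] that(1) by simp
          then show ?thesis using fun_cong[of _ _ "(0, b i - j)"] that(2)
            by (metis diff_diff_cancel diff_le_self reversed_leg_apply)
        qed
        show "\<sigma> = \<sigma>'"
        proof (rule spiders_eqI[OF inSP[OF a(1)] inSP[OF a(2)]])
          fix q' assume "q' \<in> Pos p b"
          then show "\<sigma> q' = \<sigma>' q'"
          proof (cases rule: Pos_cases)
            case 1
            then show ?thesis using *[OF p, of 0] by simp
          next
            case (2 i j)
            then show ?thesis using *[of i j] by (simp add: lpos_def)
          qed
        qed
      qed
      moreover have "?f ` ?C w q \<subseteq> ?R"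
      proof
        fix g assume "g \<in> ?f ` ?C w q"
        then obtain \<sigma> where s: "\<sigma> \<in> ?C w q" "g = ?f \<sigma>" by auto
        have "reversed_leg b i (b i) \<sigma> \<in> paths nb (b i) (\<sigma>\<^sub>1 (lpos i (b i))) (\<sigma>\<^sub>1 (0,0))" if "i < p" for i
          using reversed_leg_paths[OF inSP[OF s(1)] that order_refl] leafeq[OF s(1) that] s(1) s1 1 by simp
        then show "g \<in> ?R" using s(2) by (simp add: PiE_def)
      qed
      moreover have finp: "finite (paths nb (b i) (\<sigma>\<^sub>1 (lpos i (b i))) (\<sigma>\<^sub>1 (0,0)))" if "i < p" for i
        using spiders_range[OF s1S(2) subset_refl lpos_in_Pos[OF that order_refl]] finite_paths by blast
      then have "finite ?R" by (intro finite_PiE) auto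
      ultimately have "card (?C w q) \<le> card ?R" by (rule card_inj_on_le)
      also have "\<dots> = (\<Prod>i<p. card (paths nb (b i) (\<sigma>\<^sub>1 (lpos i (b i))) (\<sigma>\<^sub>1 (0,0))))"
        by (simp add: card_PiE)
      also have "\<dots> \<le> (\<Prod>i<p. K)"
        using path[OF s1S(1)] nfx bpos by (intro prod_mono) (metis diff_self_eq_0 lessThan_iff order_refl lpos_0 zero_le)
      finally show ?thesis by simp
    next
      case (2 i j)
      \<comment> \<open>The hit vertex is interior to leg \<open>i\<close>. It becomes a leaf of the
        spider cut there, so the cut spider and the remaining suffix both have prescribed keys and
        at most \<open>K\<close> choices each.\<close>
      then have jlt: "j < b i" using that by (auto simp: Keys_def le_less)
      let ?b = "b(i := j)"
      let ?m = "b i - j"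
      have qps: "q = lpos i j" using 2 by (simp add: lpos_def)
      let ?f = "\<lambda>\<sigma>. (restrict \<sigma> (Pos p ?b), reversed_leg b i ?m \<sigma>)"
      let ?R = "key_class fx p ?b (spiders M nb p ?b) (restrict \<sigma>\<^sub>1 (Pos p ?b)) \<times> paths nb ?m (\<sigma>\<^sub>1 (lpos i (b i))) (\<sigma>\<^sub>1 (lpos i (b i - ?m)))"
      have le: "?b i' \<le> b i'" for i' using jlt by simp
      have "inj_on ?f (?C w q)"
      proof (rule inj_onI)
        fix \<sigma> \<sigma>' assume a: "\<sigma> \<in> ?C w q" "\<sigma>' \<in> ?C w q" "?f \<sigma> = ?f \<sigma>'"
        show "\<sigma> = \<sigma>'"
        proof (rule spiders_eqI[OF inSP[OF a(1)] inSP[OF a(2)]])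
          fix q' assume q': "q' \<in> Pos p b"
          show "\<sigma> q' = \<sigma>' q'"
          proof (cases "q' \<in> Pos p ?b")
            case True
            then show ?thesis using a(3) by (metis (no_types, lifting) prod.inject restrict_apply')
          next
            case False
            then have "q' \<noteq> (0, 0)" by auto
            with q' obtain i' j' where j': "i' < p" "0 < j'" "j' \<le> b i'" "q' = (i', j')"
              by (cases rule: Pos_cases) auto
            then have [simp]: "i' = i" using False by (cases "i' = i") (auto simp: in_Pos)
            have "j < j'" using False j' by (simp add: in_Pos)
            moreover have "q' = lpos i j'" using j' by (simp add: lpos_def)
            moreover have "reversed_leg b i ?m \<sigma> (0, b i - j') = reversed_leg b i ?m \<sigma>' (0, b i - j')" using a(3) by simp
            ultimately show ?thesis using j' by simp
          qed
        qed
      qed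
      moreover have "?f ` ?C w q \<subseteq> ?R"
      proof
        fix g assume "g \<in> ?f ` ?C w q"
        then obtain \<sigma> where s: "\<sigma> \<in> ?C w q" "g = ?f \<sigma>" by auto
        have "\<sigma> q' = \<sigma>\<^sub>1 q'" if "q' \<in> Keys fx p ?b" for q'
        proof (cases "q' = (i, j)")
          case True
          then show ?thesis using s s1 2 by simp
        next
          case False
          then have "q' \<in> Keys fx p b" using that by (auto simp: Keys_def split: if_splits)
          then show ?thesis using agree s s1 by blast
        qed
        moreover have "Keys fx p ?b \<subseteq> Pos p ?b" using 2 bpos by (auto simp: Keys_def in_Pos split: if_splits)
        ultimately have 1: "restrict \<sigma> (Pos p ?b) \<in> key_class fx p ?b (spiders M nb p ?b) (restrict \<sigma>\<^sub>1 (Pos p ?b))"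
          using restrict_spiders[OF inSP[OF s(1)], of ?b] le by (auto simp: key_class_def)
        have "\<sigma> (lpos i (b i - ?m)) = \<sigma>\<^sub>1 (lpos i (b i - ?m))"
          using s s1 jlt qps by simp
        then have "reversed_leg b i ?m \<sigma> \<in> paths nb ?m (\<sigma>\<^sub>1 (lpos i (b i))) (\<sigma>\<^sub>1 (lpos i (b i - ?m)))"
          using reversed_leg_paths[OF inSP[OF s(1)] 2(1), of ?m] leafeq[OF s(1) 2(1)] by simp
        then show "g \<in> ?R" using 1 s(2) by simp
      qed
      moreover have "finite ?R"
      proof (rule finite_cartesian_product)
        show "finite (key_class fx p ?b (spiders M nb p ?b) (restrict \<sigma>\<^sub>1 (Pos p ?b)))"
          using finite_spiders[OF subset_refl] by (simp add: key_class_def)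
        show "finite (paths nb ?m (\<sigma>\<^sub>1 (lpos i (b i))) (\<sigma>\<^sub>1 (lpos i (b i - ?m))))"
          using spiders_range[OF s1S(2) subset_refl lpos_in_Pos[OF 2(1) order_refl]] finite_paths by blast
      qed
      ultimately have "card (?C w q) \<le> card ?R" by (rule card_inj_on_le)
      also have "\<dots> \<le> K * K"
        unfolding card_cartesian_product
        using 2 jlt trunc[OF s1S(1) 2(1,2) jlt] path[OF s1S(1) 2(1), of ?m] by (intro mult_le_mono) auto
      finally show ?thesis by (simp add: power2_eq_square)
    qed
  qed
  have "card {\<sigma> \<in> key_class fx p b \<S> \<sigma>\<^sub>0. \<sigma> ` Pos p b \<inter> W \<noteq> {}}
      \<le> card (\<Union>w\<in>W. \<Union>q\<in>Pos p b - Keys fx p b. ?C w q)"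
    using W(1) finK by (intro card_mono sub) auto
  also have "\<dots> \<le> card W * (card (Pos p b - Keys fx p b) * (K^2 + K^p))"
    using W(1) bd by (intro card_UN_le_bound) auto
  also have "\<dots> \<le> card W * (card (Pos p b) * (K^2 + K^p))"
    by (intro mult_le_mono order_refl card_mono) auto
  finally show ?thesis .
qed

end

section \<open>Few heavy spiders, or a robust family\<close>

definition heavy_bound :: "nat \<Rightarrow> (('a \<Rightarrow> 'a set) \<Rightarrow> bool) \<Rightarrow> bool \<Rightarrow> nat \<Rightarrow> (nat \<Rightarrow> nat) \<Rightarrow> real \<Rightarrow> nat \<Rightarrow> nat \<Rightarrow> bool" where
  "heavy_bound \<mu> F fx p b \<epsilon> K C \<longleftrightarrow> (\<forall>M N nb D d. bireg \<mu> M N nb D d \<longrightarrow> F nb \<longrightarrow> C \<le> D \<longrightarrow> C \<le> d \<longrightarrow>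
     real (card (heavy_spiders fx K M nb p b))
       \<le> \<epsilon> * (spider_total M D d p b))"

text \<open>\<open>K\<close> and \<open>C\<close> may depend on \<open>\<epsilon>\<close> but not on
  the graph, since the induction over types asks for a smaller \<open>\<epsilon>\<close> on shorter
  types. \<open>F\<close> is a condition on the neighbourhoods alone and \<open>heavy_bound\<close>
  ranges over all pairs of sides, so each bound is also available with \<open>M\<close> and
  \<open>N\<close> exchanged.\<close>

definition few_heavy :: "nat \<Rightarrow> (('a \<Rightarrow> 'a set) \<Rightarrow> bool) \<Rightarrow> bool \<Rightarrow> nat \<Rightarrow> (nat \<Rightarrow> nat) \<Rightarrow> bool" where
  "few_heavy \<mu> F fx p b \<longleftrightarrow> (\<forall>\<epsilon>>0. \<exists>K C. heavy_bound \<mu> F fx p b \<epsilon> K C)"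

text \<open>The first clause supplies disjoint spiders on one key, hence \<open>W\<close> has to
  miss the key. The second moves a single leaf and keeps everything else. Together they drive the
  lengthening of legs.\<close>

definition robust :: "bool \<Rightarrow> nat \<Rightarrow> (nat \<Rightarrow> nat) \<Rightarrow> nat \<Rightarrow> (nat \<times> nat \<Rightarrow> 'a) set \<Rightarrow> bool" where
  "robust fx p b w \<S> \<longleftrightarrow>
     (\<forall>\<sigma>\<in>\<S>. \<forall>W. finite W \<longrightarrow> card W \<le> w \<longrightarrow> W \<inter> \<sigma> ` Keys fx p b = {} \<longrightarrow>
        (\<exists>\<sigma>'\<in>key_class fx p b \<S> \<sigma>. \<sigma>' ` Pos p b \<inter> W = {})) \<and>
     (\<forall>\<sigma>\<in>\<S>. \<forall>i<p. \<forall>W. finite W \<longrightarrow> card W \<le> w \<longrightarrow> (\<exists>v. v \<notin> W \<and> \<sigma>((i, b i) := v) \<in> \<S>))"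

abbreviation robust_family :: "bool \<Rightarrow> nat \<Rightarrow> 'a set \<Rightarrow> ('a \<Rightarrow> 'a set) \<Rightarrow> nat \<Rightarrow> (nat \<Rightarrow> nat) \<Rightarrow> real \<Rightarrow> bool" where
  "robust_family fx w S nb p b c \<equiv> (\<exists>\<S>\<subseteq>spiders S nb p b. robust fx p b w \<S> \<and> c < real (card \<S>))"

lemma heavy_bound_mono:
  assumes "heavy_bound \<mu> F fx p b \<epsilon> K C" "K \<le> K'" "C \<le> C'"
  shows "heavy_bound \<mu> F fx p b \<epsilon> K' C'"
  unfolding heavy_bound_def
proof (intro allI impI)
  fix M N :: "'a set" and nb D d
  assume a: "bireg \<mu> M N nb D d" "F nb" "C' \<le> D" "C' \<le> d"
  interpret bireg \<mu> M N nb D d by fact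
  have "card (heavy_spiders fx K' M nb p b)
      \<le> card (heavy_spiders fx K M nb p b)"
    using finite_spiders[of M p b] assms(2) by (intro card_mono) auto
  moreover have "real (card (heavy_spiders fx K M nb p b))
       \<le> \<epsilon> * (spider_total M D d p b)"
    using assms(1,3) a unfolding heavy_bound_def by (meson le_trans)
  ultimately show "real (card (heavy_spiders fx K' M nb p b))
       \<le> \<epsilon> * (spider_total M D d p b)" by linarith
qed

lemma few_heavy_uniform:
  assumes "finite Q" "\<And>fx p b. (fx, p, b) \<in> Q \<Longrightarrow> few_heavy \<mu> F fx p b" "0 < \<epsilon>"
  shows "\<exists>K C. \<forall>(fx, p, b)\<in>Q. heavy_bound \<mu> F fx p b \<epsilon> K C"
  using assms(1,2)
proof (induction Q rule: finite_induct)
  case empty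
  then show ?case by auto
next
  case (insert x Q)
  obtain fx p b where x: "x = (fx, p, b)" by (cases x)
  obtain K C where 1: "\<forall>(fx, p, b)\<in>Q. heavy_bound \<mu> F fx p b \<epsilon> K C" using insert by auto
  obtain K' C' where 2: "heavy_bound \<mu> F fx p b \<epsilon> K' C'"
    using insert(4)[of fx p b] x assms(3) unfolding few_heavy_def by auto
  have "\<forall>(fx, p, b)\<in>insert x Q. heavy_bound \<mu> F fx p b \<epsilon> (max K K') (max C C')"
    using 1 2 x heavy_bound_mono by fastforce
  then show ?case by blast
qed

lemma restrict_eq_iff: "restrict f A = restrict g A \<longleftrightarrow> (\<forall>x\<in>A. f x = g x)"
  by (metis restrict_apply' restrict_ext)

text \<open>Truncations and leg suffixes of most heavy spiders are light, so after deleting the exceptions each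
  remaining class with more than a constant number of members cannot be blocked by few vertices.\<close>

lemma few_heavy_or_robust_family:
  fixes \<epsilon> :: real and F :: "('a \<Rightarrow> 'a set) \<Rightarrow> bool"
  assumes p: "0 < p" and bpos: "\<And>i. i < p \<Longrightarrow> 0 < b i" and mu: "1 \<le> \<mu>" and eps: "0 < \<epsilon>"
    and trunc: "\<And>i j. i < p \<Longrightarrow> 0 < j \<Longrightarrow> j < b i \<Longrightarrow> few_heavy \<mu> F fx p (b(i := j))"
    and path: "\<And>i m. i < p \<Longrightarrow> 0 < m \<Longrightarrow> m \<le> b i \<Longrightarrow> (fx \<Longrightarrow> m < b i) \<Longrightarrow> few_heavy \<mu> F True 1 (\<lambda>_. m)"
  shows "\<exists>K C. \<forall>M N nb D d. bireg \<mu> M N nb D d \<longrightarrow> F nb \<longrightarrow> C \<le> D \<longrightarrow> C \<le> d \<longrightarrow>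
     real (card (heavy_spiders fx K M nb p b))
       \<le> \<epsilon> * (spider_total M D d p b) \<or>
     robust_family fx w M nb p b (\<epsilon> / 4 * (spider_total M D d p b))"
proof -
  define B where "B = (\<Sum>i<p. b i)"
  have B: "0 < B" using p bpos by (auto simp: B_def intro!: sum_pos)
  \<comment> \<open>Index sets of the pieces: \<open>Ia\<close> cuts leg \<open>i\<close> at length
    \<open>j\<close>, \<open>Ib\<close> takes its last \<open>m\<close> edges. With
    \<open>fx\<close> the full leg is excluded, since for a path it would be the very type under
    consideration.\<close>
  define Ia where "Ia = {(i, j). i < p \<and> 0 < j \<and> j < b i}"
  define Ib where "Ib = {(i, m). i < p \<and> 0 < m \<and> m \<le> b i \<and> (fx \<longrightarrow> m < b i)}"
  have cSig: "card (Sigma {..<p} (\<lambda>i. {1..b i})) = B" by (simp add: B_def)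
  have sub: "Ia \<subseteq> Sigma {..<p} (\<lambda>i. {1..b i})" "Ib \<subseteq> Sigma {..<p} (\<lambda>i. {1..b i})"
    by (auto simp: Ia_def Ib_def)
  then have fI: "finite Ia" "finite Ib" by (auto intro: finite_subset)
  have cI: "card Ia \<le> B" "card Ib \<le> B"
    using card_mono[OF _ sub(1)] card_mono[OF _ sub(2)] cSig by auto
  \<comment> \<open>There are at most \<open>B\<close> pieces of each kind, and passing from a piece
    to full spiders costs at most \<open>\<mu> ^ (2 * B + 1)\<close>; so each kind spoils a
    proportion of at most \<open>\<epsilon> / 4\<close>.\<close>
  define \<epsilon>1 where "\<epsilon>1 = \<epsilon> / (4 * real B * real \<mu> ^ (2 * B + 1))"
  have e1: "0 < \<epsilon>1" using eps B mu by (simp add: \<epsilon>1_def)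
  define Q where "Q = (\<lambda>(i, j). (fx, p, b(i := j))) ` Ia \<union> (\<lambda>(i, m). (True, 1::nat, \<lambda>_::nat. m)) ` Ib"
  have "few_heavy \<mu> F fx' p' b'" if "(fx', p', b') \<in> Q" for fx' p' b'
    using that trunc path by (auto simp: Q_def Ia_def Ib_def)
  then obtain K1 C1 where KC1: "\<forall>(fx, p, b)\<in>Q. heavy_bound \<mu> F fx p b \<epsilon>1 K1 C1"
    using few_heavy_uniform[of Q \<mu> F \<epsilon>1] fI e1 by (auto simp: Q_def)
  have fa: "heavy_bound \<mu> F fx p (b(i := j)) \<epsilon>1 K1 C1" if "(i, j) \<in> Ia" for i j
    using KC1 that by (force simp: Q_def)
  have fb: "heavy_bound \<mu> F True 1 (\<lambda>_. m) \<epsilon>1 K1 C1" if "(i, m) \<in> Ib" for i m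
    using KC1 that by (force simp: Q_def)
  \<comment> \<open>One more than the number of class members that \<open>w\<close> vertices off the
    key can hit, by \<open>card_class_hitting_le\<close>.\<close>
  define K' where "K' = w * (card (Pos p b) * (K1^2 + K1^p)) + 1"
  define A where "A = w + 1"
  \<comment> \<open>With \<open>T\<close> the spider total, classes of more than \<open>K\<close>
    members number at most \<open>\<mu> ^ B * T / K\<close>; at the price \<open>K'\<close> each,
    cleaning by keys loses at most \<open>\<epsilon> / 8 * T\<close>.\<close>
  obtain K where K: "8 * real K' * real \<mu> ^ B / \<epsilon> < real K" using reals_Archimedean2 by blast
  \<comment> \<open>Deleting a last vertex divides the weight by a degree scale of at least
    \<open>C2\<close>; at the price \<open>A\<close> per truncation, the \<open>p\<close> legs
    together lose at most \<open>\<epsilon> / 8 * T\<close>.\<close>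
  obtain C2 where C2: "8 * real A * real p * real \<mu> ^ B / \<epsilon> < real C2" using reals_Archimedean2 by blast
  define C where "C = max C1 C2"
  have "real (card (heavy_spiders fx K M nb p b))
       \<le> \<epsilon> * (spider_total M D d p b) \<or>
     robust_family fx w M nb p b (\<epsilon> / 4 * (spider_total M D d p b))"
    if br: "bireg \<mu> M N nb D d" and F: "F nb" and CD: "C \<le> D" "C \<le> d" for M N nb D d
  proof (subst disj_imp, rule impI)
    define T where "T = real (card M) * weight D d p b"
    define H where "H = heavy_spiders fx K M nb p b"
    assume "\<not> real (card (heavy_spiders fx K M nb p b))
       \<le> \<epsilon> * (spider_total M D d p b)"
    then have H: "\<epsilon> * T < real (card H)" by (simp add: H_def T_def)
    interpret bireg \<mu> M N nb D d by fact
    interpret sw: bireg \<mu> N M nb d D by (rule swap)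
    note finSP = finite_spiders[OF subset_refl]
    have T0: "0 \<le> T" using weight_pos[OF Dpos dpos, of p b] by (simp add: T_def)
    have C1: "C1 \<le> D" "C1 \<le> d" and C2': "C2 \<le> D" "C2 \<le> d" using CD by (auto simp: C_def)
    have mu1: "1 \<le> real \<mu>" using mu by simp
    define Xa where "Xa = (\<lambda>(i, j). {\<sigma> \<in> spiders M nb p b. K1 <
      card (key_class fx p (b(i := j)) (spiders M nb p (b(i := j))) (restrict \<sigma> (Pos p (b(i := j)))))})"
    define Xb where "Xb = (\<lambda>(i, m). {\<sigma> \<in> spiders M nb p b. K1 < card (paths nb m (\<sigma> (lpos i (b i))) (\<sigma> (lpos i (b i - m))))})"
    have cXa: "real (card (Xa x)) \<le> \<epsilon>1 * real \<mu> ^ (2 * B + 1) * T" if x: "x \<in> Ia" for x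
    proof -
      obtain i j where ij: "x = (i, j)" by (cases x)
      let ?b = "b(i := j)"
      let ?X = "heavy_spiders fx K1 M nb p ?b"
      have "real (card ?X) \<le> \<epsilon>1 * (spider_total M D d p ?b)"
        using fa[of i j] x ij br F C1 unfolding heavy_bound_def by blast
      then have "real (card {\<sigma> \<in> spiders M nb p b. restrict \<sigma> (Pos p ?b) \<in> ?X})
        \<le> \<epsilon>1 * real \<mu> ^ (\<Sum>i<p. b i) * (spider_total M D d p b)"
        using x ij by (intro dens_ext) (auto simp: Ia_def)
      moreover have Xaeq: "Xa x = {\<sigma> \<in> spiders M nb p b. restrict \<sigma> (Pos p ?b) \<in> ?X}"
        using restrict_spiders[of _ M nb p b ?b] x ij by (auto simp: Xa_def Ia_def)
      moreover have "\<epsilon>1 * real \<mu> ^ (\<Sum>i<p. b i) * (spider_total M D d p b) \<le> \<epsilon>1 * real \<mu> ^ (2 * B + 1) * T"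
        using T0 e1 mu1 unfolding T_def B_def
        by (intro mult_right_mono mult_left_mono power_increasing) auto
      ultimately show ?thesis unfolding Xaeq by linarith
    qed
    have cXb: "real (card (Xb x)) \<le> \<epsilon>1 * real \<mu> ^ (2 * B + 1) * T" if x: "x \<in> Ib" for x
    proof -
      obtain i m where im: "x = (i, m)" by (cases x)
      have i: "i < p" "m \<le> b i" using x im by (auto simp: Ib_def)
      have "heavy_bound \<mu> F True 1 (\<lambda>_. m) \<epsilon>1 K1 C1" using fb x im by blast
      then have "real (card (heavy_spiders True K1 M nb 1 (\<lambda>_. m)))
            \<le> \<epsilon>1 * (spider_total M D d 1 (\<lambda>_. m))"
          "real (card (heavy_spiders True K1 N nb 1 (\<lambda>_. m)))
            \<le> \<epsilon>1 * (spider_total N d D 1 (\<lambda>_. m))"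
        using br swap F C1 unfolding heavy_bound_def by blast+
      moreover have "(heavy_spiders True K1 S nb 1 (\<lambda>_. m))
          = {\<tau> \<in> spiders S nb 1 (\<lambda>_. m). K1 < card (paths nb m (\<tau> (0, 0)) (\<tau> (0, m)))}" for S
        by (intro Collect_cong conj_cong refl) (simp only: key_class_path[OF spiders_center])
      ultimately have "real (card (Xb x))
         \<le> \<epsilon>1 * real \<mu> ^ b i * real \<mu> * real \<mu> ^ (\<Sum>i<p. b i) * T"
        unfolding im Xb_def T_def prod.case using suffix_density[of i p m b \<epsilon>1 K1] i e1 by simp
      also have "\<dots> = \<epsilon>1 * real \<mu> ^ (b i + 1 + B) * T"
        by (simp add: power_add B_def)
      also have "\<dots> \<le> \<epsilon>1 * real \<mu> ^ (2 * B + 1) * T"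
      proof -
        have "b i \<le> B" unfolding B_def using i by (intro member_le_sum) auto
        then show ?thesis
          using T0 e1 mu1 by (intro mult_right_mono mult_left_mono power_increasing) auto
      qed
      finally show ?thesis .
    qed
    \<comment> \<open>Heavy spiders all of whose pieces are light. More than
      \<open>\<epsilon> / 2 * T\<close> of them remain, and cleaning removes at most
      \<open>\<epsilon> / 4 * T\<close>.\<close>
    define S0 where "S0 = H - (\<Union>x\<in>Ia. Xa x) - (\<Union>x\<in>Ib. Xb x)"
    have finH: "finite H" using finSP by (simp add: H_def)
    have "real (card (\<Union>x\<in>Ia. Xa x)) \<le> \<epsilon> / 4 * T" "real (card (\<Union>x\<in>Ib. Xb x)) \<le> \<epsilon> / 4 * T"
    proof -
      have *: "real (card (\<Union>x\<in>I. X x)) \<le> \<epsilon> / 4 * T"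
        if "finite I" "card I \<le> B" "\<And>x. x \<in> I \<Longrightarrow> real (card (X x)) \<le> \<epsilon>1 * real \<mu> ^ (2 * B + 1) * T"
        for I and X :: "nat \<times> nat \<Rightarrow> (nat \<times> nat \<Rightarrow> 'a) set"
      proof -
        have "real (card (\<Union>x\<in>I. X x)) \<le> (\<Sum>x\<in>I. real (card (X x)))"
          using card_UN_le[OF that(1), of X] by (metis of_nat_le_iff of_nat_sum)
        also have "\<dots> \<le> real (card I) * (\<epsilon>1 * real \<mu> ^ (2 * B + 1) * T)"
          using sum_bounded_above[of I "\<lambda>x. real (card (X x))"] that(3) by simp
        also have "\<dots> \<le> real B * (\<epsilon>1 * real \<mu> ^ (2 * B + 1) * T)"
          using that(2) e1 T0 by (intro mult_right_mono) auto
        also have "\<dots> = \<epsilon> / 4 * T" using B mu by (simp add: \<epsilon>1_def)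
        finally show ?thesis .
      qed
      show "real (card (\<Union>x\<in>Ia. Xa x)) \<le> \<epsilon> / 4 * T" using fI cI cXa by (intro *) auto
      show "real (card (\<Union>x\<in>Ib. Xb x)) \<le> \<epsilon> / 4 * T" using fI cI cXb by (intro *) auto
    qed
    moreover have "card H \<le> card S0 + card (\<Union>x\<in>Ia. Xa x) + card (\<Union>x\<in>Ib. Xb x)"
    proof -
      have "finite (\<Union>x\<in>Ia. Xa x)" "finite (\<Union>x\<in>Ib. Xb x)"
        using fI finSP by (auto simp: Xa_def Xb_def)
      then have "card H \<le> card (S0 \<union> (\<Union>x\<in>Ia. Xa x) \<union> (\<Union>x\<in>Ib. Xb x))"
        using finH by (intro card_mono) (auto simp: S0_def)
      also have "\<dots> \<le> card S0 + card (\<Union>x\<in>Ia. Xa x) + card (\<Union>x\<in>Ib. Xb x)"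
        by (meson add_le_mono1 card_Un_le le_trans)
      finally show ?thesis .
    qed
    ultimately have cS0: "\<epsilon> / 2 * T < real (card S0)"
      using H by simp
    have S0: "S0 \<subseteq> H" "H \<subseteq> spiders M nb p b" "finite S0" using finH by (auto simp: S0_def H_def)
    \<comment> \<open>\<open>None\<close> classifies by the key, for avoiding vertex sets;
      \<open>Some i\<close> by everything except the leaf of leg \<open>i\<close>, for replacing
      that leaf.\<close>
    define I where "I = insert None (Some ` {..<p})"
    define \<kappa> where "\<kappa> = (\<lambda>x (\<sigma> :: nat \<times> nat \<Rightarrow> 'a). case x of None \<Rightarrow> restrict \<sigma> (Keys fx p b)
      | Some i \<Rightarrow> restrict \<sigma> (Pos p (b(i := b i - 1))))"
    define wt where "wt = (\<lambda>x :: nat option. case x of None \<Rightarrow> real K' | Some i \<Rightarrow> real A)"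
    have cSP: "real (card (spiders M nb p b)) \<le> real \<mu> ^ B * T" using card_spiders_le[of p b] by (simp add: B_def T_def)
    have wN: "wt None * real (card (\<kappa> None ` S0)) \<le> \<epsilon> / 8 * T"
    proof -
      define cl where "cl = (\<lambda>c. {\<sigma> \<in> spiders M nb p b. \<kappa> None \<sigma> = c})"
      have "real K * real (card (\<kappa> None ` S0)) \<le> real (\<Sum>c\<in>\<kappa> None ` S0. card (cl c))"
      proof -
        have "K \<le> card (cl c)" if c: "c \<in> \<kappa> None ` S0" for c
        proof -
          obtain \<sigma> where s: "\<sigma> \<in> S0" "c = \<kappa> None \<sigma>" using c by auto
          have "cl c = key_class fx p b (spiders M nb p b) \<sigma>"
            by (auto simp: cl_def s(2) \<kappa>_def restrict_eq_iff key_class_def)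
          then show ?thesis using s(1) S0(1) by (auto simp: H_def)
        qed
        then show ?thesis
          using sum_bounded_below[of "\<kappa> None ` S0" K "\<lambda>c. card (cl c)"]
          by (metis mult.commute of_nat_id of_nat_le_iff of_nat_mult)
      qed
      also have "(\<Sum>c\<in>\<kappa> None ` S0. card (cl c)) = card (\<Union>c\<in>\<kappa> None ` S0. cl c)"
        using S0(3) finSP by (intro card_UN_disjoint[symmetric]) (auto simp: cl_def)
      also have "real (card (\<Union>c\<in>\<kappa> None ` S0. cl c)) \<le> real (card (spiders M nb p b))"
        using finSP by (intro of_nat_mono card_mono) (auto simp: cl_def)
      finally have *: "real K * real (card (\<kappa> None ` S0)) \<le> real \<mu> ^ B * T" using cSP by linarith
      have "8 * real K' * real \<mu> ^ B * real (card (\<kappa> None ` S0)) \<le> \<epsilon> * real K * real (card (\<kappa> None ` S0))"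
        using K eps by (intro mult_right_mono) (auto simp: field_simps)
      also have "\<dots> \<le> \<epsilon> * (real \<mu> ^ B * T)"
        using * eps by (simp add: mult.assoc)
      finally have "real \<mu> ^ B * (8 * (real K' * real (card (\<kappa> None ` S0)))) \<le> real \<mu> ^ B * (\<epsilon> * T)"
        by (simp add: ac_simps)
      then have "8 * (real K' * real (card (\<kappa> None ` S0))) \<le> \<epsilon> * T"
        using mu1 by (subst (asm) mult_le_cancel_left_pos) auto
      then show ?thesis by (simp add: wt_def)
    qed
    have wS: "wt (Some i) * real (card (\<kappa> (Some i) ` S0)) \<le> \<epsilon> / (8 * real p) * T" if i: "i < p" for i
    proof -
      let ?b = "b(i := b i - 1)"
      have "\<kappa> (Some i) ` S0 \<subseteq> spiders M nb p ?b"
        using restrict_spiders[of _ M nb p b ?b] S0 by (auto simp: \<kappa>_def)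
      then have "real (card (\<kappa> (Some i) ` S0)) \<le> real (card (spiders M nb p ?b))"
        using finSP by (intro of_nat_mono card_mono) auto
      also have "\<dots> \<le> real \<mu> ^ (\<Sum>i<p. ?b i) * (spider_total M D d p ?b)" by (rule card_spiders_le)
      also have "\<dots> \<le> real \<mu> ^ B * (spider_total M D d p ?b)"
        unfolding B_def using mu1 weight_pos[OF Dpos dpos, of p ?b]
        by (intro mult_right_mono power_increasing sum_mono) auto
      finally have 1: "real (card (\<kappa> (Some i) ` S0)) \<le> real \<mu> ^ B * (spider_total M D d p ?b)" .
      have "b = ?b(i := Suc (?b i))" using bpos[OF i] by auto
      then have Tb: "weight D d p b = weight D d p ?b * real (sdeg D d (?b i))" using weight_upd[OF i, of D d ?b] by simp
      have "real C2 \<le> real (sdeg D d (?b i))" using C2' by (simp add: sdeg_def)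
      then have "real C2 * (spider_total M D d p ?b) \<le> real (sdeg D d (?b i)) * (spider_total M D d p ?b)"
        using weight_pos[OF Dpos dpos, of p ?b] by (intro mult_right_mono) auto
      also have "\<dots> = T" unfolding T_def Tb by simp
      finally have 2: "real C2 * (spider_total M D d p ?b) \<le> T" .
      have "real C2 * real (card (\<kappa> (Some i) ` S0)) \<le> real C2 * (real \<mu> ^ B * (spider_total M D d p ?b))"
        using 1 by (rule mult_left_mono) simp
      also have "\<dots> = real \<mu> ^ B * (real C2 * (spider_total M D d p ?b))" by simp
      also have "\<dots> \<le> real \<mu> ^ B * T" using 2 by (rule mult_left_mono) simp
      finally have "real C2 * real (card (\<kappa> (Some i) ` S0)) \<le> real \<mu> ^ B * T" .
      then have "\<epsilon> * (real C2 * real (card (\<kappa> (Some i) ` S0))) \<le> \<epsilon> * (real \<mu> ^ B * T)"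
        using eps by simp
      moreover have "8 * real A * real p * real \<mu> ^ B * real (card (\<kappa> (Some i) ` S0)) \<le> \<epsilon> * real C2 * real (card (\<kappa> (Some i) ` S0))"
        using C2 eps by (intro mult_right_mono) (auto simp: field_simps)
      ultimately have "real \<mu> ^ B * (8 * real p * (real A * real (card (\<kappa> (Some i) ` S0)))) \<le> real \<mu> ^ B * (\<epsilon> * T)"
        by (simp add: ac_simps)
      then have "8 * real p * (real A * real (card (\<kappa> (Some i) ` S0))) \<le> \<epsilon> * T"
        using mu1 by (subst (asm) mult_le_cancel_left_pos) auto
      then show ?thesis using p by (simp add: wt_def field_simps)
    qed
    have "(\<Sum>x\<in>I. wt x * real (card (\<kappa> x ` S0)))
       = wt None * real (card (\<kappa> None ` S0)) + (\<Sum>i<p. wt (Some i) * real (card (\<kappa> (Some i) ` S0)))"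
      unfolding I_def by (subst sum.insert) (auto simp: sum.reindex)
    also have "\<dots> \<le> \<epsilon> / 8 * T + (\<Sum>i<p. \<epsilon> / (8 * real p) * T)"
      using wN wS by (intro add_mono sum_mono) auto
    also have "\<dots> = \<epsilon> / 4 * T" using p by simp
    finally have wsum: "(\<Sum>x\<in>I. wt x * real (card (\<kappa> x ` S0))) \<le> \<epsilon> / 4 * T" .
    obtain \<S> where \<S>: "\<S> \<subseteq> S0" "real (card S0) - (\<Sum>x\<in>I. wt x * real (card (\<kappa> x ` S0))) \<le> real (card \<S>)"
      "\<forall>x\<in>I. \<forall>a\<in>\<S>. wt x \<le> real (card {a' \<in> \<S>. \<kappa> x a' = \<kappa> x a})"
    proof -
      have "\<exists>A\<subseteq>S0. real (card S0) - (\<Sum>i\<in>I. wt i * real (card (\<kappa> i ` S0))) \<le> real (card A) \<and>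
        (\<forall>i\<in>I. \<forall>a\<in>A. wt i \<le> real (card {a' \<in> A. \<kappa> i a' = \<kappa> i a}))"
        by (rule cleaning[OF S0(3)]) (auto simp: I_def wt_def split: option.splits)
      then show ?thesis by (elim exE conjE) (rule that)
    qed
    have card\<S>: "\<epsilon> / 4 * T < real (card \<S>)" using \<S>(2) wsum cS0 by linarith
    have \<S>spiders: "\<S> \<subseteq> spiders M nb p b" using \<S>(1) S0 by blast
    have fin\<S>: "finite \<S>" using \<S>(1) S0(3) by (rule finite_subset)
    have fresh: "\<exists>\<sigma>'\<in>key_class fx p b \<S> \<sigma>. \<sigma>' ` Pos p b \<inter> W = {}"
      if s: "\<sigma> \<in> \<S>" and W: "finite W" "card W \<le> w" "W \<inter> \<sigma> ` Keys fx p b = {}" for \<sigma> W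
    proof (rule ccontr)
      assume n: "\<not> ?thesis"
      have "wt None \<le> real (card {a' \<in> \<S>. \<kappa> None a' = \<kappa> None \<sigma>})" using \<S>(3) s by (auto simp: I_def)
      moreover have "{a' \<in> \<S>. \<kappa> None a' = \<kappa> None \<sigma>} = key_class fx p b \<S> \<sigma>"
        by (auto simp: \<kappa>_def restrict_eq_iff key_class_def)
      ultimately have "K' \<le> card (key_class fx p b \<S> \<sigma>)" by (simp add: wt_def)
      also have "key_class fx p b \<S> \<sigma> = {\<sigma>' \<in> key_class fx p b \<S> \<sigma>. \<sigma>' ` Pos p b \<inter> W \<noteq> {}}" using n by auto
      also have "card \<dots> \<le> card W * (card (Pos p b) * (K1^2 + K1^p))"
      proof (rule card_class_hitting_le[OF \<S>spiders p])
        fix \<tau> i j assume a: "\<tau> \<in> \<S>" "i < p" "0 < j" "j < b i"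
        then have "\<tau> \<notin> Xa (i, j)" using \<S>(1) by (auto simp: S0_def Ia_def)
        then show "card (key_class fx p (b(i := j)) (spiders M nb p (b(i := j))) (restrict \<tau> (Pos p (b(i := j))))) \<le> K1"
          using a \<S>spiders by (auto simp: Xa_def)
      next
        fix \<tau> i m assume a: "\<tau> \<in> \<S>" "i < p" "0 < m" "m \<le> b i" "fx \<Longrightarrow> m < b i"
        then have "\<tau> \<notin> Xb (i, m)" using \<S>(1) by (auto simp: S0_def Ib_def)
        then show "card (paths nb m (\<tau> (lpos i (b i))) (\<tau> (lpos i (b i - m)))) \<le> K1"
          using a \<S>spiders by (auto simp: Xb_def)
      qed (use bpos W in auto)
      also have "\<dots> \<le> w * (card (Pos p b) * (K1^2 + K1^p))" using W(2) by (intro mult_right_mono) auto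
      finally show False by (simp add: K'_def)
    qed
    have repl: "\<exists>v. v \<notin> W \<and> \<sigma>((i, b i) := v) \<in> \<S>"
      if s: "\<sigma> \<in> \<S>" and i: "i < p" and W: "finite W" "card W \<le> w" for \<sigma> i W
    proof -
      let ?P = "Pos p (b(i := b i - 1))"
      define cl where "cl = {a' \<in> \<S>. restrict a' ?P = restrict \<sigma> ?P}"
      have "real A \<le> real (card cl)" using \<S>(3) s i by (auto simp: I_def wt_def \<kappa>_def cl_def)
      then have "w < card cl" by (simp add: A_def)
      \<comment> \<open>Members of the class agree with \<open>\<sigma>\<close> off the leaf, so
        distinct members have distinct leaves.\<close>
      have eq: "a = \<sigma>((i, b i) := a (i, b i))" if a: "a \<in> cl" for a
      proof
        fix q
        have aS: "a \<in> spiders M nb p b" "\<sigma> \<in> spiders M nb p b" using a s \<S>spiders by (auto simp: cl_def)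
        consider "q = (i, b i)" | "q \<in> ?P" "q \<noteq> (i, b i)" | "q \<notin> Pos p b" "q \<noteq> (i, b i)"
        proof -
          have "q \<in> ?P \<or> q = (i, b i)" if "q \<in> Pos p b"
            using that by (cases rule: Pos_cases) (auto simp: in_Pos)
          then show ?thesis using that by blast
        qed
        then show "a q = (\<sigma>((i, b i) := a (i, b i))) q"
        proof cases
          case 2
          then show ?thesis using a by (auto simp: cl_def restrict_eq_iff)
        next
          case 3
          then show ?thesis
            using extensional_arb[OF spiders_ext[OF aS(1)] 3(1)] extensional_arb[OF spiders_ext[OF aS(2)] 3(1)] by simp
        qed simp
      qed
      have "inj_on (\<lambda>a. a (i, b i)) cl" by (rule inj_onI) (metis eq)
      then have "card ((\<lambda>a. a (i, b i)) ` cl) = card cl" by (rule card_image)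
      then have "\<not> (\<lambda>a. a (i, b i)) ` cl \<subseteq> W"
        using card_mono[OF W(1), of "(\<lambda>a. a (i, b i)) ` cl"] W(2) \<open>w < card cl\<close> by linarith
      then obtain a where "a \<in> cl" "a (i, b i) \<notin> W" by auto
      then show ?thesis using eq[of a] by (metis (no_types, lifting) cl_def mem_Collect_eq)
    qed
    have "robust fx p b w \<S>" unfolding robust_def by (intro conjI ballI allI impI fresh repl)
    then show "robust_family fx w M nb p b (\<epsilon> / 4 * (spider_total M D d p b))"
      using \<S>spiders card\<S> unfolding T_def by blast
  qed
  then show ?thesis by blast
qed

section \<open>Embedding subdivisions\<close>

text \<open>A copy of the subdivision in coordinates, phrased through neighbourhoods only so that
  its absence can serve as the condition \<open>F\<close>. \<open>P i j h\<close> is the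
  \<open>h\<close>-th path from \<open>x i\<close> to \<open>y j\<close>; injectivity is asked of
  interior vertices because the ends are shared.\<close>

definition subdivision_embedded :: "('a \<Rightarrow> 'a set) \<Rightarrow> nat \<Rightarrow> nat \<Rightarrow> nat \<Rightarrow> nat \<Rightarrow> bool" where
  "subdivision_embedded nb l s t r \<longleftrightarrow> (\<exists>x y P. inj_on x {..<s} \<and> inj_on y {..<t} \<and> x ` {..<s} \<inter> y ` {..<t} = {} \<and>
     (\<forall>i<s. \<forall>j<t. \<forall>h<r. P i j h 0 = x i \<and> P i j h l = y j \<and>
        (\<forall>m<l. P i j h (Suc m) \<in> nb (P i j h m)) \<and>
        (\<forall>m. 0 < m \<longrightarrow> m < l \<longrightarrow> P i j h m \<notin> x ` {..<s} \<union> y ` {..<t})) \<and>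
     inj_on (\<lambda>(i, j, h, m). P i j h m) ({..<s} \<times> {..<t} \<times> {..<r} \<times> {0<..<l}))"

text \<open>Objects are chosen one after another. At any moment the vertices already used number at
  most \<open>n * c\<close>, which is the size of the sets that every request must be able to
  avoid.\<close>

lemma greedy:
  fixes vs :: "'q \<Rightarrow> 'o \<Rightarrow> 'v set"
  assumes "finite Q" "card Q \<le> n"
    and "\<And>q W. q \<in> Q \<Longrightarrow> finite W \<Longrightarrow> card W \<le> n * c \<Longrightarrow> \<exists>z. Obj q z \<and> vs q z \<inter> W = {}"
    and "\<And>q z. q \<in> Q \<Longrightarrow> Obj q z \<Longrightarrow> finite (vs q z) \<and> card (vs q z) \<le> c"
  shows "\<exists>f. (\<forall>q\<in>Q. Obj q (f q)) \<and> (\<forall>q\<in>Q. \<forall>q'\<in>Q. q \<noteq> q' \<longrightarrow> vs q (f q) \<inter> vs q' (f q') = {})"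
  using assms
proof (induction Q rule: finite_induct)
  case empty
  then show ?case by auto
next
  case (insert q Q)
  have "\<exists>f. (\<forall>q\<in>Q. Obj q (f q)) \<and> (\<forall>q\<in>Q. \<forall>q'\<in>Q. q \<noteq> q' \<longrightarrow> vs q (f q) \<inter> vs q' (f q') = {})"
  proof (rule insert.IH)
    show "card Q \<le> n" using insert(1,2,4) by simp
  qed (use insert(5,6) in auto)
  then obtain f where f: "\<forall>q\<in>Q. Obj q (f q)" "\<forall>q\<in>Q. \<forall>q'\<in>Q. q \<noteq> q' \<longrightarrow> vs q (f q) \<inter> vs q' (f q') = {}"
    by blast
  define W where "W = (\<Union>q'\<in>Q. vs q' (f q'))"
  have W: "finite W" "card W \<le> card Q * c"
    unfolding W_def using insert(1,6) f(1) by (auto intro!: card_UN_le_bound)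
  have "card Q * c \<le> n * c" using insert(1,2,4) by (intro mult_right_mono) auto
  then have "card W \<le> n * c" using W(2) by linarith
  then obtain z where z: "Obj q z" "vs q z \<inter> W = {}" using insert(5)[of q W] W(1) by blast
  have "\<forall>q'\<in>insert q Q. Obj q' ((f(q := z)) q')" using f(1) z(1) by simp
  moreover have "vs q' ((f(q := z)) q') \<inter> vs q'' ((f(q := z)) q'') = {}"
    if "q' \<in> insert q Q" "q'' \<in> insert q Q" "q' \<noteq> q''" for q' q''
    using that f(2) z(2) insert(2) by (auto simp: W_def)
  ultimately show ?case by (intro exI[of _ "f(q := z)"]) blast
qed

lemma inj_on_quadruplesI:
  assumes "\<And>i j h m i' j' h' m'. i \<in> A \<Longrightarrow> j \<in> B \<Longrightarrow> h \<in> C \<Longrightarrow> m \<in> E \<Longrightarrow>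
    i' \<in> A \<Longrightarrow> j' \<in> B \<Longrightarrow> h' \<in> C \<Longrightarrow> m' \<in> E \<Longrightarrow> P i j h m = P i' j' h' m' \<Longrightarrow>
    i = i' \<and> j = j' \<and> h = h' \<and> m = m'"
  shows "inj_on (\<lambda>(i, j, h, m). P i j h m) (A \<times> B \<times> C \<times> E)"
proof (rule inj_onI)
  fix a a' assume a: "a \<in> A \<times> B \<times> C \<times> E" "a' \<in> A \<times> B \<times> C \<times> E"
    "(case a of (i, j, h, m) \<Rightarrow> P i j h m) = (case a' of (i, j, h, m) \<Rightarrow> P i j h m)"
  obtain i j h m i' j' h' m' where "a = (i, j, h, m)" "a' = (i', j', h', m')"
    by (cases a, cases a') auto
  then show "a = a'" using a assms[of i j h m i' j' h' m'] by simp
qed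

definition robustly_connected :: "('a \<Rightarrow> 'a set) \<Rightarrow> nat \<Rightarrow> nat \<Rightarrow> 'a \<Rightarrow> 'a \<Rightarrow> bool" where
  "robustly_connected nb l w x y \<longleftrightarrow> (\<forall>W. finite W \<longrightarrow> card W \<le> w \<longrightarrow> x \<notin> W \<longrightarrow> y \<notin> W \<longrightarrow>
     (\<exists>R\<in>paths nb l x y. R ` Pos 1 (\<lambda>_. l) \<inter> W = {}))"

text \<open>The \<open>s * t * r\<close> paths are chosen greedily and only their interiors, at most
  \<open>l\<close> vertices each, are reserved. The other branch vertices are added to the forbidden
  set, whence the summands \<open>s + t\<close>.\<close>

lemma robustly_connected_subdivision_embedded:
  fixes nb :: "'a \<Rightarrow> 'a set"
  assumes fin: "finite X" "finite Y" and card: "card X = s" "card Y = t" and disj: "X \<inter> Y = {}"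
    and robustly_connected: "\<And>x y. x \<in> X \<Longrightarrow> y \<in> Y \<Longrightarrow> robustly_connected nb l w x y"
    and w: "s * t * r * l + s + t \<le> w"
  shows "subdivision_embedded nb l s t r"
proof -
  obtain x where x: "bij_betw x {..<s} X" using ex_bij_betw_nat_finite[OF fin(1)] card by (auto simp: lessThan_atLeast0)
  obtain y where y: "bij_betw y {..<t} Y" using ex_bij_betw_nat_finite[OF fin(2)] card by (auto simp: lessThan_atLeast0)
  have xX: "x ` {..<s} = X" and yY: "y ` {..<t} = Y" and ix: "inj_on x {..<s}" and iy: "inj_on y {..<t}"
    using x y by (auto simp: bij_betw_def)
  define Q where "Q = {..<s} \<times> {..<t} \<times> {..<r}"
  define Obj where "Obj = (\<lambda>(i, j, h :: nat) R. R \<in> paths nb l (x i) (y j) \<and>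
    R ` Pos 1 (\<lambda>_. l) \<inter> ((X \<union> Y) - {x i, y j}) = {})"
  define vs where "vs = (\<lambda>(q :: nat \<times> nat \<times> nat) (R :: nat \<times> nat \<Rightarrow> 'a). R ` (Pair 0 ` {0<..<l}))"
  have in_paths: "R (0, 0) = x' \<and> R (0, l) = y' \<and> inj_on R (Pos 1 (\<lambda>_. l)) \<and> (\<forall>m<l. R (0, Suc m) \<in> nb (R (0, m)))"
    if "R \<in> paths nb l x' y'" for R x' y'
    using that by (auto simp: paths_def spiders_def)
  have inj_paths: "R (0, m) = R (0, m') \<longleftrightarrow> m = m'" if "R \<in> paths nb l x' y'" "m \<le> l" "m' \<le> l" for R x' y' m m'
    using inj_on_eq_iff[of R "Pos 1 (\<lambda>_. l)" "(0, m)" "(0, m')"] in_paths[OF that(1)] that by auto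
  have int: "R (0, m) \<notin> {x', y'}" if "R \<in> paths nb l x' y'" "0 < m" "m < l" for R x' y' m
    using in_paths[OF that(1)] inj_paths[OF that(1), of m 0] inj_paths[OF that(1), of m l] that by auto
  have "\<exists>f. (\<forall>q\<in>Q. Obj q (f q)) \<and> (\<forall>q\<in>Q. \<forall>q'\<in>Q. q \<noteq> q' \<longrightarrow> vs q (f q) \<inter> vs q' (f q') = {})"
  proof (rule greedy)
    show "finite Q" "card Q \<le> s * t * r" by (auto simp: Q_def)
  next
    fix q :: "nat \<times> nat \<times> nat" and W :: "'a set" assume a: "q \<in> Q" "finite W" "card W \<le> s * t * r * l"
    obtain i j h where q: "q = (i, j, h)" "i < s" "j < t" "h < r" using a(1) by (auto simp: Q_def)
    \<comment> \<open>The two ends are exempt because \<open>robustly_connected\<close> only speaks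
      of sets that miss them.\<close>
    define W' where "W' = (W \<union> X \<union> Y) - {x i, y j}"
    have "card W' \<le> card (W \<union> X \<union> Y)" unfolding W'_def using a fin by (intro card_mono) auto
    also have "\<dots> \<le> card W + card X + card Y" by (meson add_le_mono1 card_Un_le le_trans)
    finally have "card W' \<le> w" using a(3) w card by simp
    moreover have "finite W'" "x i \<notin> W'" "y j \<notin> W'" using a fin by (auto simp: W'_def)
    moreover have "robustly_connected nb l w (x i) (y j)" using robustly_connected xX yY q by auto
    ultimately obtain R where R: "R \<in> paths nb l (x i) (y j)" "R ` Pos 1 (\<lambda>_. l) \<inter> W' = {}"
      unfolding robustly_connected_def by blast
    have "Obj q R" using R by (auto simp: Obj_def q W'_def)
    moreover have "vs q R \<inter> W = {}"
    proof (rule ccontr)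
      assume "vs q R \<inter> W \<noteq> {}"
      then obtain m where m: "0 < m" "m < l" "R (0, m) \<in> W" by (auto simp: vs_def)
      then have "R (0, m) \<in> W'" using int[OF R(1) m(1,2)] by (simp add: W'_def)
      moreover have "(0, m) \<in> Pos 1 (\<lambda>_. l)" using m by simp
      ultimately show False using R(2) by blast
    qed
    ultimately show "\<exists>z. Obj q z \<and> vs q z \<inter> W = {}" by blast
  next
    fix q :: "nat \<times> nat \<times> nat" and R assume "q \<in> Q" "Obj q R"
    have "card (vs q R) \<le> card {0<..<l}"
      unfolding vs_def by (meson card_image_le finite_greaterThanLessThan finite_imageI le_trans)
    then show "finite (vs q R) \<and> card (vs q R) \<le> l" by (auto simp: vs_def)
  qed
  then obtain f where f: "\<forall>q\<in>Q. Obj q (f q)" "\<forall>q\<in>Q. \<forall>q'\<in>Q. q \<noteq> q' \<longrightarrow> vs q (f q) \<inter> vs q' (f q') = {}"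
    by blast
  define P where "P = (\<lambda>i j h m. f (i, j, h) (0 :: nat, m))"
  have path: "f (i, j, h) \<in> paths nb l (x i) (y j)"
    "f (i, j, h) ` Pos 1 (\<lambda>_. l) \<inter> ((X \<union> Y) - {x i, y j}) = {}" if "i < s" "j < t" "h < r" for i j h
    using f(1) that by (auto simp: Q_def Obj_def)
  have out: "P i j h m \<notin> X \<union> Y" if a: "i < s" "j < t" "h < r" "0 < m" "m < l" for i j h m
  proof
    assume "P i j h m \<in> X \<union> Y"
    then have "P i j h m \<in> (X \<union> Y) - {x i, y j}"
      using int[OF path(1)[OF a(1-3)] a(4,5)] by (simp add: P_def)
    moreover have "(0, m) \<in> Pos 1 (\<lambda>_. l)" using a by simp
    ultimately show False using path(2)[OF a(1-3)] unfolding P_def by blast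
  qed
  have inj: "inj_on (\<lambda>(i, j, h, m). P i j h m) ({..<s} \<times> {..<t} \<times> {..<r} \<times> {0<..<l})"
  proof (rule inj_on_quadruplesI)
    fix i j h m i' j' h' m'
    assume "i \<in> {..<s}" "j \<in> {..<t}" "h \<in> {..<r}" "m \<in> {0<..<l}"
      "i' \<in> {..<s}" "j' \<in> {..<t}" "h' \<in> {..<r}" "m' \<in> {0<..<l}" "P i j h m = P i' j' h' m'"
    then have a: "i < s" "j < t" "h < r" "m \<in> {0<..<l}" "i' < s" "j' < t" "h' < r" "m' \<in> {0<..<l}"
      "P i j h m = P i' j' h' m'" by auto
    have "P i j h m \<in> vs (i, j, h) (f (i, j, h))" "P i' j' h' m' \<in> vs (i', j', h') (f (i', j', h'))"
      unfolding vs_def P_def using a(4,8) by blast+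
    then have eq: "(i, j, h) = (i', j', h')" using f(2) a by (force simp: Q_def)
    then have "m = m'" using a inj_paths[OF path(1)[OF a(1-3)], of m m'] by (simp add: P_def)
    then show "i = i' \<and> j = j' \<and> h = h' \<and> m = m'" using eq by simp
  qed
  show ?thesis
    unfolding subdivision_embedded_def
  proof (rule exI[of _ x], rule exI[of _ y], rule exI[of _ P], intro conjI ix iy inj allI impI)
    show "x ` {..<s} \<inter> y ` {..<t} = {}" using disj xX yY by simp
  qed (use path(1)[THEN in_paths] out xX yY in \<open>auto simp: P_def\<close>)
qed

text \<open>Greedy choice of \<open>t\<close> spiders on the common leaves \<open>x\<close>: their
  centres become the other branch vertices, and their legs, read from leaf to centre, the paths.
  Only non-leaf positions are reserved, at most \<open>Suc (s * l)\<close> per spider.\<close>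

lemma (in bireg) spiders_subdivision_embedded:
  assumes s: "0 < s" and l: "0 < l" and x: "inj_on x {..<s}"
    and ex: "\<And>W. finite W \<Longrightarrow> card W \<le> w \<Longrightarrow> W \<inter> x ` {..<s} = {} \<Longrightarrow>
      \<exists>R\<in>spiders M nb s (\<lambda>_. l). (\<forall>i<s. R (i, l) = x i) \<and> R ` Pos s (\<lambda>_. l) \<inter> W = {}"
    and w: "t * Suc (s * l) \<le> w"
  shows "subdivision_embedded nb l s t 1"
proof -
  define Lf where "Lf = (\<lambda>i :: nat. (i, l)) ` {..<s}"
  define Obj where "Obj = (\<lambda>(j :: nat) R. R \<in> spiders M nb s (\<lambda>_. l) \<and> (\<forall>i<s. R (i, l) = x i))"
  define vs where "vs = (\<lambda>(j :: nat) (R :: nat \<times> nat \<Rightarrow> 'a). R ` (Pos s (\<lambda>_. l) - Lf))"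
  have leafP: "(i, l) \<in> Pos s (\<lambda>_. l)" if "i < s" for i using that l by (simp add: in_Pos)
  have noleaf: "R q \<notin> x ` {..<s}" if "Obj j R" "q \<in> Pos s (\<lambda>_. l) - Lf" for j R q
  proof
    assume "R q \<in> x ` {..<s}"
    then obtain i where "i < s" "R q = x i" by auto
    then have i: "i < s" "R q = R (i, l)" using that(1) by (auto simp: Obj_def)
    have "inj_on R (Pos s (\<lambda>_. l))" using that(1) by (auto simp: Obj_def spiders_inj)
    then have "q = (i, l)" using i that(2) leafP[OF i(1)] by (meson DiffD1 inj_onD)
    then show False using that(2) i by (auto simp: Lf_def)
  qed
  have "\<exists>f. (\<forall>j\<in>{..<t}. Obj j (f j)) \<and> (\<forall>j\<in>{..<t}. \<forall>j'\<in>{..<t}. j \<noteq> j' \<longrightarrow> vs j (f j) \<inter> vs j' (f j') = {})"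
  proof (rule greedy[where n = t and c = "Suc (s * l)"])
    fix j :: nat and W :: "'a set" assume a: "finite W" "card W \<le> t * Suc (s * l)"
    have "card (W - x ` {..<s}) \<le> w" using a w by (meson card_Diff_subset_Int card_mono Diff_subset le_trans)
    then obtain R where R: "R \<in> spiders M nb s (\<lambda>_. l)" "\<forall>i<s. R (i, l) = x i"
      "R ` Pos s (\<lambda>_. l) \<inter> (W - x ` {..<s}) = {}"
      using ex[of "W - x ` {..<s}"] a by blast
    then have O: "Obj j R" by (simp add: Obj_def)
    moreover have "vs j R \<inter> W = {}"
      using noleaf[OF O] R(3) by (fastforce simp: vs_def)
    ultimately show "\<exists>z. Obj j z \<and> vs j z \<inter> W = {}" by blast
  next
    fix j :: nat and R assume "Obj j R"
    have "card (vs j R) \<le> card (Pos s (\<lambda>_. l))"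
      unfolding vs_def by (meson Diff_subset card_image_le card_mono finite_Diff finite_Pos le_trans)
    then show "finite (vs j R) \<and> card (vs j R) \<le> Suc (s * l)"
      using card_Pos_le[of s "\<lambda>_. l"] by (simp add: vs_def)
  qed auto
  then obtain f where f: "\<And>j. j < t \<Longrightarrow> Obj j (f j)"
    "\<And>j j'. j < t \<Longrightarrow> j' < t \<Longrightarrow> j \<noteq> j' \<Longrightarrow> vs j (f j) \<inter> vs j' (f j') = {}"
    by blast
  define y where "y = (\<lambda>j. f j (0, 0))"
  define P where "P = (\<lambda>i j (h :: nat) m. f j (lpos i (l - m)))"
  have fSP: "f j \<in> spiders M nb s (\<lambda>_. l)" "i < s \<Longrightarrow> f j (i, l) = x i" if "j < t" for i j
    using f(1)[OF that] by (auto simp: Obj_def)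
  have ninL: "lpos i m \<notin> Lf" if "m < l" for i m
    using that l by (auto simp: Lf_def lpos_def split: if_splits)
  have inV: "f j (lpos i m) \<in> vs j (f j)" if "j < t" "i < s" "m < l" for i j m
    using that ninL[OF that(3)] by (auto simp: vs_def lpos_in_Pos)
  have uniq: "j = j'" if "j < t" "j' < t" "i < s" "i' < s" "m < l" "m' < l" "f j (lpos i m) = f j' (lpos i' m')" for i i' j j' m m'
    using f(2)[OF that(1,2)] inV[OF that(1,3,5)] inV[OF that(2,4,6)] that(7) by (metis disjoint_iff)
  have iy: "inj_on y {..<t}"
  proof (rule inj_onI)
    fix j j' assume "j \<in> {..<t}" "j' \<in> {..<t}" "y j = y j'"
    then show "j = j'" using uniq[of j j' 0 0 0 0] s l by (simp add: y_def)
  qed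
  have nx: "f j (lpos i m) \<notin> x ` {..<s}" if "j < t" "i < s" "m < l" for i j m
    using noleaf[OF f(1)[OF that(1)], of "lpos i m"] ninL[OF that(3)] that by (simp add: lpos_in_Pos)
  have ny: "f j (lpos i m) \<notin> y ` {..<t}" if "j < t" "i < s" "0 < m" "m < l" for i j m
  proof
    assume "f j (lpos i m) \<in> y ` {..<t}"
    then obtain j' where j': "j' < t" "f j (lpos i m) = f j' (lpos 0 0)" by (auto simp: y_def)
    then have "j = j'" using uniq[of j j' i 0 m 0] that s l by simp
    then have "lpos i m = (0, 0)"
      using j' that spiders_inj[OF fSP(1)[OF that(1)]] by (auto simp: inj_on_eq_iff lpos_in_Pos)
    then show False using that by (simp add: lpos_def)
  qed
  show ?thesis
    unfolding subdivision_embedded_def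
  proof (rule exI[of _ x], rule exI[of _ y], rule exI[of _ P], intro conjI x iy allI impI)
    have yx: "y j \<notin> x ` {..<s}" if "j < t" for j using nx[OF that s l] by (simp add: y_def)
    show "x ` {..<s} \<inter> y ` {..<t} = {}"
    proof (rule equals0I)
      fix v assume v: "v \<in> x ` {..<s} \<inter> y ` {..<t}"
      then obtain j where "j < t" "v = y j" by auto
      then show False using yx[of j] v by simp
    qed
  next
    fix i j h assume a: "i < s" "j < t" "h < (1::nat)"
    show "P i j h 0 = x i" using fSP[OF a(2)] a l by (simp add: P_def lpos_def)
    show "P i j h l = y j" by (simp add: P_def y_def)
  next
    fix i j h m assume a: "i < s" "j < t" "h < (1::nat)" "m < l"
    have e: "Suc (l - Suc m) = l - m" using a by simp
    have "f j (i, Suc (l - Suc m)) \<in> nb (f j (lpos i (l - Suc m)))"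
      using spiders_step[OF fSP(1)[OF a(2)] a(1)] a by simp
    then have "f j (lpos i (l - m)) \<in> nb (f j (lpos i (l - Suc m)))" using e by (metis lpos_Suc)
    then show "P i j h (Suc m) \<in> nb (P i j h m)" using sym by (simp add: P_def)
  next
    fix i j h m assume a: "i < s" "j < t" "h < (1::nat)" "0 < m" "m < l"
    show "P i j h m \<notin> x ` {..<s} \<union> y ` {..<t}"
      using nx[of j i "l - m"] ny[of j i "l - m"] a by (simp add: P_def)
  next
    show "inj_on (\<lambda>(i, j, h, m). P i j h m) ({..<s} \<times> {..<t} \<times> {..<1} \<times> {0<..<l})"
    proof (rule inj_on_quadruplesI)
      fix i j h m i' j' h' m'
      assume "i \<in> {..<s}" "j \<in> {..<t}" "h \<in> {..<1::nat}" "m \<in> {0<..<l}"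
        "i' \<in> {..<s}" "j' \<in> {..<t}" "h' \<in> {..<1::nat}" "m' \<in> {0<..<l}" "P i j h m = P i' j' h' m'"
      then have a: "i < s" "j < t" "h < 1" "m \<in> {0<..<l}" "i' < s" "j' < t" "h' < 1" "m' \<in> {0<..<l}"
        "P i j h m = P i' j' h' m'" by auto
      have j: "j = j'" using uniq[of j j' i i' "l - m" "l - m'"] a by (simp add: P_def)
      have "lpos i (l - m) = lpos i' (l - m')"
        using a j spiders_inj[OF fSP(1)[OF a(2)]] by (auto simp: P_def inj_on_eq_iff lpos_in_Pos)
      then have "i = i' \<and> l - m = l - m'" using a by (auto simp: lpos_def split: if_splits)
      then show "i = i' \<and> j = j' \<and> h = h' \<and> m = m'" using a j by auto
    qed
  qed
qed

text \<open>A leg grows by two: take a fresh spider with the same key, replace the leaf \<open>z\<close> of leg \<open>i\<close> by some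
  \<open>v\<close> with the same predecessor \<open>u\<close>, continue from the new key, and append \<open>u, z\<close> to the result.\<close>

lemma (in bireg) zigzag:
  assumes rob: "robust fx p b w \<S>" and SS: "\<S> \<subseteq> spiders M nb p b"
    and bpos: "\<And>i. i < p \<Longrightarrow> 0 < b i" and fx2: "\<And>i. fx \<Longrightarrow> i < p \<Longrightarrow> 2 \<le> b i"
    and "\<sigma> \<in> \<S>" "finite W" "card W + 2 * (\<Sum>i<p. m i) + card (Pos p b) \<le> w" "W \<inter> \<sigma> ` Keys fx p b = {}"
  shows "\<exists>\<rho>\<in>spiders M nb p (\<lambda>i. b i + 2 * m i). \<rho> ` Pos p (\<lambda>i. b i + 2 * m i) \<inter> W = {} \<and>
    (\<forall>i<p. \<rho> (i, b i + 2 * m i) = \<sigma> (i, b i)) \<and> (fx \<longrightarrow> \<rho> (0, 0) = \<sigma> (0, 0))"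
  using assms(5-)
proof (induction "\<Sum>i<p. m i" arbitrary: m \<sigma> W)
  case 0
  then have m0: "m i = 0" if "i < p" for i using that by simp
  have "card W \<le> w" using 0 by simp
  then obtain \<sigma>' where s': "\<sigma>' \<in> key_class fx p b \<S> \<sigma>" "\<sigma>' ` Pos p b \<inter> W = {}"
    using rob 0 unfolding robust_def by blast
  have P: "Pos p (\<lambda>i. b i + 2 * m i) = Pos p b" by (rule Pos_cong) (simp add: m0)
  have "\<sigma>' \<in> spiders M nb p (\<lambda>i. b i + 2 * m i)"
    using spiders_cong[of p "\<lambda>i. b i + 2 * m i" b M nb] m0 s'(1) SS by (auto simp: key_class_def)
  then show ?case using s' P m0 by (intro bexI[of _ \<sigma>']) (auto simp: key_class_def Keys_def)
next
  case (Suc n)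
  obtain i where i: "i < p" "m i \<noteq> 0"
    using sum_neq_0_ex[of m p] Suc(2)[symmetric] by (metis nat.distinct(1))
  define m' where "m' = m(i := m i - 1)"
  have n: "n = (\<Sum>i<p. m' i)" using sum_upd_pred[of i p m, OF i] Suc(2) unfolding m'_def by linarith
  have "card W \<le> w" using Suc by simp
  then obtain \<sigma>' where s': "\<sigma>' \<in> key_class fx p b \<S> \<sigma>" "\<sigma>' ` Pos p b \<inter> W = {}"
    using rob Suc(3,4,6) unfolding robust_def by blast
  then have s'S: "\<sigma>' \<in> \<S>" "\<sigma>' \<in> spiders M nb p b" using SS by (auto simp: key_class_def)
  have agree: "\<sigma>' q = \<sigma> q" if "q \<in> Keys fx p b" for q using s'(1) that by (simp add: key_class_def)
  have leaf: "(i', b i') \<in> Keys fx p b" if "i' < p" for i' using that by (auto simp: Keys_def)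
  have LPP: "Keys fx p b \<subseteq> Pos p b" using bpos by (auto simp: Keys_def in_Pos)
  define qu where "qu = lpos i (b i - 1)"
  define u where "u = \<sigma>' qu"
  define z where "z = \<sigma>' (i, b i)"
  have qP: "qu \<in> Pos p b" "(i, b i) \<in> Pos p b"
    using i bpos[OF i(1)] by (auto simp: qu_def lpos_in_Pos in_Pos)
  have qne: "qu \<noteq> (i, b i)" using bpos[OF i(1)] by (auto simp: qu_def lpos_def)
  \<comment> \<open>The predecessor \<open>u\<close> will be forbidden from now on, so it must not
    belong to the key. With \<open>fx\<close> the key contains the centre, and
    \<open>2 \<le> b i\<close> keeps \<open>u\<close> away from it.\<close>
  have quLP: "qu \<notin> Keys fx p b"
  proof (cases "b i - 1 = 0")
    case True
    then have "\<not> fx" using fx2[OF _ i(1)] by fastforce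
    then show ?thesis using True bpos[of 0] by (auto simp: qu_def Keys_def)
  next
    case False
    then show ?thesis by (auto simp: qu_def lpos_def Keys_def)
  qed
  have inj': "inj_on \<sigma>' (Pos p b)" using spiders_inj[OF s'S(2)] .
  have uz: "u \<noteq> z" using inj_on_eq_iff[OF inj' qP] qne by (simp add: u_def z_def)
  have zu: "z \<in> nb u"
    using spiders_step[OF s'S(2) i(1), of "b i - 1"] bpos[OF i(1)] by (simp add: z_def u_def qu_def)
  have "card (W \<union> \<sigma>' ` Pos p b) \<le> card W + card (Pos p b)"
    using card_Un_le[of W "\<sigma>' ` Pos p b"] card_image_le[of "Pos p b" \<sigma>'] by simp
  then have "card (W \<union> \<sigma>' ` Pos p b) \<le> w" using Suc(5) by simp
  then obtain v where v: "v \<notin> W \<union> \<sigma>' ` Pos p b" "\<sigma>'((i, b i) := v) \<in> \<S>"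
    using rob s'S(1) i(1) Suc(4) finite_Pos unfolding robust_def by (meson finite_UnI finite_imageI)
  define \<sigma>'' where "\<sigma>'' = \<sigma>'((i, b i) := v)"
  have s''spiders: "\<sigma>'' \<in> spiders M nb p b" using v(2) SS by (auto simp: \<sigma>''_def)
  have "v \<in> nb u"
    using spiders_step[OF s''spiders i(1), of "b i - 1"] bpos[OF i(1)] qne by (simp add: \<sigma>''_def u_def qu_def)
  then have uv: "u \<in> nb v" by (rule sym)
  \<comment> \<open>\<open>u\<close> and \<open>z\<close> are reserved for the end of leg
    \<open>i\<close>; they account for the budget of 2 per unit of \<open>m i\<close>.\<close>
  define W' where "W' = W \<union> {z, u}"
  have W': "finite W'" "card W' + 2 * (\<Sum>i<p. m' i) + card (Pos p b) \<le> w"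
  proof -
    show "finite W'" using Suc(4) by (simp add: W'_def)
    have "card {z, u} \<le> 2" by (simp add: card_insert_if)
    then have "card W' \<le> card W + 2" unfolding W'_def using card_Un_le[of W "{z, u}"] by linarith
    then show "card W' + 2 * (\<Sum>i<p. m' i) + card (Pos p b) \<le> w" using Suc(2,5) n by simp
  qed
  have disj: "W' \<inter> \<sigma>'' ` Keys fx p b = {}"
  proof -
    have "\<sigma>'' q \<notin> W'" if q: "q \<in> Keys fx p b" for q
    proof (cases "q = (i, b i)")
      case True
      have "z \<in> \<sigma>' ` Pos p b" "u \<in> \<sigma>' ` Pos p b" using qP by (auto simp: z_def u_def)
      then show ?thesis using v(1) True by (auto simp: \<sigma>''_def W'_def)
    next
      case False
      have qp: "q \<in> Pos p b" using q LPP by auto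
      have "q \<noteq> qu" using q quLP by auto
      then have "\<sigma>' q \<noteq> u" "\<sigma>' q \<noteq> z"
        using False inj_on_eq_iff[OF inj' qp qP(1)] inj_on_eq_iff[OF inj' qp qP(2)] by (auto simp: u_def z_def)
      moreover have "\<sigma>' q \<notin> W" using s'(2) qp by blast
      ultimately show ?thesis using False by (simp add: \<sigma>''_def W'_def)
    qed
    then show ?thesis by blast
  qed
  define B' where "B' = (\<lambda>i. b i + 2 * m' i)"
  obtain \<rho> where r: "\<rho> \<in> spiders M nb p B'" "\<rho> ` Pos p B' \<inter> W' = {}"
    "\<forall>i<p. \<rho> (i, B' i) = \<sigma>'' (i, b i)" "fx \<longrightarrow> \<rho> (0, 0) = \<sigma>'' (0, 0)"
    using Suc(1)[OF n, of \<sigma>'' W'] v(2) W' disj unfolding \<sigma>''_def[symmetric] B'_def by blast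
  define c where "c = B' i"
  have c0: "0 < c" using bpos[OF i(1)] by (simp add: c_def B'_def)
  define \<rho>1 where "\<rho>1 = \<rho>((i, Suc c) := u)"
  define \<rho>2 where "\<rho>2 = \<rho>1((i, Suc (Suc c)) := z)"
  define B1 where "B1 = B'(i := Suc c)"
  have "\<rho> (lpos i (B' i)) = v" using r(3) i(1) c0 by (simp add: c_def \<sigma>''_def lpos_def)
  then have r1: "\<rho>1 \<in> spiders M nb p B1"
    unfolding \<rho>1_def B1_def c_def using uv r(2) by (intro spiders_upd[OF r(1) i(1)]) (auto simp: W'_def)
  have P1: "Pos p B1 = insert (i, Suc c) (Pos p B')" unfolding B1_def c_def by (rule Pos_upd_Suc[OF i(1)])
  have nin: "(i, Suc c) \<notin> Pos p B'" by (simp add: in_Pos c_def)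
  have im1: "\<rho>1 ` Pos p B1 = insert u (\<rho> ` Pos p B')"
    unfolding P1 \<rho>1_def using nin by (auto simp: image_iff)
  have "z \<notin> \<rho>1 ` Pos p B1" unfolding im1 using uz r(2) by (auto simp: W'_def)
  moreover have "\<rho>1 (lpos i (B1 i)) = u" by (simp add: B1_def \<rho>1_def)
  moreover have B1i: "Suc (B1 i) = Suc (Suc c)" by (simp add: B1_def)
  ultimately have r2: "\<rho>2 \<in> spiders M nb p (B1(i := Suc (B1 i)))"
    unfolding \<rho>2_def B1i[symmetric] using zu by (intro spiders_upd[OF r1 i(1)]) auto
  have BB: "B1(i := Suc (B1 i)) = (\<lambda>i. b i + 2 * m i)"
    using i(2) by (auto simp: B1_def c_def B'_def m'_def fun_eq_iff)
  have P2: "Pos p (\<lambda>i. b i + 2 * m i) = insert (i, Suc (Suc c)) (Pos p B1)"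
    unfolding BB[symmetric] using Pos_upd_Suc[OF i(1), of B1] B1i by simp
  have nin2: "(i, Suc (Suc c)) \<notin> Pos p B1" using B1i by (simp add: in_Pos B1_def)
  have im2: "\<rho>2 ` Pos p (\<lambda>i. b i + 2 * m i) = insert z (insert u (\<rho> ` Pos p B'))"
    unfolding P2 im1[symmetric] \<rho>2_def using nin2 by (auto simp: image_iff)
  have "\<rho>2 ` Pos p (\<lambda>i. b i + 2 * m i) \<inter> W = {}"
  proof -
    have "z \<notin> W" "u \<notin> W" using s'(2) qP by (auto simp: z_def u_def)
    then show ?thesis unfolding im2 using r(2) by (auto simp: W'_def)
  qed
  moreover have "\<rho>2 (i', b i' + 2 * m i') = \<sigma> (i', b i')" if i': "i' < p" for i'
  proof (cases "i' = i")
    case True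
    have "b i + 2 * m i = Suc (Suc c)" using fun_cong[OF BB, of i] B1i by simp
    then show ?thesis using True agree[OF leaf[OF i']] by (simp add: \<rho>2_def z_def)
  next
    case False
    then have "\<rho>2 (i', b i' + 2 * m i') = \<rho> (i', B' i')" by (simp add: \<rho>2_def \<rho>1_def B'_def m'_def)
    then show ?thesis using r(3) i' False agree[OF leaf[OF i']] by (simp add: \<sigma>''_def)
  qed
  moreover have "\<rho>2 (0, 0) = \<sigma> (0, 0)" if fx
  proof -
    have "(0, 0) \<in> Keys fx p b" using that by (simp add: Keys_def)
    then show ?thesis using r(4) that agree[of "(0, 0)"] bpos[OF i(1)] by (auto simp: \<rho>2_def \<rho>1_def \<sigma>''_def)
  qed
  ultimately show ?case using r2 unfolding BB by blast
qed

section \<open>Brooms, and sets of vertices joined by many members of a family\<close>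

lemma growth_Suc_left: "growth D d (Suc a) = D * growth d D a"
  by (induction a) (auto simp: growth_Suc sdeg_def)

text \<open>The first vertices of the paths in \<open>\<S>\<close> are separated from the rest: a broom is a path \<open>h\<close>
  together with \<open>s\<close> vertices each of which extends \<open>h\<close> to a member of \<open>\<S>\<close>. Brooms supply the \<open>s\<close>
  branch vertices that are heavily joined to common endpoints.\<close>

definition shift :: "nat \<Rightarrow> (nat \<times> nat \<Rightarrow> 'a) \<Rightarrow> nat \<times> nat \<Rightarrow> 'a" where
  "shift q \<sigma> = restrict (\<lambda>(i, j). \<sigma> (0, Suc j)) (Pos 1 (\<lambda>_. q))"

lemma shift_apply [simp]: "j \<le> q \<Longrightarrow> shift q \<sigma> (0, j) = \<sigma> (0, Suc j)"
  by (simp add: shift_def)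

lemma (in bireg) shift_spiders:
  assumes "\<sigma> \<in> spiders M nb 1 (\<lambda>_. Suc q)"
  shows "shift q \<sigma> \<in> spiders N nb 1 (\<lambda>_. q)" "\<sigma> (0, 0) \<in> nb (shift q \<sigma> (0, 0))"
proof -
  have st: "\<sigma> (0, Suc j) \<in> nb (\<sigma> (0, j))" if "j < Suc q" for j
    using spiders_step[OF assms, of 0 j] that by simp
  have inj: "inj_on \<sigma> (Pos 1 (\<lambda>_. Suc q))" using spiders_inj[OF assms] .
  have "inj_on (shift q \<sigma>) (Pos 1 (\<lambda>_. q))"
  proof (rule inj_onI)
    fix a a' assume a: "a \<in> Pos 1 (\<lambda>_. q)" "a' \<in> Pos 1 (\<lambda>_. q)" "shift q \<sigma> a = shift q \<sigma> a'"
    then obtain j j' where "a = (0, j)" "a' = (0, j')" "j \<le> q" "j' \<le> q" by (cases a; cases a') auto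
    then show "a = a'" using a(3) inj_onD[OF inj, of "(0, Suc j)" "(0, Suc j')"] by auto
  qed
  moreover have "\<sigma> (0, Suc 0) \<in> N" using st[of 0] nbM[of "\<sigma> (0, 0)"] spiders_center[OF assms] by auto
  ultimately show "shift q \<sigma> \<in> spiders N nb 1 (\<lambda>_. q)"
    using st by (auto simp: spiders_def shift_def)
  show "\<sigma> (0, 0) \<in> nb (shift q \<sigma> (0, 0))" using sym[OF st[of 0]] by simp
qed

lemma shift_inj:
  assumes "\<sigma> \<in> spiders S nb 1 (\<lambda>_. Suc q)" "\<sigma>' \<in> spiders S nb 1 (\<lambda>_. Suc q)"
    "shift q \<sigma> = shift q \<sigma>'" "\<sigma> (0, 0) = \<sigma>' (0, 0)"
  shows "\<sigma> = \<sigma>'"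
proof (rule spiders_eqI[OF assms(1,2)])
  fix a assume "a \<in> Pos 1 (\<lambda>_. Suc q)"
  then obtain j where j: "a = (0, j)" "j \<le> Suc q" by (cases a) auto
  show "\<sigma> a = \<sigma>' a"
  proof (cases j)
    case 0
    then show ?thesis using j assms(4) by simp
  next
    case (Suc j')
    then show ?thesis using j fun_cong[OF assms(3), of "(0, j')"] by simp
  qed
qed

lemma choose_le_pow: "(n choose s) \<le> n ^ s"
  using binomial_le_pow[of s n] by (cases "s \<le> n") (auto simp: binomial_eq_0)

text \<open>A path \<open>h\<close> has at most \<open>\<mu> * d\<close> extensions by a first
  vertex, while density makes the average at least a constant times \<open>d\<close>. Hence a
  positive proportion of the main term for \<open>h\<close> consists of paths with at least
  \<open>\<theta> * d\<close> extensions, and each of these carries of order \<open>d ^ s\<close>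
  brooms.\<close>

lemma (in bireg) many_brooms:
  fixes \<eta> :: real
  assumes S: "\<S> \<subseteq> spiders M nb 1 (\<lambda>_. Suc q)"
    and dens: "\<eta> * (spider_total M D d 1 (\<lambda>_. Suc q)) < real (card \<S>)" and eta: "0 < \<eta>" and s: "0 < s"
    and Xs: "Xs = (\<lambda>h. (\<lambda>\<sigma>. \<sigma> (0, 0)) ` {\<sigma> \<in> \<S>. shift q \<sigma> = h})"
    and big: "real s * (2 * real \<mu> ^ (q + 1)) \<le> \<eta> * real d"
  shows "\<eta> / (2 * real \<mu> ^ 2) * (\<eta> / (2 * real \<mu> ^ (q + 1)) / real s) ^ s
      * (real (card N) * real (growth d D q) * real d ^ s)
    \<le> real (card (Sigma (spiders N nb 1 (\<lambda>_. q)) (\<lambda>h. {X. X \<subseteq> Xs h \<and> card X = s})))"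
proof -
  interpret sw: bireg \<mu> N M nb d D by (rule swap)
  define H where "H = spiders N nb 1 (\<lambda>_. q)"
  define G0 where "G0 = real (card N) * real (growth d D q)"
  \<comment> \<open>Paths \<open>h\<close> with fewer than \<open>\<theta> * d\<close> extensions
    then account for at most half of the lower bound \<open>\<eta> / \<mu> * (G0 * d)\<close> for
    \<open>card \<S>\<close>.\<close>
  define \<theta> where "\<theta> = \<eta> / (2 * real \<mu> ^ (q + 1))"
  define dh where "dh = (\<lambda>h. card (Xs h))"
  have mu1: "1 \<le> real \<mu>" using mu by simp
  have th: "0 < \<theta>" using eta mu1 by (simp add: \<theta>_def)
  have G0: "0 \<le> G0" by (simp add: G0_def)
  have finS: "finite \<S>" using S finite_spiders[OF subset_refl] by (rule finite_subset)
  have finH: "finite H" unfolding H_def by (rule sw.finite_spiders) simp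
  have Xnb: "Xs h \<subseteq> nb (h (0, 0))" for h using shift_spiders(2) S by (auto simp: Xs)
  have hN: "h (0, 0) \<in> N" if "h \<in> H" for h using that spiders_center by (auto simp: H_def)
  have finX: "finite (Xs h)" for h using finS by (simp add: Xs)
  have dhle: "real (dh h) \<le> real \<mu> * real d" if "h \<in> H" for h
  proof -
    have "dh h \<le> card (nb (h (0, 0)))"
      unfolding dh_def using Xnb hN[OF that] finite_nb by (intro card_mono) auto
    also have "\<dots> \<le> \<mu> * d" using degN[OF hN[OF that]] by simp
    finally show ?thesis by (metis of_nat_le_iff of_nat_mult)
  qed
  have sumdh: "(\<Sum>h\<in>H. dh h) = card \<S>"
  proof -
    have "inj_on (\<lambda>\<sigma>. \<sigma> (0, 0)) {\<sigma> \<in> \<S>. shift q \<sigma> = h}" for h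
    proof (rule inj_onI)
      fix \<sigma> \<sigma>' assume a: "\<sigma> \<in> {\<sigma> \<in> \<S>. shift q \<sigma> = h}" "\<sigma>' \<in> {\<sigma> \<in> \<S>. shift q \<sigma> = h}" "\<sigma> (0, 0) = \<sigma>' (0, 0)"
      show "\<sigma> = \<sigma>'"
        by (rule shift_inj[of \<sigma> M nb q \<sigma>']) (use a S in auto)
    qed
    then have "dh h = card {\<sigma> \<in> \<S>. shift q \<sigma> = h}" for h
      unfolding dh_def Xs by (rule card_image)
    moreover have "card (\<Union>h\<in>H. {\<sigma> \<in> \<S>. shift q \<sigma> = h}) = (\<Sum>h\<in>H. card {\<sigma> \<in> \<S>. shift q \<sigma> = h})"
      using finH finS by (intro card_UN_disjoint) auto
    moreover have "(\<Union>h\<in>H. {\<sigma> \<in> \<S>. shift q \<sigma> = h}) = \<S>"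
      using shift_spiders(1) S unfolding H_def by blast
    ultimately show ?thesis by simp
  qed
  have cH: "real (card H) \<le> real \<mu> ^ q * G0"
    using sw.card_spiders_le[of 1 "\<lambda>_. q"] by (simp add: H_def G0_def weight_def)
  have T: "G0 * real d \<le> real \<mu> * (spider_total M D d 1 (\<lambda>_. Suc q))"
  proof -
    have "card N * d \<le> \<mu> * (card M * D)" using sw.balance .
    then have "card N * d * growth d D q \<le> \<mu> * (card M * D) * growth d D q" by (rule mult_right_mono) simp
    then have "real (card N * d * growth d D q) \<le> real (\<mu> * (card M * D) * growth d D q)" by (simp only: of_nat_le_iff)
    then show ?thesis by (simp add: G0_def weight_def growth_Suc_left mult.assoc mult.left_commute mult.commute)
  qed
  define Rh where "Rh = {h \<in> H. \<theta> * real d \<le> real (dh h)}"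
  have finR: "finite Rh" using finH by (simp add: Rh_def)
  have u0: "real (card \<S>) = (\<Sum>h\<in>Rh. real (dh h)) + (\<Sum>h\<in>H - Rh. real (dh h))"
    unfolding sumdh[symmetric] of_nat_sum using sum.subset_diff[of Rh H "\<lambda>h. real (dh h)"] finH
    by (simp add: Rh_def)
  have u1: "(\<Sum>h\<in>Rh. real (dh h)) \<le> real (card Rh) * (real \<mu> * real d)"
    using sum_bounded_above[of Rh "\<lambda>h. real (dh h)" "real \<mu> * real d"] dhle by (simp add: Rh_def)
  have "(\<Sum>h\<in>H - Rh. real (dh h)) \<le> real (card (H - Rh)) * (\<theta> * real d)"
    by (rule sum_bounded_above) (auto simp: Rh_def)
  also have "\<dots> \<le> real (card H) * (\<theta> * real d)"
    using card_mono[of H "H - Rh"] finH th by (intro mult_right_mono) auto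
  also have "\<dots> \<le> (real \<mu> ^ q * G0) * (\<theta> * real d)"
    using cH th by (intro mult_right_mono) auto
  also have "\<dots> = \<eta> / (2 * real \<mu>) * (G0 * real d)"
    using mu1 by (simp add: \<theta>_def field_simps)
  finally have up: "real (card \<S>) \<le> real (card Rh) * (real \<mu> * real d) + \<eta> / (2 * real \<mu>) * (G0 * real d)"
    using u0 u1 by linarith
  have "\<eta> / real \<mu> * (G0 * real d) \<le> \<eta> / real \<mu> * (real \<mu> * (spider_total M D d 1 (\<lambda>_. Suc q)))"
    using T eta by (intro mult_left_mono) auto
  also have "\<dots> = \<eta> * (spider_total M D d 1 (\<lambda>_. Suc q))" using mu1 by simp
  finally have "\<eta> / real \<mu> * (G0 * real d) \<le> real (card \<S>)" using dens by linarith
  then have "\<eta> / (2 * real \<mu>) * (G0 * real d) \<le> real (card Rh) * (real \<mu> * real d)"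
    using up by (simp add: field_simps)
  then have "(\<eta> / (2 * real \<mu>) * G0) * real d \<le> (real (card Rh) * real \<mu>) * real d"
    by (simp add: ac_simps)
  then have "\<eta> / (2 * real \<mu>) * G0 \<le> real (card Rh) * real \<mu>"
    using dpos by (subst (asm) mult_le_cancel_right_pos) auto
  then have cR: "\<eta> / (2 * real \<mu> ^ 2) * G0 \<le> real (card Rh)"
    using mu1 by (simp add: field_simps power2_eq_square)
  have ch: "(\<theta> / real s) ^ s * real d ^ s \<le> real (dh h choose s)" if "h \<in> Rh" for h
  proof -
    have *: "\<theta> * real d \<le> real (dh h)" using that by (simp add: Rh_def)
    have "real s \<le> \<theta> * real d" using big mu1 by (simp add: \<theta>_def field_simps)
    then have "s \<le> dh h" using * by linarith
    then have "(real (dh h) / real s) ^ s \<le> real (dh h choose s)"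
      by (rule binomial_ge_n_over_k_pow_k)
    moreover have "(\<theta> * real d / real s) ^ s \<le> (real (dh h) / real s) ^ s"
      using * th by (intro power_mono divide_right_mono) auto
    ultimately show ?thesis by (simp add: power_mult_distrib power_divide)
  qed
  have "\<eta> / (2 * real \<mu> ^ 2) * (\<theta> / real s) ^ s * (G0 * real d ^ s)
      = (\<eta> / (2 * real \<mu> ^ 2) * G0) * ((\<theta> / real s) ^ s * real d ^ s)" by simp
  also have "\<dots> \<le> real (card Rh) * ((\<theta> / real s) ^ s * real d ^ s)"
    using cR th by (intro mult_right_mono) auto
  also have "\<dots> \<le> (\<Sum>h\<in>Rh. real (dh h choose s))"
    using sum_bounded_below[of Rh "(\<theta> / real s) ^ s * real d ^ s" "\<lambda>h. real (dh h choose s)"] ch by simp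
  also have "\<dots> \<le> (\<Sum>h\<in>H. real (dh h choose s))"
    using finH by (intro sum_mono2) (auto simp: Rh_def)
  also have "\<dots> = real (\<Sum>h\<in>H. card {X. X \<subseteq> Xs h \<and> card X = s})"
    using finX by (simp add: n_subsets dh_def)
  also have "(\<Sum>h\<in>H. card {X. X \<subseteq> Xs h \<and> card X = s}) = card (Sigma H (\<lambda>h. {X. X \<subseteq> Xs h \<and> card X = s}))"
    using finH finX by (intro card_SigmaI[symmetric]) auto
  finally show ?thesis by (simp add: G0_def \<theta>_def H_def)
qed

text \<open>Applied to shortened paths \<open>h\<close>, where it bounds the number of classes in
  the cleaning of brooms; for equal \<open>q\<close> the order is that of the lower bound in
  \<open>many_brooms\<close>.\<close>

lemma (in bireg) card_brooms_le:
  shows "real (card (Sigma (spiders N nb 1 (\<lambda>_. q)) (\<lambda>h. {X. X \<subseteq> nb (h (0, 0)) \<and> card X = s})))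
    \<le> real \<mu> ^ (q + s) * (real (card N) * real (growth d D q) * real d ^ s)"
    "finite (Sigma (spiders N nb 1 (\<lambda>_. q)) (\<lambda>h. {X. X \<subseteq> nb (h (0, 0)) \<and> card X = s}))"
proof -
  interpret sw: bireg \<mu> N M nb d D by (rule swap)
  define H where "H = spiders N nb 1 (\<lambda>_. q)"
  have finH: "finite H" unfolding H_def by (rule sw.finite_spiders) simp
  have hN: "h (0, 0) \<in> N" if "h \<in> H" for h using that spiders_center by (auto simp: H_def)
  have finX: "finite {X. X \<subseteq> nb (h (0, 0)) \<and> card X = s}" if "h \<in> H" for h
  proof (rule finite_subset)
    show "finite (Pow (nb (h (0, 0))))" using finite_nb[of "h (0, 0)"] hN[OF that] by simp
  qed auto
  show "finite (Sigma (spiders N nb 1 (\<lambda>_. q)) (\<lambda>h. {X. X \<subseteq> nb (h (0, 0)) \<and> card X = s}))"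
    using finH finX unfolding H_def by (intro finite_SigmaI) auto
  have "card (Sigma H (\<lambda>h. {X. X \<subseteq> nb (h (0, 0)) \<and> card X = s}))
      = (\<Sum>h\<in>H. card {X. X \<subseteq> nb (h (0, 0)) \<and> card X = s})"
    using finH finX by (intro card_SigmaI) auto
  also have "\<dots> \<le> (\<Sum>h\<in>H. (\<mu> * d) ^ s)"
  proof (rule sum_mono)
    fix h assume h: "h \<in> H"
    have "card {X. X \<subseteq> nb (h (0, 0)) \<and> card X = s} = card (nb (h (0, 0))) choose s"
      using finite_nb[of "h (0, 0)"] hN[OF h] by (intro n_subsets) auto
    also have "\<dots> \<le> card (nb (h (0, 0))) ^ s" by (rule choose_le_pow)
    also have "\<dots> \<le> (\<mu> * d) ^ s" using degN[OF hN[OF h]] by (intro power_mono) auto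
    finally show "card {X. X \<subseteq> nb (h (0, 0)) \<and> card X = s} \<le> (\<mu> * d) ^ s" .
  qed
  also have "\<dots> = card H * (\<mu> * d) ^ s" by simp
  finally have "real (card (Sigma H (\<lambda>h. {X. X \<subseteq> nb (h (0, 0)) \<and> card X = s}))) \<le> real (card H * (\<mu> * d) ^ s)"
    by (simp only: of_nat_le_iff)
  also have "\<dots> = real (card H) * (real \<mu> * real d) ^ s" by simp
  also have "\<dots> \<le> (real \<mu> ^ q * (real (card N) * real (growth d D q))) * (real \<mu> * real d) ^ s"
    using sw.card_spiders_le[of 1 "\<lambda>_. q"] by (intro mult_right_mono) (auto simp: H_def weight_def)
  also have "\<dots> = real \<mu> ^ (q + s) * (real (card N) * real (growth d D q) * real d ^ s)"
    by (simp add: power_add power_mult_distrib)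
  finally show "real (card (Sigma (spiders N nb 1 (\<lambda>_. q)) (\<lambda>h. {X. X \<subseteq> nb (h (0, 0)) \<and> card X = s})))
    \<le> real \<mu> ^ (q + s) * (real (card N) * real (growth d D q) * real d ^ s)" by (simp add: H_def)
qed

text \<open>Brooms are cleaned with respect to \<open>X\<close> together with \<open>h\<close>
  shortened by one vertex and, if \<open>2 \<le> q\<close>, by two. In a surviving broom the last
  vertex takes many values for fixed \<open>X\<close>, which gives the first part. Freeing two
  vertices gives many penultimate vertices \<open>y\<close>, each with many admissible last
  vertices; this second part serves odd lengths, where one more edge is needed.\<close>

lemma broom:
  fixes \<eta> :: real
  assumes eta: "0 < \<eta>" and s: "0 < s" and mu: "1 \<le> \<mu>" and q: "1 \<le> q"
  shows "\<exists>C. \<forall>M N (nb :: 'a \<Rightarrow> 'a set) D d \<S>. bireg \<mu> M N nb D d \<longrightarrow> C \<le> D \<longrightarrow> C \<le> d \<longrightarrow>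
    \<S> \<subseteq> spiders M nb 1 (\<lambda>_. Suc q) \<longrightarrow> \<eta> * (spider_total M D d 1 (\<lambda>_. Suc q)) < real (card \<S>) \<longrightarrow>
    (\<exists>X Y. finite X \<and> card X = s \<and> finite Y \<and> A \<le> card Y \<and>
       (\<forall>x\<in>X. \<forall>y\<in>Y. \<exists>\<sigma>\<in>\<S>. \<sigma> (0, 0) = x \<and> \<sigma> (0, Suc q) = y)) \<and>
    (2 \<le> q \<longrightarrow> (\<exists>X Y. finite X \<and> card X = s \<and> finite Y \<and> A \<le> card Y \<and>
       (\<forall>y\<in>Y. \<exists>Z. finite Z \<and> A \<le> card Z \<and> Z \<subseteq> nb y \<and>
          (\<forall>x\<in>X. \<forall>z\<in>Z. \<exists>\<sigma>\<in>\<S>. \<sigma> (0, 0) = x \<and> \<sigma> (0, Suc q) = z))))"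
proof -
  define c where "c = \<eta> / (2 * real \<mu> ^ 2) * (\<eta> / (2 * real \<mu> ^ (q + 1)) / real s) ^ s"
  have mu1: "1 \<le> real \<mu>" using mu by simp
  have c0: "0 < c" using eta s mu1 by (simp add: c_def)
  obtain C1 where C1: "real s * (2 * real \<mu> ^ (q + 1)) / \<eta> < real C1" using reals_Archimedean2 by blast
  \<comment> \<open>Each of at most two truncations costs at most
    \<open>A * \<mu> ^ (q + s + 1) * G / C2\<close>, with \<open>G\<close> the main term; the sum
    has to stay below the \<open>c * G\<close> available brooms.\<close>
  obtain C2 where C2: "2 * real A * real \<mu> ^ (q + s + 1) / c < real C2" using reals_Archimedean2 by blast
  have concl: "(\<exists>X Y. finite X \<and> card X = s \<and> finite Y \<and> A \<le> card Y \<and>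
       (\<forall>x\<in>X. \<forall>y\<in>Y. \<exists>\<sigma>\<in>\<S>. \<sigma> (0, 0) = x \<and> \<sigma> (0, Suc q) = y)) \<and>
    (2 \<le> q \<longrightarrow> (\<exists>X Y. finite X \<and> card X = s \<and> finite Y \<and> A \<le> card Y \<and>
       (\<forall>y\<in>Y. \<exists>Z. finite Z \<and> A \<le> card Z \<and> Z \<subseteq> nb y \<and>
          (\<forall>x\<in>X. \<forall>z\<in>Z. \<exists>\<sigma>\<in>\<S>. \<sigma> (0, 0) = x \<and> \<sigma> (0, Suc q) = z))))"
    if br: "bireg \<mu> M N nb D d" and CD: "max C1 C2 \<le> D" "max C1 C2 \<le> d"
      and S: "\<S> \<subseteq> spiders M nb 1 (\<lambda>_. Suc q)"
      and dens: "\<eta> * (spider_total M D d 1 (\<lambda>_. Suc q)) < real (card \<S>)"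
    for M N and nb :: "'a \<Rightarrow> 'a set" and D d \<S>
  proof -
    interpret bireg \<mu> M N nb D d by fact
    interpret sw: bireg \<mu> N M nb d D by (rule swap)
    define Xs where "Xs = (\<lambda>h. (\<lambda>\<sigma>. \<sigma> (0, 0)) ` {\<sigma> \<in> \<S>. shift q \<sigma> = h})"
    define BB where "BB = Sigma (spiders N nb 1 (\<lambda>_. q)) (\<lambda>h. {X. X \<subseteq> Xs h \<and> card X = s})"
    define G where "G = real (card N) * real (growth d D q) * real d ^ s"
    have cd: "C1 \<le> d" "C2 \<le> D" "C2 \<le> d" using CD by auto
    have Nne: "N \<noteq> {}"
    proof
      assume "N = {}"
      then have "\<S> = {}" using S shift_spiders(1)[THEN spiders_center] by fastforce
      moreover have "0 \<le> \<eta> * (spider_total M D d 1 (\<lambda>_. Suc q))" using eta by (simp add: weight_def)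
      ultimately show False using dens by simp
    qed
    have Gpos: "0 < G"
      using Nne finN growth_pos[OF dpos Dpos, of q] dpos by (simp add: G_def card_gt_0_iff)
    have "real s * (2 * real \<mu> ^ (q + 1)) \<le> \<eta> * real d"
    proof -
      have "real s * (2 * real \<mu> ^ (q + 1)) \<le> \<eta> * real C1" using C1 eta by (simp add: field_simps)
      also have "\<dots> \<le> \<eta> * real d" using cd eta by simp
      finally show ?thesis .
    qed
    from many_brooms[OF S dens eta s Xs_def this] have cB: "c * G \<le> real (card BB)"
      by (simp only: c_def G_def BB_def)
    have Xnb: "Xs h \<subseteq> nb (h (0, 0))" for h using shift_spiders(2) S by (auto simp: Xs_def)
    have BBsub: "BB \<subseteq> Sigma (spiders N nb 1 (\<lambda>_. q)) (\<lambda>h. {X. X \<subseteq> nb (h (0, 0)) \<and> card X = s})"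
      using Xnb by (auto simp: BB_def)
    then have finB: "finite BB" using card_brooms_le(2) by (rule finite_subset)
    define I where "I = (if 2 \<le> q then {1, 2} else {1 :: nat})"
    define \<kappa> where "\<kappa> = (\<lambda>j (h :: nat \<times> nat \<Rightarrow> 'a, X :: 'a set). (restrict h (Pos 1 (\<lambda>_. q - j)), X))"
    \<comment> \<open>With two free vertices, one penultimate vertex accounts for at most
      \<open>\<mu> * sdeg d D (q - 1)\<close> members of a class, so this weight forces at least
      \<open>A\<close> penultimate vertices.\<close>
    define wt where "wt = (\<lambda>j :: nat. if j = 1 then real A else real A * (real \<mu> * real (sdeg d D (q - 1))))"
    have im: "real (card (\<kappa> j ` BB)) \<le> real \<mu> ^ (q + s) * (real (card N) * real (growth d D (q - j)) * real d ^ s)" for j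
    proof -
      have "\<kappa> j ` BB \<subseteq> Sigma (spiders N nb 1 (\<lambda>_. q - j)) (\<lambda>h. {X. X \<subseteq> nb (h (0, 0)) \<and> card X = s})"
        using BBsub restrict_spiders[of _ N nb 1 "\<lambda>_. q" "\<lambda>_. q - j"] by (fastforce simp: \<kappa>_def)
      then have "real (card (\<kappa> j ` BB)) \<le> real (card (Sigma (spiders N nb 1 (\<lambda>_. q - j)) (\<lambda>h. {X. X \<subseteq> nb (h (0, 0)) \<and> card X = s})))"
        using card_brooms_le(2) by (intro of_nat_mono card_mono)
      also have "\<dots> \<le> real \<mu> ^ (q - j + s) * (real (card N) * real (growth d D (q - j)) * real d ^ s)"
        by (rule card_brooms_le)
      also have "\<dots> \<le> real \<mu> ^ (q + s) * (real (card N) * real (growth d D (q - j)) * real d ^ s)"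
        using mu1 by (intro mult_right_mono power_increasing) auto
      finally show ?thesis .
    qed
    have wtj: "wt j * real (card (\<kappa> j ` BB)) * real C2 \<le> real A * real \<mu> ^ (q + s + 1) * G" if j: "j \<in> I" for j
    proof -
      \<comment> \<open>A common form of both cases: \<open>y\<close> is the degree factor in the
        weight, 1 or \<open>sdeg d D (q - 1)\<close>. Shortening \<open>h\<close> saves this factor
        and another one of at least \<open>C2\<close>.\<close>
      obtain y where y: "wt j \<le> real A * (real \<mu> * y)" "0 \<le> y" "y * real C2 * real (growth d D (q - j)) \<le> real (growth d D q)"
      proof (cases "j = 1")
        case True
        have "growth d D q = growth d D (q - 1) * sdeg d D (q - 1)" using q growth_Suc[of d D "q - 1"] by simp
        moreover have "C2 \<le> sdeg d D (q - 1)" using cd by (simp add: sdeg_def)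
        ultimately have "C2 * growth d D (q - 1) \<le> growth d D q" by simp
        then have "real C2 * real (growth d D (q - 1)) \<le> real (growth d D q)" by (metis of_nat_le_iff of_nat_mult)
        moreover have "real A \<le> real A * real \<mu>" using mu1 by (simp add: mult_le_cancel_left1)
        ultimately show ?thesis using that[of 1] True by (simp add: wt_def)
      next
        case False
        then have j2: "j = 2" "2 \<le> q" using j by (auto simp: I_def split: if_splits)
        then obtain q' where q': "q = Suc (Suc q')" by (metis Suc_le_D numeral_2_eq_2 Suc_le_mono)
        have "C2 \<le> sdeg d D q'" using cd by (simp add: sdeg_def)
        then have "sdeg d D (q - 1) * C2 * growth d D (q - j) \<le> growth d D q"
          using j2 q' by (simp add: growth_Suc)
        then have "real (sdeg d D (q - 1)) * real C2 * real (growth d D (q - j)) \<le> real (growth d D q)"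
          by (metis of_nat_le_iff of_nat_mult)
        then show ?thesis using that[of "real (sdeg d D (q - 1))"] j2 by (simp add: wt_def)
      qed
      have "wt j * real (card (\<kappa> j ` BB)) * real C2
        \<le> (real A * (real \<mu> * y)) * (real \<mu> ^ (q + s) * (real (card N) * real (growth d D (q - j)) * real d ^ s)) * real C2"
        using y im by (intro mult_right_mono mult_mono) auto
      also have "\<dots> = (real A * real \<mu> ^ (q + s + 1) * real (card N) * real d ^ s) * (y * real C2 * real (growth d D (q - j)))"
        by simp
      also have "\<dots> \<le> (real A * real \<mu> ^ (q + s + 1) * real (card N) * real d ^ s) * real (growth d D q)"
        using y by (intro mult_left_mono) auto
      finally show ?thesis by (simp add: G_def ac_simps)
    qed
    have "card I \<le> 2" by (simp add: I_def)
    have "(\<Sum>j\<in>I. wt j * real (card (\<kappa> j ` BB))) * real C2 \<le> real (card I) * (real A * real \<mu> ^ (q + s + 1) * G)"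
      unfolding sum_distrib_right using wtj by (intro sum_bounded_above)
    also have "\<dots> \<le> 2 * (real A * real \<mu> ^ (q + s + 1) * G)"
      using \<open>card I \<le> 2\<close> Gpos by (intro mult_right_mono) auto
    also have "\<dots> = (2 * real A * real \<mu> ^ (q + s + 1)) * G" by simp
    also have "\<dots> < (c * real C2) * G"
      using C2 c0 Gpos by (intro mult_strict_right_mono) (auto simp: field_simps)
    also have "\<dots> = (c * G) * real C2" by simp
    finally have "(\<Sum>j\<in>I. wt j * real (card (\<kappa> j ` BB))) < c * G"
      by (rule mult_right_less_imp_less) simp
    then have pos: "0 < real (card BB) - (\<Sum>j\<in>I. wt j * real (card (\<kappa> j ` BB)))" using cB by linarith
    have "\<exists>A\<subseteq>BB. real (card BB) - (\<Sum>j\<in>I. wt j * real (card (\<kappa> j ` BB))) \<le> real (card A) \<and>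
        (\<forall>j\<in>I. \<forall>a\<in>A. wt j \<le> real (card {a' \<in> A. \<kappa> j a' = \<kappa> j a}))"
      by (rule cleaning[OF finB]) (auto simp: I_def wt_def)
    then obtain FF where FF: "FF \<subseteq> BB" "real (card BB) - (\<Sum>j\<in>I. wt j * real (card (\<kappa> j ` BB))) \<le> real (card FF)"
      "\<forall>j\<in>I. \<forall>a\<in>FF. wt j \<le> real (card {a' \<in> FF. \<kappa> j a' = \<kappa> j a})"
      by (elim exE conjE) (rule that)
    have "FF \<noteq> {}" using FF(2) pos by auto
    then obtain h X where hX: "(h, X) \<in> FF" by auto
    have finF: "finite FF" using FF(1) finB by (rule finite_subset)
    have FD: "h' \<in> spiders N nb 1 (\<lambda>_. q)" "X' \<subseteq> Xs h'" "card X' = s" if "(h', X') \<in> FF" for h' X'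
      using that FF(1) by (auto simp: BB_def)
    have ends: "\<exists>\<sigma>\<in>\<S>. \<sigma> (0, 0) = x \<and> \<sigma> (0, Suc q) = h' (0, q)" if "(h', X') \<in> FF" "x \<in> X'" for h' X' x
    proof -
      have "x \<in> Xs h'" using FD(2)[OF that(1)] that(2) by blast
      then obtain \<sigma> where "\<sigma> \<in> \<S>" "shift q \<sigma> = h'" "\<sigma> (0, 0) = x" by (auto simp: Xs_def)
      then show ?thesis using shift_apply[of q q \<sigma>] by auto
    qed
    have Zset: "\<exists>Z. finite Z \<and> A \<le> card Z \<and> Z \<subseteq> nb (h' (0, q - 1)) \<and>
       (\<forall>x\<in>X. \<forall>z\<in>Z. \<exists>\<sigma>\<in>\<S>. \<sigma> (0, 0) = x \<and> \<sigma> (0, Suc q) = z)" if h': "(h', X) \<in> FF" for h'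
    proof -
      define cl where "cl = {a' \<in> FF. \<kappa> 1 a' = \<kappa> 1 (h', X)}"
      have "wt 1 \<le> real (card cl)" using FF(3) h' unfolding cl_def by (auto simp: I_def)
      then have "A \<le> card cl" by (simp add: wt_def)
      have clD: "X'' = X" "(h'', X) \<in> FF" "\<And>j. j \<le> q - 1 \<Longrightarrow> h'' (0, j) = h' (0, j)" if "(h'', X'') \<in> cl" for h'' X''
      proof -
        show e: "X'' = X" using that by (auto simp: cl_def \<kappa>_def)
        then show "(h'', X) \<in> FF" using that by (auto simp: cl_def)
        fix j assume "j \<le> q - 1"
        moreover have "restrict h'' (Pos 1 (\<lambda>_. q - 1)) = restrict h' (Pos 1 (\<lambda>_. q - 1))"
          using that by (auto simp: cl_def \<kappa>_def)
        ultimately show "h'' (0, j) = h' (0, j)" unfolding restrict_eq_iff by simp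
      qed
      have "inj_on (\<lambda>(h'', X''). h'' (0 :: nat, q)) cl"
      proof (rule inj_onI)
        fix a a' assume a: "a \<in> cl" "a' \<in> cl" "(case a of (h'', X'') \<Rightarrow> h'' (0 :: nat, q)) = (case a' of (h'', X'') \<Rightarrow> h'' (0, q))"
        obtain h1 X1 h2 X2 where e: "a = (h1, X1)" "a' = (h2, X2)" by (cases a, cases a') auto
        have "h1 = h2"
        proof (rule spiders_eqI)
          fix p assume "p \<in> Pos 1 (\<lambda>_. q)"
          then obtain j where j: "p = (0, j)" "j \<le> q" by (cases p) auto
          show "h1 p = h2 p"
          proof (cases "j = q")
            case True
            then show ?thesis using a(3) e j by simp
          next
            case False
            then have "j \<le> q - 1" using j by simp
            then show ?thesis using clD(3)[of h1 X1 j] clD(3)[of h2 X2 j] a e j by simp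
          qed
        qed (use a e clD(2) FD(1) in blast)+
        then show "a = a'" using e a clD(1) by blast
      qed
      then have "card ((\<lambda>(h'', X''). h'' (0, q)) ` cl) = card cl" by (rule card_image)
      moreover have "(\<lambda>(h'', X''). h'' (0, q)) ` cl \<subseteq> nb (h' (0, q - 1))"
      proof
        fix z assume "z \<in> (\<lambda>(h'', X''). h'' (0, q)) ` cl"
        then obtain h'' X'' where z: "(h'', X'') \<in> cl" "z = h'' (0, q)" by auto
        have "h'' (0, Suc (q - 1)) \<in> nb (h'' (lpos 0 (q - 1)))"
          using FD(1)[OF clD(2)[OF z(1)]] q by (intro spiders_step) auto
        then show "z \<in> nb (h' (0, q - 1))" using z clD(3)[OF z(1), of "q - 1"] q by simp
      qed
      moreover have "finite ((\<lambda>(h'', X''). h'' (0, q)) ` cl)" using finF by (simp add: cl_def)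
      moreover have "\<exists>\<sigma>\<in>\<S>. \<sigma> (0, 0) = x \<and> \<sigma> (0, Suc q) = z"
        if x: "x \<in> X" and z: "z \<in> (\<lambda>(h'', X''). h'' (0, q)) ` cl" for x z
      proof -
        obtain h'' X'' where "(h'', X'') \<in> cl" "z = h'' (0, q)" using z by auto
        then show ?thesis using ends[OF clD(2) x] by blast
      qed
      ultimately show ?thesis using \<open>A \<le> card cl\<close> by (intro exI[of _ "(\<lambda>(h'', X''). h'' (0, q)) ` cl"]) auto
    qed
    have cX: "card X = s" and finX: "finite X"
      using FD(3)[OF hX] s card.infinite by fastforce+
    have "\<exists>X Y. finite X \<and> card X = s \<and> finite Y \<and> A \<le> card Y \<and>
       (\<forall>x\<in>X. \<forall>y\<in>Y. \<exists>\<sigma>\<in>\<S>. \<sigma> (0, 0) = x \<and> \<sigma> (0, Suc q) = y)"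
    proof -
      obtain Z where "finite Z" "A \<le> card Z" "\<forall>x\<in>X. \<forall>z\<in>Z. \<exists>\<sigma>\<in>\<S>. \<sigma> (0, 0) = x \<and> \<sigma> (0, Suc q) = z"
        using Zset[OF hX] by (elim exE conjE) (rule that)
      then show ?thesis using cX finX by - (rule exI[of _ X], rule exI[of _ Z], intro conjI)
    qed
    moreover have "\<exists>X Y. finite X \<and> card X = s \<and> finite Y \<and> A \<le> card Y \<and>
       (\<forall>y\<in>Y. \<exists>Z. finite Z \<and> A \<le> card Z \<and> Z \<subseteq> nb y \<and>
          (\<forall>x\<in>X. \<forall>z\<in>Z. \<exists>\<sigma>\<in>\<S>. \<sigma> (0, 0) = x \<and> \<sigma> (0, Suc q) = z))" if q2: "2 \<le> q"
    proof -
      define cl where "cl = {a' \<in> FF. \<kappa> 2 a' = \<kappa> 2 (h, X)}"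
      have fincl: "finite cl" using finF by (simp add: cl_def)
      have "wt 2 \<le> real (card cl)" using FF(3) hX q2 unfolding cl_def by (auto simp: I_def)
      then have w2: "real A * (real \<mu> * real (sdeg d D (q - 1))) \<le> real (card cl)" by (simp add: wt_def)
      have clD: "X'' = X" "(h'', X) \<in> FF" "\<And>j. j \<le> q - 2 \<Longrightarrow> h'' (0, j) = h (0, j)" if "(h'', X'') \<in> cl" for h'' X''
      proof -
        show e: "X'' = X" using that by (auto simp: cl_def \<kappa>_def)
        then show "(h'', X) \<in> FF" using that by (auto simp: cl_def)
        fix j assume "j \<le> q - 2"
        moreover have "restrict h'' (Pos 1 (\<lambda>_. q - 2)) = restrict h (Pos 1 (\<lambda>_. q - 2))"
          using that by (auto simp: cl_def \<kappa>_def)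
        ultimately show "h'' (0, j) = h (0, j)" unfolding restrict_eq_iff by simp
      qed
      define Y where "Y = (\<lambda>(h'', X'' :: 'a set). h'' (0 :: nat, q - 1)) ` cl"
      have finY: "finite Y" using fincl by (simp add: Y_def)
      have Ynb: "finite (nb y) \<and> card (nb y) \<le> \<mu> * sdeg d D (q - 1)" if y: "y \<in> Y" for y
      proof -
        obtain h'' X'' where h'': "(h'', X'') \<in> cl" "y = h'' (0, q - 1)" using y by (auto simp: Y_def)
        have "h'' \<in> spiders N nb 1 (\<lambda>_. q)" using FD(1)[OF clD(2)[OF h''(1)]] .
        then show ?thesis using sw.spiders_nb_card[of h'' 1 "\<lambda>_. q" 0 "q - 1"] h''(2) by simp
      qed
      let ?g = "\<lambda>(h'', X'' :: 'a set). (h'' (0 :: nat, q - 1), h'' (0, q))"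
      have "inj_on ?g cl"
      proof (rule inj_onI)
        fix a a' assume a: "a \<in> cl" "a' \<in> cl" "?g a = ?g a'"
        obtain h1 X1 h2 X2 where e: "a = (h1, X1)" "a' = (h2, X2)" by (cases a, cases a') auto
        have "h1 = h2"
        proof (rule spiders_eqI)
          fix p assume "p \<in> Pos 1 (\<lambda>_. q)"
          then obtain j where j: "p = (0, j)" "j \<le> q" by (cases p) auto
          show "h1 p = h2 p"
          proof (cases "j = q \<or> j = q - 1")
            case True
            then show ?thesis using a(3) e j by auto
          next
            case False
            then have "j \<le> q - 2" using j(2) q2 by arith
            then show ?thesis using clD(3)[of h1 X1 j] clD(3)[of h2 X2 j] a e j by simp
          qed
        qed (use a e clD(2) FD(1) in blast)+
        then show "a = a'" using e a clD(1) by blast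
      qed
      moreover have "?g ` cl \<subseteq> Sigma Y nb"
      proof
        fix g assume "g \<in> ?g ` cl"
        then obtain h'' X'' where z: "(h'', X'') \<in> cl" "g = (h'' (0, q - 1), h'' (0, q))" by auto
        have "h'' (0, Suc (q - 1)) \<in> nb (h'' (lpos 0 (q - 1)))"
          using FD(1)[OF clD(2)[OF z(1)]] q by (intro spiders_step) auto
        moreover have "h'' (0, q - 1) \<in> Y" using z(1) by (force simp: Y_def)
        ultimately show "g \<in> Sigma Y nb" using z q by simp
      qed
      moreover have "finite (Sigma Y nb)" using finY Ynb by (intro finite_SigmaI) auto
      ultimately have "card cl \<le> card (Sigma Y nb)" by (rule card_inj_on_le)
      also have "\<dots> = (\<Sum>y\<in>Y. card (nb y))" using finY Ynb by (intro card_SigmaI) auto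
      also have "\<dots> \<le> card Y * (\<mu> * sdeg d D (q - 1))"
        using sum_bounded_above[of Y "\<lambda>y. card (nb y)" "\<mu> * sdeg d D (q - 1)"] Ynb by simp
      finally have "real (card cl) \<le> real (card Y) * (real \<mu> * real (sdeg d D (q - 1)))"
        by (metis of_nat_le_iff of_nat_mult)
      then have "real A * (real \<mu> * real (sdeg d D (q - 1))) \<le> real (card Y) * (real \<mu> * real (sdeg d D (q - 1)))"
        using w2 by linarith
      moreover have "0 < real \<mu> * real (sdeg d D (q - 1))" using mu1 sdeg_pos[OF dpos Dpos, of "q - 1"] by simp
      ultimately have "real A \<le> real (card Y)" by (rule mult_right_le_imp_le)
      then have "A \<le> card Y" by simp
      moreover have "\<exists>Z. finite Z \<and> A \<le> card Z \<and> Z \<subseteq> nb y \<and>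
          (\<forall>x\<in>X. \<forall>z\<in>Z. \<exists>\<sigma>\<in>\<S>. \<sigma> (0, 0) = x \<and> \<sigma> (0, Suc q) = z)" if y: "y \<in> Y" for y
      proof -
        obtain h'' X'' where h'': "(h'', X'') \<in> cl" "y = h'' (0, q - 1)" using y by (auto simp: Y_def)
        show ?thesis unfolding h''(2) by (rule Zset[OF clD(2)[OF h''(1)]])
      qed
      ultimately show ?thesis
        using cX finX finY by - (rule exI[of _ X], rule exI[of _ Y], intro conjI ballI)
    qed
    ultimately show ?thesis by (intro conjI impI)
  qed
  show ?thesis
    by (rule exI[of _ "max C1 C2"], intro allI impI) (rule concl)
qed

section \<open>Paths with both ends prescribed\<close>

lemma few_heavy_edge:
  fixes F :: "('a \<Rightarrow> 'a set) \<Rightarrow> bool"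
  shows "few_heavy \<mu> F True 1 (\<lambda>_. 1)"
  unfolding few_heavy_def
proof (intro allI impI)
  fix \<epsilon> :: real assume eps: "0 < \<epsilon>"
  have "heavy_bound \<mu> F True 1 (\<lambda>_. 1) \<epsilon> 1 0"
    unfolding heavy_bound_def
  proof (intro allI impI)
    fix M N :: "'a set" and nb :: "'a \<Rightarrow> 'a set" and D d
    \<comment> \<open>A path of length 1 is determined by its ends, so the threshold 1 leaves
      nothing heavy.\<close>
    have le: "card (paths nb 1 x z) \<le> 1" for x z
    proof -
      have "\<tau> = \<tau>'" if "\<tau> \<in> paths nb 1 x z" "\<tau>' \<in> paths nb 1 x z" for \<tau> \<tau>'
      proof (rule spiders_eqI)
        show "\<tau> \<in> spiders {x} nb 1 (\<lambda>_. 1)" "\<tau>' \<in> spiders {x} nb 1 (\<lambda>_. 1)" using that by (auto simp: paths_def)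
        fix q assume "q \<in> Pos 1 (\<lambda>_. 1)"
        then have "q = (0, 0) \<or> q = (0, 1)" by (cases q) auto
        then show "\<tau> q = \<tau>' q" using that by (auto simp: paths_def spiders_def)
      qed
      then show ?thesis by (metis One_nat_def card_le_Suc0_iff_eq card.infinite zero_le)
    qed
    have "{\<sigma> \<in> spiders M nb 1 (\<lambda>_. 1). 1 < card (key_class True 1 (\<lambda>_. 1) (spiders M nb 1 (\<lambda>_. 1)) \<sigma>)} = {}"
    proof (rule equals0I)
      fix \<sigma> assume a: "\<sigma> \<in> {\<sigma> \<in> spiders M nb 1 (\<lambda>_. 1). 1 < card (key_class True 1 (\<lambda>_. 1) (spiders M nb 1 (\<lambda>_. 1)) \<sigma>)}"
      have "key_class True 1 (\<lambda>_. 1) (spiders M nb 1 (\<lambda>_. 1)) \<sigma> = paths nb 1 (\<sigma> (0, 0)) (\<sigma> (0, 1))"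
        by (rule key_class_path) (use a spiders_center in blast)
      then have "1 < card (paths nb 1 (\<sigma> (0, 0)) (\<sigma> (0, 1)))" using a by (simp only: mem_Collect_eq)
      then show False using le[of "\<sigma> (0, 0)" "\<sigma> (0, 1)"] by simp
    qed
    moreover have "0 \<le> \<epsilon> * (spider_total M D d 1 (\<lambda>_. 1))" using eps by (simp add: weight_def)
    ultimately show "real (card {\<sigma> \<in> spiders M nb 1 (\<lambda>_. 1). 1 < card (key_class True 1 (\<lambda>_. 1) (spiders M nb 1 (\<lambda>_. 1)) \<sigma>)})
       \<le> \<epsilon> * (spider_total M D d 1 (\<lambda>_. 1))" by (simp only: card.empty of_nat_0)
  qed
  then show "\<exists>K C. heavy_bound \<mu> F True 1 (\<lambda>_. 1) \<epsilon> K C" by blast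
qed

text \<open>The one-legged case of \<open>zigzag\<close> with both ends prescribed. The summand
  \<open>2 * L + 1\<close> covers the vertices reserved while growing and the positions of the short
  path.\<close>

lemma (in bireg) robustly_connected_of_ends:
  assumes rob: "robust True 1 (\<lambda>_. l) w \<S>" and SS: "\<S> \<subseteq> spiders M nb 1 (\<lambda>_. l)" and l: "2 \<le> l" "l \<le> L" "even (L - l)"
    and s: "\<sigma> \<in> \<S>" "\<sigma> (0, 0) = x" "\<sigma> (0, l) = z"
    and W: "finite W" "card W + 2 * L + 1 \<le> w" "x \<notin> W" "z \<notin> W"
  shows "\<exists>R\<in>paths nb L x z. R ` Pos 1 (\<lambda>_. L) \<inter> W = {}"
proof -
  define m where "m = (L - l) div 2"
  have Lm: "l + 2 * m = L" using l by (auto simp: m_def)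
  have "card (Pos 1 (\<lambda>_. l)) \<le> Suc l" using card_Pos_le[of 1 "\<lambda>_. l"] by simp
  then have "card W + 2 * (\<Sum>i<(1::nat). m) + card (Pos 1 (\<lambda>_. l)) \<le> w" using W(2) Lm by simp
  moreover have "W \<inter> \<sigma> ` Keys True 1 (\<lambda>_. l) = {}" using s W by (auto simp: Keys_def lessThan_Suc)
  ultimately have "\<exists>\<rho>\<in>spiders M nb 1 (\<lambda>i. l + 2 * m). \<rho> ` Pos 1 (\<lambda>i. l + 2 * m) \<inter> W = {} \<and>
    (\<forall>i<1. \<rho> (i, l + 2 * m) = \<sigma> (i, l)) \<and> (True \<longrightarrow> \<rho> (0, 0) = \<sigma> (0, 0))"
    using l by (intro zigzag[OF rob SS _ _ s(1) W(1)]) auto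
  then obtain \<rho> where r: "\<rho> \<in> spiders M nb 1 (\<lambda>_. L)" "\<rho> ` Pos 1 (\<lambda>_. L) \<inter> W = {}" "\<rho> (0, L) = z" "\<rho> (0, 0) = x"
    unfolding Lm using s by auto
  then have "\<rho> \<in> paths nb L x z" by (auto simp: paths_def spiders_def)
  then show ?thesis using r(2) by blast
qed

lemma subset_of_card_avoiding:
  assumes "finite X" "finite Y" "card X + t \<le> card Y"
  obtains Y' where "Y' \<subseteq> Y" "finite Y'" "card Y' = t" "X \<inter> Y' = {}"
proof -
  have "t \<le> card (Y - X)" using diff_card_le_card_Diff[OF assms(1), of Y] assms(3) by linarith
  then obtain Y' where "Y' \<subseteq> Y - X" "card Y' = t" "finite Y'" by (rule obtain_subset_with_card_n)
  then show ?thesis by (intro that[of Y']) auto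
qed

text \<open>Induction on the length. By \<open>few_heavy_or_robust_family\<close> it remains to
  exclude dense robust families, and a broom in such a family yields the subdivision: for even
  \<open>l\<close> its paths grow to length \<open>2 * k\<close>, for odd \<open>l\<close> to
  \<open>2 * k - 1\<close>, and one edge closes them.\<close>

lemma path_claim:
  fixes F :: "('a \<Rightarrow> 'a set) \<Rightarrow> bool"
  assumes mu: "1 \<le> \<mu>" and st: "0 < s" and F: "F = (\<lambda>nb. \<not> subdivision_embedded nb (2 * k) s t r)"
  shows "0 < l \<Longrightarrow> l \<le> 2 * k \<Longrightarrow> few_heavy \<mu> F True 1 (\<lambda>_. l)"
proof (induction l rule: less_induct)
  case (less l)
  show ?case
  proof (cases "l = 1")
    case True
    then show ?thesis using few_heavy_edge by simp
  next
    case False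
    then have l2: "2 \<le> l" using less(2) by simp
    define q where "q = l - 1"
    have q: "l = Suc q" "1 \<le> q" using l2 by (auto simp: q_def)
    \<comment> \<open>\<open>w1\<close> is the demand of the greedy choice of all paths, and
      \<open>w\<close> adds the cost of lengthening one path. \<open>A\<close> leaves room for
      \<open>t\<close> branch vertices off \<open>X\<close> and for a \<open>z\<close> off
      \<open>W\<close>, \<open>x\<close> and \<open>y\<close>.\<close>
    define w1 where "w1 = s * t * r * (2 * k) + s + t"
    define w where "w = w1 + 4 * k + 2"
    define A where "A = w1 + s + t + 3"
    show ?thesis
      unfolding few_heavy_def
    proof (intro allI impI)
      fix \<epsilon> :: real assume eps: "0 < \<epsilon>"
      have sm: "few_heavy \<mu> F True 1 (\<lambda>_. m)" if "0 < m" "m < l" for m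
        using less that by simp
      \<comment> \<open>The two length functions agree only on \<open>{..<1}\<close>, not as
        functions, so the claim for the shorter path has to be transferred.\<close>
      have upd: "few_heavy \<mu> F True 1 ((\<lambda>_. l)(i := j)) = few_heavy \<mu> F True 1 (\<lambda>_. j)" if "i < 1" for i j
      proof -
        have 1: "spiders M nb 1 ((\<lambda>_. l)(i := j)) = spiders M nb 1 (\<lambda>_. j)" for M and nb :: "'a \<Rightarrow> 'a set"
          by (rule spiders_cong) (use that in simp)
        have 2: "Keys True 1 ((\<lambda>_. l)(i := j)) = Keys True 1 (\<lambda>_. j)" using that by (auto simp: Keys_def lessThan_Suc)
        have 3: "weight D d 1 ((\<lambda>_. l)(i := j)) = weight D d 1 (\<lambda>_. j)" for D d using that by (simp add: weight_def)
        show ?thesis unfolding few_heavy_def heavy_bound_def key_class_def by (simp only: 1 2 3)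
      qed
      have "\<exists>K C. \<forall>M N nb D d. bireg \<mu> M N nb D d \<longrightarrow> F nb \<longrightarrow> C \<le> D \<longrightarrow> C \<le> d \<longrightarrow>
         real (card (heavy_spiders True K M nb 1 (\<lambda>_. l)))
           \<le> \<epsilon> * (spider_total M D d 1 (\<lambda>_. l)) \<or>
         robust_family True w M nb 1 (\<lambda>_. l) (\<epsilon> / 4 * (spider_total M D d 1 (\<lambda>_. l)))"
        using less(2) mu eps sm upd by (intro few_heavy_or_robust_family) auto
      then obtain K C where key_class: "\<forall>M N nb D d. bireg \<mu> M N nb D d \<longrightarrow> F nb \<longrightarrow> C \<le> D \<longrightarrow> C \<le> d \<longrightarrow>
         real (card (heavy_spiders True K M nb 1 (\<lambda>_. l)))
           \<le> \<epsilon> * (spider_total M D d 1 (\<lambda>_. l)) \<or>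
         robust_family True w M nb 1 (\<lambda>_. l) (\<epsilon> / 4 * (spider_total M D d 1 (\<lambda>_. l)))"
        by (elim exE) (rule that)
      have "0 < \<epsilon> / 4" using eps by simp
      from broom[OF this st mu q(2), where 'a = 'a and A = A] obtain C' where C':
        "\<forall>M N (nb :: 'a \<Rightarrow> 'a set) D d \<S>. bireg \<mu> M N nb D d \<longrightarrow> C' \<le> D \<longrightarrow> C' \<le> d \<longrightarrow>
          \<S> \<subseteq> spiders M nb 1 (\<lambda>_. Suc q) \<longrightarrow> \<epsilon> / 4 * (spider_total M D d 1 (\<lambda>_. Suc q)) < real (card \<S>) \<longrightarrow>
          (\<exists>X Y. finite X \<and> card X = s \<and> finite Y \<and> A \<le> card Y \<and>
             (\<forall>x\<in>X. \<forall>y\<in>Y. \<exists>\<sigma>\<in>\<S>. \<sigma> (0, 0) = x \<and> \<sigma> (0, Suc q) = y)) \<and>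
          (2 \<le> q \<longrightarrow> (\<exists>X Y. finite X \<and> card X = s \<and> finite Y \<and> A \<le> card Y \<and>
             (\<forall>y\<in>Y. \<exists>Z. finite Z \<and> A \<le> card Z \<and> Z \<subseteq> nb y \<and>
                (\<forall>x\<in>X. \<forall>z\<in>Z. \<exists>\<sigma>\<in>\<S>. \<sigma> (0, 0) = x \<and> \<sigma> (0, Suc q) = z))))"
        by (elim exE) (rule that)
      have "heavy_bound \<mu> F True 1 (\<lambda>_. l) \<epsilon> K (max C C')"
        unfolding heavy_bound_def
      proof (intro allI impI)
        fix M N :: "'a set" and nb D d
        assume br: "bireg \<mu> M N nb D d" and Fnb: "F nb" and CD: "max C C' \<le> D" "max C C' \<le> d"
        interpret bireg \<mu> M N nb D d by fact
        have "\<not> robust_family True w M nb 1 (\<lambda>_. l) (\<epsilon> / 4 * (spider_total M D d 1 (\<lambda>_. l)))"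
        proof
          assume "robust_family True w M nb 1 (\<lambda>_. l) (\<epsilon> / 4 * (spider_total M D d 1 (\<lambda>_. l)))"
          then obtain \<S> where S: "\<S> \<subseteq> spiders M nb 1 (\<lambda>_. l)" "robust True 1 (\<lambda>_. l) w \<S>"
            "\<epsilon> / 4 * (spider_total M D d 1 (\<lambda>_. l)) < real (card \<S>)" by blast
          note bro = C'[rule_format, OF br _ _ S(1)[unfolded q(1)] S(3)[unfolded q(1)]]
          have "subdivision_embedded nb (2 * k) s t r"
          proof (cases "even l")
            case True
            obtain X Y where XY: "finite X" "card X = s" "finite Y" "A \<le> card Y"
              "\<forall>x\<in>X. \<forall>y\<in>Y. \<exists>\<sigma>\<in>\<S>. \<sigma> (0, 0) = x \<and> \<sigma> (0, l) = y"
              using bro CD unfolding q(1)[symmetric] by auto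
            have "card X + t \<le> card Y" using XY by (simp add: A_def)
            with XY(1,3) obtain Y' where Y': "Y' \<subseteq> Y" "finite Y'" "card Y' = t" "X \<inter> Y' = {}"
              by (rule subset_of_card_avoiding)
            show ?thesis
            proof (rule robustly_connected_subdivision_embedded[OF XY(1) Y'(2) XY(2) Y'(3,4)])
              fix x y assume xy: "x \<in> X" "y \<in> Y'"
              obtain \<sigma> where s: "\<sigma> \<in> \<S>" "\<sigma> (0, 0) = x" "\<sigma> (0, l) = y" using XY(5) xy Y'(1) by blast
              show "robustly_connected nb (2 * k) w1 x y"
                unfolding robustly_connected_def
              proof (intro allI impI)
                fix W :: "'a set" assume W: "finite W" "card W \<le> w1" "x \<notin> W" "y \<notin> W"
                show "\<exists>R\<in>paths nb (2 * k) x y. R ` Pos 1 (\<lambda>_. 2 * k) \<inter> W = {}"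
                  using True l2 less(3) W by (intro robustly_connected_of_ends[OF S(2,1) _ _ _ s W(1)]) (auto simp: w_def)
              qed
            qed (simp add: w1_def)
          next
            case False
            then have l3: "3 \<le> l" using l2 by (cases "l = 2") auto
            then have q2: "2 \<le> q" using q(1) by simp
            then obtain X Y where XY: "finite X" "card X = s" "finite Y" "A \<le> card Y"
              "\<forall>y\<in>Y. \<exists>Z. finite Z \<and> A \<le> card Z \<and> Z \<subseteq> nb y \<and>
                (\<forall>x\<in>X. \<forall>z\<in>Z. \<exists>\<sigma>\<in>\<S>. \<sigma> (0, 0) = x \<and> \<sigma> (0, l) = z)"
              using bro CD q2 unfolding q(1)[symmetric] by auto
            have "card X + t \<le> card Y" using XY by (simp add: A_def)
            with XY(1,3) obtain Y' where Y': "Y' \<subseteq> Y" "finite Y'" "card Y' = t" "X \<inter> Y' = {}"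
              by (rule subset_of_card_avoiding)
            have lk: "l \<le> 2 * k - 1" "even (2 * k - 1 - l)" "Suc (2 * k - 1) = 2 * k"
            proof -
              have "l \<noteq> 2 * k" using False by auto
              then show "l \<le> 2 * k - 1" using less(3) by simp
              then show "even (2 * k - 1 - l)" "Suc (2 * k - 1) = 2 * k" using False l3 by auto
            qed
            show ?thesis
            proof (rule robustly_connected_subdivision_embedded[OF XY(1) Y'(2) XY(2) Y'(3,4)])
              fix x y assume xy: "x \<in> X" "y \<in> Y'"
              obtain Z where Z: "finite Z" "A \<le> card Z" "Z \<subseteq> nb y"
                "\<forall>x\<in>X. \<forall>z\<in>Z. \<exists>\<sigma>\<in>\<S>. \<sigma> (0, 0) = x \<and> \<sigma> (0, l) = z" using XY(5) xy(2) Y'(1) by blast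
              show "robustly_connected nb (2 * k) w1 x y"
                unfolding robustly_connected_def
              proof (intro allI impI)
                fix W :: "'a set" assume W: "finite W" "card W \<le> w1" "x \<notin> W" "y \<notin> W"
                have "card (W \<union> {x, y}) \<le> card W + 2"
                  using card_Un_le[of W "{x, y}"] card_insert_le_m1[of 2 "{y}" x] by simp
                then have "\<not> Z \<subseteq> W \<union> {x, y}"
                  using card_mono[of "W \<union> {x, y}" Z] W Z(2) by (auto simp: A_def)
                then obtain z where z: "z \<in> Z" "z \<notin> W" "z \<noteq> x" "z \<noteq> y" by auto
                obtain \<sigma> where s: "\<sigma> \<in> \<S>" "\<sigma> (0, 0) = x" "\<sigma> (0, l) = z" using Z(4) xy(1) z(1) by blast
                have "x \<noteq> y" using xy Y'(4) by blast
                \<comment> \<open>\<open>y\<close> is avoided as well, so that it can be appended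
                  after its neighbour \<open>z\<close>.\<close>
                then have "\<exists>R\<in>paths nb (2 * k - 1) x z. R ` Pos 1 (\<lambda>_. 2 * k - 1) \<inter> insert y W = {}"
                  using l2 lk W z by (intro robustly_connected_of_ends[OF S(2,1) _ _ _ s]) (auto simp: w_def card_insert_if)
                then obtain R where R: "R \<in> paths nb (2 * k - 1) x z" "R ` Pos 1 (\<lambda>_. 2 * k - 1) \<inter> insert y W = {}"
                  by blast
                let ?R = "R((0, Suc (2 * k - 1)) := y)"
                have RS: "R \<in> spiders {x} nb 1 (\<lambda>_. 2 * k - 1)" "R (0, 2 * k - 1) = z" using R(1) by (auto simp: paths_def)
                have "y \<in> nb z" using sym Z(3) z(1) by blast
                then have R': "?R \<in> spiders {x} nb 1 ((\<lambda>_. 2 * k - 1)(0 := Suc (2 * k - 1)))"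
                  using spiders_upd[OF RS(1), of 0 y] RS(2) R(2) by simp
                have eq: "spiders {x} nb 1 ((\<lambda>_. 2 * k - 1)(0 := Suc (2 * k - 1))) = spiders {x} nb 1 (\<lambda>_. 2 * k)"
                  using lk(3) by (intro spiders_cong) simp
                have "?R \<in> paths nb (2 * k) x y" using R' eq lk(3) by (auto simp: paths_def)
                moreover have "?R ` Pos 1 (\<lambda>_. 2 * k) \<inter> W = {}"
                proof -
                  have "?R a \<notin> W" if a: "a \<in> Pos 1 (\<lambda>_. 2 * k)" for a
                  proof (cases "a = (0, Suc (2 * k - 1))")
                    case True
                    then show ?thesis using W(4) by simp
                  next
                    case False
                    then have "a \<in> Pos 1 (\<lambda>_. 2 * k - 1)" using a lk(3) by (cases a) auto
                    then have "R a \<notin> W" using R(2) by blast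
                    then show ?thesis using False by (simp only: fun_upd_other not_False_eq_True)
                  qed
                  then show ?thesis by blast
                qed
                ultimately show "\<exists>R\<in>paths nb (2 * k) x y. R ` Pos 1 (\<lambda>_. 2 * k) \<inter> W = {}" by blast
              qed
            qed (simp add: w1_def)
          qed
          then show False using Fnb F by simp
        qed
        moreover have "C \<le> D" "C \<le> d" using CD by auto
        ultimately show "real (card (heavy_spiders True K M nb 1 (\<lambda>_. l)))
           \<le> \<epsilon> * (spider_total M D d 1 (\<lambda>_. l))"
          using key_class[rule_format, OF br Fnb] by blast
      qed
      then show "\<exists>K C. heavy_bound \<mu> F True 1 (\<lambda>_. l) \<epsilon> K C" by blast
    qed
  qed
qed

section \<open>Spiders with \<open>s\<close> legs and prescribed leaves\<close>

lemma robust_replace: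
  "robust fx p b w \<S> \<Longrightarrow> \<sigma> \<in> \<S> \<Longrightarrow> i < p \<Longrightarrow> finite W \<Longrightarrow> card W \<le> w \<Longrightarrow>
    \<exists>v. v \<notin> W \<and> \<sigma>((i, b i) := v) \<in> \<S>"
  by (simp add: robust_def)

text \<open>Leaves are moved one at a time against the same \<open>W\<close>; each move stays in
  \<open>\<S>\<close> and leaves the earlier ones intact.\<close>

lemma (in bireg) replace_leaves:
  assumes rob: "robust fx p b w \<S>" and s: "\<sigma> \<in> \<S>" and fin: "finite W" "card W \<le> w"
    and Q: "finite Q" "Q \<subseteq> {..<p}"
  shows "\<exists>\<sigma>'\<in>\<S>. (\<forall>q. q \<notin> (\<lambda>i. (i, b i)) ` Q \<longrightarrow> \<sigma>' q = \<sigma> q) \<and> (\<forall>i\<in>Q. \<sigma>' (i, b i) \<notin> W)"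
  using Q
proof (induction Q rule: finite_induct)
  case empty
  then show ?case using s by auto
next
  case (insert i Q)
  then obtain \<sigma>' where s': "\<sigma>' \<in> \<S>" "\<forall>q. q \<notin> (\<lambda>i. (i, b i)) ` Q \<longrightarrow> \<sigma>' q = \<sigma> q" "\<forall>i\<in>Q. \<sigma>' (i, b i) \<notin> W"
    by auto
  obtain v where v: "v \<notin> W" "\<sigma>'((i, b i) := v) \<in> \<S>"
    using robust_replace[OF rob s'(1) _ fin, of i] insert(4) by auto
  show ?case using s' v insert(2) by (intro bexI[OF _ v(2)]) auto
qed

lemma (in bireg) extend_leaves:
  assumes r: "\<rho> \<in> spiders S nb p c" and Q: "finite Q" "Q \<subseteq> {..<p}" and x: "inj_on x {..<p}"
    and nbx: "\<And>i. i \<in> Q \<Longrightarrow> x i \<in> nb (\<rho> (lpos i (c i)))" and new: "\<And>i. i \<in> Q \<Longrightarrow> x i \<notin> \<rho> ` Pos p c"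
  shows "\<exists>R\<in>spiders S nb p (\<lambda>i. if i \<in> Q then Suc (c i) else c i). (\<forall>q\<in>Pos p c. R q = \<rho> q) \<and>
    (\<forall>i\<in>Q. R (i, Suc (c i)) = x i) \<and> R ` Pos p (\<lambda>i. if i \<in> Q then Suc (c i) else c i) \<subseteq> \<rho> ` Pos p c \<union> x ` Q"
  using Q nbx new
proof (induction Q rule: finite_induct)
  case empty
  then show ?case using r by (intro bexI[of _ \<rho>]) auto
next
  case (insert i Q)
  let ?c = "\<lambda>i. if i \<in> Q then Suc (c i) else c i"
  have "\<exists>R\<in>spiders S nb p ?c. (\<forall>q\<in>Pos p c. R q = \<rho> q) \<and> (\<forall>i\<in>Q. R (i, Suc (c i)) = x i) \<and> R ` Pos p ?c \<subseteq> \<rho> ` Pos p c \<union> x ` Q"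
    by (rule insert.IH) (use insert.prems in auto)
  then obtain R where R: "R \<in> spiders S nb p ?c" "\<forall>q\<in>Pos p c. R q = \<rho> q" "\<forall>i\<in>Q. R (i, Suc (c i)) = x i"
    "R ` Pos p ?c \<subseteq> \<rho> ` Pos p c \<union> x ` Q" by blast
  have ip: "i < p" "Q \<subseteq> {..<p}" using insert.prems(1) by auto
  have ci: "?c i = c i" using insert(2) by simp
  have ceq: "(\<lambda>i'. if i' \<in> insert i Q then Suc (c i') else c i') = ?c(i := Suc (?c i))"
    using insert(2) by auto
  define R' where "R' = R((i, Suc (?c i)) := x i)"
  have "x i \<notin> x ` Q"
  proof
    assume "x i \<in> x ` Q"
    then obtain j where "j \<in> Q" "x i = x j" by auto
    then have "i = j" using x ip by (auto simp: inj_on_def)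
    then show False using insert(2) \<open>j \<in> Q\<close> by simp
  qed
  then have xn: "x i \<notin> R ` Pos p ?c" using R(4) insert.prems(3)[of i] by blast
  have Rp: "R (lpos i (?c i)) = \<rho> (lpos i (c i))" unfolding ci using R(2) ip by (simp add: lpos_in_Pos)
  have xnb: "x i \<in> nb (R (lpos i (?c i)))" unfolding Rp using insert.prems(2)[of i] by simp
  have R': "R' \<in> spiders S nb p (?c(i := Suc (?c i)))"
    unfolding R'_def by (rule spiders_upd[OF R(1) ip(1) xnb xn])
  have P: "Pos p (?c(i := Suc (?c i))) = insert (i, Suc (?c i)) (Pos p ?c)" by (rule Pos_upd_Suc[OF ip(1)])
  have nin: "(i, Suc (?c i)) \<notin> Pos p ?c" by (simp only: in_Pos) simp
  have sub: "Pos p c \<subseteq> Pos p ?c" by (rule Pos_mono) simp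
  have 1: "R' q = \<rho> q" if q: "q \<in> Pos p c" for q
  proof -
    have "q \<noteq> (i, Suc (?c i))" using q sub nin by blast
    then show ?thesis using R(2) q unfolding R'_def by (simp only: fun_upd_other not_False_eq_True)
  qed
  have 2: "R' (i', Suc (c i')) = x i'" if i': "i' \<in> insert i Q" for i'
    using R(3) i' insert(2) ci by (cases "i' = i") (auto simp: R'_def)
  have 3: "R' ` Pos p (?c(i := Suc (?c i))) \<subseteq> \<rho> ` Pos p c \<union> x ` insert i Q"
  proof
    fix v assume "v \<in> R' ` Pos p (?c(i := Suc (?c i)))"
    then obtain q where q: "q \<in> insert (i, Suc (?c i)) (Pos p ?c)" "v = R' q" unfolding P by blast
    show "v \<in> \<rho> ` Pos p c \<union> x ` insert i Q"
    proof (cases "q = (i, Suc (?c i))")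
      case True
      then show ?thesis using q(2) by (simp add: R'_def)
    next
      case False
      then have "v = R q" "q \<in> Pos p ?c"
        using q unfolding R'_def by (simp_all only: fun_upd_other not_False_eq_True) blast
      then show ?thesis using R(4) by blast
    qed
  qed
  show ?case unfolding ceq using R' 1 2 3 by (intro bexI[OF _ R'] conjI ballI)
qed

text \<open>The branch vertices on the \<open>s\<close>-side are the leaves of one spider, or their predecessors on legs of odd
  length; these are distinct as long as at most one leg has length 1.\<close>

lemma (in bireg) spider_embed:
  assumes rob: "robust False s b w \<S>" and SS: "\<S> \<subseteq> spiders M nb s b" and s0: "\<sigma> \<in> \<S>" and s: "0 < s" and k: "0 < k"
    and b: "\<And>i. i < s \<Longrightarrow> 0 < b i \<and> b i \<le> 2 * k"
    and one: "\<And>i j. i < s \<Longrightarrow> j < s \<Longrightarrow> b i = 1 \<Longrightarrow> b j = 1 \<Longrightarrow> i = j"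
    and w: "t * Suc (s * (2 * k)) + s + 4 * (s * k) + 1 \<le> w"
  shows "subdivision_embedded nb (2 * k) s t 1"
proof -
  \<comment> \<open>All \<open>x i\<close> lie at even distance from the centre, as the ends of legs
    of length \<open>2 * k\<close> must.\<close>
  define qx where "qx = (\<lambda>i. if odd (b i) then lpos i (b i - 1) else (i, b i))"
  define x where "x = (\<lambda>i. \<sigma> (qx i))"
  have sSP: "\<sigma> \<in> spiders M nb s b" using s0 SS by auto
  have qP: "qx i \<in> Pos s b" if "i < s" for i using that b[OF that] by (auto simp: qx_def lpos_in_Pos in_Pos)
  have fstq: "qx i = (0, 0) \<and> b i = 1 \<or> fst (qx i) = i \<and> 0 < snd (qx i)" if "i < s" for i
    using b[OF that] by (auto simp: qx_def lpos_def)
  have qinj: "i = j" if "i < s" "j < s" "qx i = qx j" for i j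
    using fstq[OF that(1)] fstq[OF that(2)] that one by auto
  have x: "inj_on x {..<s}"
  proof (rule inj_onI)
    fix i j assume a: "i \<in> {..<s}" "j \<in> {..<s}" "x i = x j"
    then have "qx i = qx j" using inj_onD[OF spiders_inj[OF sSP], of "qx i" "qx j"] qP by (simp add: x_def)
    then show "i = j" using qinj a by simp
  qed
  define Q where "Q = {i. i < s \<and> odd (b i)}"
  \<comment> \<open>Half of the missing length, rounded down: legs reach \<open>2 * k\<close> if
    \<open>b i\<close> is even and \<open>2 * k - 1\<close> if it is odd.\<close>
  define m where "m = (\<lambda>i. (2 * k - b i) div 2)"
  define c where "c = (\<lambda>i. b i + 2 * m i)"
  have Q: "finite Q" "Q \<subseteq> {..<s}" by (auto simp: Q_def)
  have c: "if i \<in> Q then Suc (c i) = 2 * k else c i = 2 * k" if "i < s" for i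
  proof -
    have "b i \<le> 2 * k" using b that by simp
    then show ?thesis using that by (cases "even (b i)"; simp add: Q_def c_def m_def; presburger)
  qed
  have sumb: "(\<Sum>i<s. b i) \<le> 2 * (s * k)"
    using sum_bounded_above[of "{..<s}" b "2 * k"] b by (simp add: ac_simps)
  have summ: "(\<Sum>i<s. m i) \<le> s * k"
    using sum_bounded_above[of "{..<s}" m k] by (simp add: m_def)
  have cPos: "card (Pos s b) \<le> Suc (2 * (s * k))" using card_Pos_le[of s b] sumb by simp
  show ?thesis
  proof (rule spiders_subdivision_embedded[OF s _ x, of "2 * k" "t * Suc (s * (2 * k))"])
    show "0 < 2 * k" using k by simp
  next
    fix W :: "'a set" assume W: "finite W" "card W \<le> t * Suc (s * (2 * k))" "W \<inter> x ` {..<s} = {}"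
    have "card (W \<union> \<sigma> ` Pos s b) \<le> card W + card (Pos s b)"
      using card_Un_le[of W "\<sigma> ` Pos s b"] card_image_le[of "Pos s b" \<sigma>] by simp
    then have "card (W \<union> \<sigma> ` Pos s b) \<le> w" using W(2) w cPos by linarith
    moreover have "finite (W \<union> \<sigma> ` Pos s b)" using W(1) by simp
    \<comment> \<open>On odd legs the old leaf is exchanged for a fresh neighbour of
      \<open>x i\<close>. The spider grown on this new key avoids every \<open>x i\<close> with
      \<open>i \<in> Q\<close>, and a last edge then leads back to \<open>x i\<close>.\<close>
    ultimately obtain \<sigma>' where s': "\<sigma>' \<in> \<S>" "\<forall>q. q \<notin> (\<lambda>i. (i, b i)) ` Q \<longrightarrow> \<sigma>' q = \<sigma> q"
      "\<forall>i\<in>Q. \<sigma>' (i, b i) \<notin> W \<union> \<sigma> ` Pos s b"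
      using replace_leaves[OF rob s0 _ _ Q, of "W \<union> \<sigma> ` Pos s b"] by blast
    have s'spiders: "\<sigma>' \<in> spiders M nb s b" using s'(1) SS by auto
    define W' where "W' = W \<union> x ` Q"
    have "card W' \<le> card W + s"
    proof -
      have "card (x ` Q) \<le> s" using card_image_le[OF Q(1), of x] card_mono[OF _ Q(2)] by simp
      then show ?thesis unfolding W'_def using card_Un_le[of W "x ` Q"] by linarith
    qed
    then have cW': "card W' + 2 * (\<Sum>i<s. m i) + card (Pos s b) \<le> w" using W(2) w cPos summ by linarith
    have disj: "W' \<inter> \<sigma>' ` Keys False s b = {}"
    proof -
      have "\<sigma>' (i, b i) \<notin> W'" if i: "i < s" for i
      proof (cases "i \<in> Q")
        case True
        have "x ` Q \<subseteq> \<sigma> ` Pos s b" using qP Q(2) by (auto simp: x_def)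
        then show ?thesis using s'(3) True by (auto simp: W'_def)
      next
        case False
        then have "\<sigma>' (i, b i) = \<sigma> (i, b i)" using s'(2) by auto
        also have "\<dots> = x i" using False i by (simp add: x_def qx_def Q_def)
        finally have e: "\<sigma>' (i, b i) = x i" .
        have "x i \<notin> W" using W(3) i by blast
        moreover have "x i \<notin> x ` Q"
        proof
          assume "x i \<in> x ` Q"
          then obtain j where "j \<in> Q" "x i = x j" by auto
          then have "i = j" using inj_onD[OF x, of i j] i Q(2) by auto
          then show False using False \<open>j \<in> Q\<close> by simp
        qed
        ultimately show ?thesis using e by (simp add: W'_def)
      qed
      then show ?thesis by (auto simp: Keys_def)
    qed
    have "\<exists>\<rho>\<in>spiders M nb s (\<lambda>i. b i + 2 * m i). \<rho> ` Pos s (\<lambda>i. b i + 2 * m i) \<inter> W' = {} \<and>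
      (\<forall>i<s. \<rho> (i, b i + 2 * m i) = \<sigma>' (i, b i)) \<and> (False \<longrightarrow> \<rho> (0, 0) = \<sigma>' (0, 0))"
      using b W(1) Q(1) by (intro zigzag[OF rob SS _ _ s'(1) _ cW' disj]) (auto simp: W'_def)
    then obtain \<rho> where r: "\<rho> \<in> spiders M nb s c" "\<rho> ` Pos s c \<inter> W' = {}" "\<And>i. i < s \<Longrightarrow> \<rho> (i, c i) = \<sigma>' (i, b i)"
      unfolding c_def by blast
    have cpos: "0 < c i" if "i < s" for i using b[OF that] by (simp add: c_def)
    have nbx: "x i \<in> nb (\<rho> (lpos i (c i)))" if iQ: "i \<in> Q" for i
    proof -
      have i: "i < s" "odd (b i)" using iQ by (auto simp: Q_def)
      have "lpos i (b i - 1) \<notin> (\<lambda>i. (i, b i)) ` Q"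
        using b[OF i(1)] by (auto simp: lpos_def Q_def split: if_splits)
      then have "\<sigma>' (lpos i (b i - 1)) = x i" using s'(2)[rule_format, of "lpos i (b i - 1)"] i by (simp add: x_def qx_def)
      moreover have "\<sigma>' (i, Suc (b i - 1)) \<in> nb (\<sigma>' (lpos i (b i - 1)))"
        by (rule spiders_step[OF s'spiders i(1)]) (use b[OF i(1)] in simp)
      ultimately have "\<sigma>' (i, b i) \<in> nb (x i)" using b[OF i(1)] by simp
      moreover have "\<rho> (lpos i (c i)) = \<sigma>' (i, b i)" using r(3)[OF i(1)] cpos[OF i(1)] by (simp add: lpos_def)
      ultimately show ?thesis using sym by simp
    qed
    have new: "x i \<notin> \<rho> ` Pos s c" if "i \<in> Q" for i using r(2) that by (auto simp: W'_def)
    let ?c = "\<lambda>i. if i \<in> Q then Suc (c i) else c i"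
    obtain R where R: "R \<in> spiders M nb s ?c" "\<forall>q\<in>Pos s c. R q = \<rho> q" "\<forall>i\<in>Q. R (i, Suc (c i)) = x i"
      "R ` Pos s ?c \<subseteq> \<rho> ` Pos s c \<union> x ` Q"
      using extend_leaves[OF r(1) Q x nbx new] by blast
    have ceq: "?c i = 2 * k" if "i < s" for i using c[OF that] by (simp split: if_splits)
    have "R \<in> spiders M nb s (\<lambda>_. 2 * k)" using R(1) spiders_cong[of s ?c "\<lambda>_. 2 * k" M nb] ceq by simp
    moreover have "R (i, 2 * k) = x i" if i: "i < s" for i
    proof (cases "i \<in> Q")
      case True
      then have "Suc (c i) = 2 * k" using ceq[OF i] by simp
      then show ?thesis using R(3)[rule_format, OF True] by (simp only:)
    next
      case False
      have "R (i, c i) = \<rho> (i, c i)" using R(2) i cpos[OF i] by (simp add: in_Pos)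
      also have "\<dots> = \<sigma>' (i, b i)" using r(3)[OF i] .
      also have "\<dots> = \<sigma> (i, b i)" using s'(2) False by auto
      also have "\<dots> = x i" using False i by (simp add: x_def qx_def Q_def)
      finally show ?thesis using ceq[OF i] False by simp
    qed
    moreover have "R ` Pos s (\<lambda>_. 2 * k) \<inter> W = {}"
    proof -
      have Pe: "Pos s (\<lambda>_. 2 * k) = Pos s ?c" by (rule Pos_cong) (simp only: ceq)
      have "x ` Q \<inter> W = {}" using W(3) Q(2) by blast
      moreover have "\<rho> ` Pos s c \<inter> W = {}" using r(2) by (auto simp: W'_def)
      ultimately have "(\<rho> ` Pos s c \<union> x ` Q) \<inter> W = {}" by (simp only: Int_Un_distrib2 Un_empty_left)
      then show ?thesis unfolding Pe using Int_mono[OF R(4) subset_refl[of W]] by (simp only: subset_empty)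
    qed
    ultimately show "\<exists>R\<in>spiders M nb s (\<lambda>_. 2 * k). (\<forall>i<s. R (i, 2 * k) = x i) \<and> R ` Pos s (\<lambda>_. 2 * k) \<inter> W = {}"
      by blast
  qed simp
qed

text \<open>If two legs have length 1, the predecessors of both leaves are the centre. This case is excluded
  since the two leaves would form a heavy pair at distance 2.\<close>

lemma (in bireg) cherry_density:
  assumes ij: "i < p" "j < p" "i \<noteq> j" "b i = 1" "b j = 1" and eps: "0 \<le> \<epsilon>"
    and h: "real (card {\<tau> \<in> spiders N nb 1 (\<lambda>_. 2). K < card (paths nb 2 (\<tau> (0, 0)) (\<tau> (0, 2)))})
      \<le> \<epsilon> * (spider_total N d D 1 (\<lambda>_. 2))"
  shows "real (card {\<sigma> \<in> spiders M nb p b. K < card (paths nb 2 (\<sigma> (i, 1)) (\<sigma> (j, 1)))})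
    \<le> \<epsilon> * real \<mu> * real \<mu> ^ (\<Sum>i<p. b i) * (spider_total M D d p b)"
proof -
  interpret sw: bireg \<mu> N M nb d D by (rule swap)
  define b' where "b' = (\<lambda>i'. if i' = i \<or> i' = j then 1 else (0 :: nat))"
  define Y where "Y = {\<tau> \<in> spiders N nb 1 (\<lambda>_. 2). K < card (paths nb 2 (\<tau> (0, 0)) (\<tau> (0, 2)))}"
  define X where "X = {\<rho> \<in> spiders M nb p b'. K < card (paths nb 2 (\<rho> (i, 1)) (\<rho> (j, 1)))}"
  have P: "Pos p b' = {(0, 0), (i, 1), (j, 1)}" using ij by (auto simp: Pos_def b'_def split: if_splits)
  have P2: "Pos 1 (\<lambda>_. 2) = {(0, 0), (0, 1), (0, 2)}" by (auto simp: Pos_def)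
  define cv where "cv = (\<lambda>\<rho> :: nat \<times> nat \<Rightarrow> 'a. restrict (\<lambda>q. if snd q = 0 then \<rho> (i, 1) else if snd q = 1 then \<rho> (0, 0) else \<rho> (j, 1)) (Pos 1 (\<lambda>_. 2)))"
  have cvv: "cv \<rho> (0, 0) = \<rho> (i, 1)" "cv \<rho> (0, 1) = \<rho> (0, 0)" "cv \<rho> (0, 2) = \<rho> (j, 1)" for \<rho>
    by (simp_all add: cv_def)
  have "inj_on cv X"
  proof (rule inj_onI)
    fix \<rho> \<rho>' assume a: "\<rho> \<in> X" "\<rho>' \<in> X" "cv \<rho> = cv \<rho>'"
    show "\<rho> = \<rho>'"
    proof (rule spiders_eqI)
      fix q assume "q \<in> Pos p b'"
      then show "\<rho> q = \<rho>' q" using a(3) cvv[of \<rho>] cvv[of \<rho>'] unfolding P by auto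
    qed (use a in \<open>auto simp: X_def\<close>)
  qed
  moreover have "cv ` X \<subseteq> Y"
  proof
    fix \<tau> assume "\<tau> \<in> cv ` X"
    then obtain \<rho> where r: "\<rho> \<in> X" "\<tau> = cv \<rho>" by auto
    then have \<rho>: "\<rho> \<in> spiders M nb p b'" by (simp add: X_def)
    have st: "\<rho> (i, 1) \<in> nb (\<rho> (0, 0))" "\<rho> (j, 1) \<in> nb (\<rho> (0, 0))"
      using spiders_step[OF \<rho> ij(1), of 0] spiders_step[OF \<rho> ij(2), of 0] by (auto simp: b'_def)
    have "\<rho> (0, 0) \<in> M" using spiders_center[OF \<rho>] .
    then have "\<rho> (i, 1) \<in> N" using st nbM by blast
    have inj: "inj_on \<rho> {(0, 0), (i, 1), (j, 1)}" using spiders_inj[OF \<rho>] P by simp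
    then have ne: "\<rho> (i, 1) \<noteq> \<rho> (0, 0)" "\<rho> (j, 1) \<noteq> \<rho> (0, 0)" "\<rho> (i, 1) \<noteq> \<rho> (j, 1)"
      using ij by (auto simp: inj_on_def)
    have "\<tau> \<in> spiders N nb 1 (\<lambda>_. 2)"
    proof -
      have "inj_on \<tau> (Pos 1 (\<lambda>_. 2))"
        unfolding P2 r(2) using ne cvv[of \<rho>] by (auto simp: inj_on_def)
      moreover have "\<tau> (0, Suc m) \<in> nb (\<tau> (0, m))" if "m < 2" for m
      proof -
        have "m = 0 \<or> m = 1" using that by auto
        then show ?thesis using cvv[of \<rho>] st sym r(2) by (auto simp: numeral_2_eq_2)
      qed
      ultimately show ?thesis using cvv[of \<rho>] r(2) \<open>\<rho> (i, 1) \<in> N\<close> by (simp add: spiders_def cv_def)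
    qed
    then show "\<tau> \<in> Y" using r cvv[of \<rho>] by (simp add: Y_def X_def)
  qed
  moreover have "finite Y" unfolding Y_def using sw.finite_spiders[of N 1 "\<lambda>_. 2"] by simp
  ultimately have "card X \<le> card Y" by (rule card_inj_on_le)
  also have "real (card Y) \<le> \<epsilon> * (real (card N) * (real d * real D))"
    using h by (simp add: Y_def weight_def growth_Suc sdeg_def numeral_2_eq_2)
  also have "\<dots> \<le> \<epsilon> * (real \<mu> * (real (card M) * (real D * real D)))"
  proof -
    have "card N * d * D \<le> \<mu> * (card M * D) * D" using sw.balance by (rule mult_right_mono) simp
    then have "real (card N * d * D) \<le> real (\<mu> * (card M * D) * D)" by (simp only: of_nat_le_iff)
    then show ?thesis using eps by (intro mult_left_mono) (simp_all add: mult.assoc)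
  qed
  also have "real D * real D = weight D d p b'"
  proof -
    have "weight D d p b' = (\<Prod>i'\<in>{..<p}. if i' \<in> {i, j} then real D else 1)"
      unfolding weight_def by (rule prod.cong) (auto simp: b'_def growth_Suc sdeg_def)
    also have "\<dots> = (\<Prod>i'\<in>{..<p} \<inter> {i, j}. real D)" by (rule prod.inter_restrict[symmetric]) simp
    also have "{..<p} \<inter> {i, j} = {i, j}" using ij by auto
    finally show ?thesis using ij(3) by simp
  qed
  finally have cX: "real (card X) \<le> \<epsilon> * real \<mu> * (spider_total M D d p b')" by simp
  have le: "b' i' \<le> b i'" for i' using ij by (simp add: b'_def)
  have "{\<sigma> \<in> spiders M nb p b. K < card (paths nb 2 (\<sigma> (i, 1)) (\<sigma> (j, 1)))}
     \<subseteq> {\<sigma> \<in> spiders M nb p b. restrict \<sigma> (Pos p b') \<in> X}"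
  proof
    fix \<sigma> assume s: "\<sigma> \<in> {\<sigma> \<in> spiders M nb p b. K < card (paths nb 2 (\<sigma> (i, 1)) (\<sigma> (j, 1)))}"
    have "restrict \<sigma> (Pos p b') \<in> spiders M nb p b'"
      using s le by (intro restrict_spiders[of _ _ _ _ b]) auto
    moreover have "restrict \<sigma> (Pos p b') (i, 1) = \<sigma> (i, 1)" "restrict \<sigma> (Pos p b') (j, 1) = \<sigma> (j, 1)"
      unfolding P by auto
    ultimately show "\<sigma> \<in> {\<sigma> \<in> spiders M nb p b. restrict \<sigma> (Pos p b') \<in> X}"
      using s by (simp add: X_def)
  qed
  then have "card {\<sigma> \<in> spiders M nb p b. K < card (paths nb 2 (\<sigma> (i, 1)) (\<sigma> (j, 1)))}
     \<le> card {\<sigma> \<in> spiders M nb p b. restrict \<sigma> (Pos p b') \<in> X}"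
    using finite_spiders[of M p b] by (intro card_mono) auto
  moreover have "real (card {\<sigma> \<in> spiders M nb p b. restrict \<sigma> (Pos p b') \<in> X})
    \<le> \<epsilon> * real \<mu> * real \<mu> ^ (\<Sum>i<p. b i) * (spider_total M D d p b)"
    using cX le by (intro dens_ext[of p b' b]) (auto simp: X_def)
  ultimately show ?thesis by linarith
qed

text \<open>If at most \<open>K\<close> paths of length 2 joined the two leaves, their midpoints
  could be avoided by a spider on the same leaves, although its centre is such a midpoint.\<close>

lemma (in bireg) robust_cherry_heavy:
  assumes rob: "robust False p b w \<S>" and SS: "\<S> \<subseteq> spiders M nb p b" and s: "\<sigma> \<in> \<S>"
    and ij: "i < p" "j < p" "i \<noteq> j" "b i = 1" "b j = 1" and bpos: "\<And>i. i < p \<Longrightarrow> 0 < b i" and K: "K \<le> w"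
  shows "K < card (paths nb 2 (\<sigma> (i, 1)) (\<sigma> (j, 1)))"
proof (rule ccontr)
  assume n: "\<not> ?thesis"
  have sSP: "\<sigma> \<in> spiders M nb p b" using s SS by auto
  define V where "V = (\<lambda>\<tau>. \<tau> (0 :: nat, 1 :: nat)) ` paths nb 2 (\<sigma> (i, 1)) (\<sigma> (j, 1))"
  have "\<sigma> (i, 1) \<in> M \<union> N" using spiders_range[OF sSP subset_refl, of "(i, 1)"] ij by (simp add: in_Pos)
  then have fin: "finite (paths nb 2 (\<sigma> (i, 1)) (\<sigma> (j, 1)))" by (rule finite_paths)
  \<comment> \<open>Robustness only avoids sets off the key; the centre survives this subtraction
    because it is never a leaf.\<close>
  define W where "W = V - \<sigma> ` Keys False p b"
  have finW: "finite W" using fin by (simp add: W_def V_def)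
  have "card W \<le> card V" unfolding W_def V_def using fin by (intro card_mono) auto
  also have "\<dots> \<le> card (paths nb 2 (\<sigma> (i, 1)) (\<sigma> (j, 1)))" unfolding V_def using fin by (rule card_image_le)
  finally have "card W \<le> w" using n K by linarith
  moreover have "W \<inter> \<sigma> ` Keys False p b = {}" by (auto simp: W_def)
  ultimately obtain \<sigma>' where s': "\<sigma>' \<in> key_class False p b \<S> \<sigma>" "\<sigma>' ` Pos p b \<inter> W = {}"
    using rob s finW unfolding robust_def by blast
  have s'spiders: "\<sigma>' \<in> spiders M nb p b" using s'(1) SS by (auto simp: key_class_def)
  have agree: "\<sigma>' q = \<sigma> q" if "q \<in> Keys False p b" for q using s'(1) that by (simp add: key_class_def)
  have lf: "\<sigma>' (i, 1) = \<sigma> (i, 1)" "\<sigma>' (j, 1) = \<sigma> (j, 1)"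
    using agree[of "(i, 1)"] agree[of "(j, 1)"] ij by (force simp: Keys_def)+
  define \<tau> where "\<tau> = restrict (\<lambda>q. if snd q = 0 then \<sigma>' (i, 1) else if snd q = 1 then \<sigma>' (0, 0) else \<sigma>' (j, 1)) (Pos 1 (\<lambda>_. 2))"
  have tv: "\<tau> (0, 0) = \<sigma>' (i, 1)" "\<tau> (0, 1) = \<sigma>' (0, 0)" "\<tau> (0, 2) = \<sigma>' (j, 1)" by (simp_all add: \<tau>_def)
  have P2: "Pos 1 (\<lambda>_. 2) = {(0, 0), (0, 1), (0, 2)}" by (auto simp: Pos_def)
  have st: "\<sigma>' (i, 1) \<in> nb (\<sigma>' (0, 0))" "\<sigma>' (j, 1) \<in> nb (\<sigma>' (0, 0))"
    using spiders_step[OF s'spiders ij(1), of 0] spiders_step[OF s'spiders ij(2), of 0] ij by auto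
  have P: "(0, 0) \<in> Pos p b" "(i, 1) \<in> Pos p b" "(j, 1) \<in> Pos p b" using ij by (auto simp: in_Pos)
  have ne: "\<sigma>' (i, 1) \<noteq> \<sigma>' (0, 0)" "\<sigma>' (j, 1) \<noteq> \<sigma>' (0, 0)" "\<sigma>' (i, 1) \<noteq> \<sigma>' (j, 1)"
    using inj_on_eq_iff[OF spiders_inj[OF s'spiders]] P ij(3) by auto
  have "\<tau> \<in> paths nb 2 (\<sigma> (i, 1)) (\<sigma> (j, 1))"
  proof -
    have "inj_on \<tau> (Pos 1 (\<lambda>_. 2))"
      unfolding P2 using ne tv by (auto simp: inj_on_def)
    moreover have "\<tau> (0, Suc m) \<in> nb (\<tau> (0, m))" if "m < 2" for m
    proof -
      have "m = 0 \<or> m = 1" using that by auto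
      then show ?thesis using tv st sym by (auto simp: numeral_2_eq_2)
    qed
    ultimately show ?thesis using tv lf by (simp add: paths_def spiders_def \<tau>_def)
  qed
  then have "\<tau> (0, 1) \<in> V" by (auto simp: V_def)
  then have cV: "\<sigma>' (0, 0) \<in> V" using tv by simp
  moreover have "\<sigma>' (0, 0) \<notin> \<sigma> ` Keys False p b"
  proof
    assume "\<sigma>' (0, 0) \<in> \<sigma> ` Keys False p b"
    then obtain i' where i': "i' < p" "\<sigma>' (0, 0) = \<sigma> (i', b i')" by (auto simp: Keys_def)
    then have "\<sigma>' (0, 0) = \<sigma>' (i', b i')" using agree[of "(i', b i')"] by (auto simp: Keys_def)
    moreover have "(i', b i') \<in> Pos p b" using i' bpos by (simp add: in_Pos)
    ultimately have "(0, 0) = (i', b i')" using inj_onD[OF spiders_inj[OF s'spiders]] P(1) by metis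
    then show False using bpos[OF i'(1)] by simp
  qed
  ultimately have "\<sigma>' (0, 0) \<in> W" by (simp add: W_def)
  then show False using s'(2) P(1) by blast
qed

text \<open>Induction on the total leg length; a dense robust family is contradictory in two ways.
  With two legs of length 1 each member has a heavy pair of leaves, which is too rare by
  \<open>cherry_density\<close>. Otherwise a single member already leads to the subdivision.\<close>

lemma spider_claim:
  fixes F :: "('a \<Rightarrow> 'a set) \<Rightarrow> bool"
  assumes mu: "1 \<le> \<mu>" and s2: "2 \<le> s" and k: "0 < k" and F: "F = (\<lambda>nb. \<not> subdivision_embedded nb (2 * k) s t 1)"
  shows "(\<And>i. i < s \<Longrightarrow> 0 < b i \<and> b i \<le> 2 * k) \<Longrightarrow> few_heavy \<mu> F False s b"
proof (induction "\<Sum>i<s. b i" arbitrary: b rule: less_induct)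
  case less
  have s: "0 < s" using s2 by simp
  have path: "few_heavy \<mu> F True 1 (\<lambda>_. m)" if "0 < m" "m \<le> 2 * k" for m
    using path_claim[OF mu s F] that by blast
  have trunc: "few_heavy \<mu> F False s (b(i := j))" if ij: "i < s" "0 < j" "j < b i" for i j
  proof (rule less(1))
    show "(\<Sum>i'<s. (b(i := j)) i') < (\<Sum>i'<s. b i')"
      using ij by (intro sum_strict_mono_ex1) auto
  next
    fix i' assume "i' < s"
    then show "0 < (b(i := j)) i' \<and> (b(i := j)) i' \<le> 2 * k" using less(2)[of i'] ij by auto
  qed
  define B where "B = (\<Sum>i<s. b i)"
  show ?case
    unfolding few_heavy_def
  proof (intro allI impI)
    fix \<epsilon> :: real assume eps: "0 < \<epsilon>"
    \<comment> \<open>Makes the bound of \<open>cherry_density\<close> exactly the proportion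
      \<open>\<epsilon> / 4\<close>, which the robust family strictly exceeds.\<close>
    define \<epsilon>1 where "\<epsilon>1 = \<epsilon> / (4 * real \<mu> * real \<mu> ^ B)"
    have mu1: "1 \<le> real \<mu>" using mu by simp
    have e1: "0 < \<epsilon>1" using eps mu1 by (simp add: \<epsilon>1_def)
    have "few_heavy \<mu> F True 1 (\<lambda>_. 2)" using k by (intro path) auto
    then obtain K1 C1 where KC1: "heavy_bound \<mu> F True 1 (\<lambda>_. 2) \<epsilon>1 K1 C1" using e1 unfolding few_heavy_def by blast
    \<comment> \<open>The demand of \<open>spider_embed\<close> plus \<open>K1\<close>, the number
      of midpoints that \<open>robust_cherry_heavy\<close> has to avoid.\<close>
    define w where "w = t * Suc (s * (2 * k)) + s + 4 * (s * k) + 1 + K1"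
    have "\<exists>K C. \<forall>M N nb D d. bireg \<mu> M N nb D d \<longrightarrow> F nb \<longrightarrow> C \<le> D \<longrightarrow> C \<le> d \<longrightarrow>
         real (card (heavy_spiders False K M nb s b))
           \<le> \<epsilon> * (spider_total M D d s b) \<or>
         robust_family False w M nb s b (\<epsilon> / 4 * (spider_total M D d s b))"
    proof (rule few_heavy_or_robust_family[OF s _ mu eps trunc])
      fix i m assume a: "i < s" "0 < m" "m \<le> b i"
      then have "m \<le> 2 * k" using less(2)[of i] by simp
      then show "few_heavy \<mu> F True 1 (\<lambda>_. m)" using path a by simp
    qed (use less(2) in auto)
    then obtain K C where key_class: "\<forall>M N nb D d. bireg \<mu> M N nb D d \<longrightarrow> F nb \<longrightarrow> C \<le> D \<longrightarrow> C \<le> d \<longrightarrow>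
         real (card (heavy_spiders False K M nb s b))
           \<le> \<epsilon> * (spider_total M D d s b) \<or>
         robust_family False w M nb s b (\<epsilon> / 4 * (spider_total M D d s b))"
      by (elim exE) (rule that)
    have "heavy_bound \<mu> F False s b \<epsilon> K (max C C1)"
      unfolding heavy_bound_def
    proof (intro allI impI)
      fix M N :: "'a set" and nb D d
      assume br: "bireg \<mu> M N nb D d" and Fnb: "F nb" and CD: "max C C1 \<le> D" "max C C1 \<le> d"
      interpret bireg \<mu> M N nb D d by fact
      have T0: "0 \<le> \<epsilon> / 4 * (spider_total M D d s b)"
        using eps weight_pos[OF Dpos dpos, of s b] by simp
      have "\<not> robust_family False w M nb s b (\<epsilon> / 4 * (spider_total M D d s b))"
      proof
        assume "robust_family False w M nb s b (\<epsilon> / 4 * (spider_total M D d s b))"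
        then obtain \<S> where S: "\<S> \<subseteq> spiders M nb s b" "robust False s b w \<S>"
          "\<epsilon> / 4 * (spider_total M D d s b) < real (card \<S>)" by blast
        show False
        proof (cases "\<exists>i j. i < s \<and> j < s \<and> i \<noteq> j \<and> b i = 1 \<and> b j = 1")
          case True
          then obtain i j where ij: "i < s" "j < s" "i \<noteq> j" "b i = 1" "b j = 1" by blast
          have "K1 \<le> w" by (simp add: w_def)
          have "\<S> \<subseteq> {\<sigma> \<in> spiders M nb s b. K1 < card (paths nb 2 (\<sigma> (i, 1)) (\<sigma> (j, 1)))}"
          proof
            fix \<sigma> assume a: "\<sigma> \<in> \<S>"
            have "K1 < card (paths nb 2 (\<sigma> (i, 1)) (\<sigma> (j, 1)))"
              using less(2) by (intro robust_cherry_heavy[OF S(2,1) a ij _ \<open>K1 \<le> w\<close>]) auto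
            then show "\<sigma> \<in> {\<sigma> \<in> spiders M nb s b. K1 < card (paths nb 2 (\<sigma> (i, 1)) (\<sigma> (j, 1)))}"
              using a S(1) by auto
          qed
          then have "card \<S> \<le> card {\<sigma> \<in> spiders M nb s b. K1 < card (paths nb 2 (\<sigma> (i, 1)) (\<sigma> (j, 1)))}"
            using finite_spiders[of M s b] by (intro card_mono) auto
          moreover have "real (card {\<sigma> \<in> spiders M nb s b. K1 < card (paths nb 2 (\<sigma> (i, 1)) (\<sigma> (j, 1)))})
            \<le> \<epsilon>1 * real \<mu> * real \<mu> ^ (\<Sum>i<s. b i) * (spider_total M D d s b)"
          proof (rule cherry_density[OF ij])
            show "0 \<le> \<epsilon>1" using e1 by simp
            have "real (card (heavy_spiders True K1 N nb 1 (\<lambda>_. 2)))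
              \<le> \<epsilon>1 * (spider_total N d D 1 (\<lambda>_. 2))"
              using KC1[unfolded heavy_bound_def, rule_format, OF swap Fnb] CD by simp
            moreover have "(heavy_spiders True K1 N nb 1 (\<lambda>_. 2))
              = {\<tau> \<in> spiders N nb 1 (\<lambda>_. 2). K1 < card (paths nb 2 (\<tau> (0, 0)) (\<tau> (0, 2)))}"
              by (intro Collect_cong conj_cong refl) (simp only: key_class_path[OF spiders_center])
            ultimately show "real (card {\<tau> \<in> spiders N nb 1 (\<lambda>_. 2). K1 < card (paths nb 2 (\<tau> (0, 0)) (\<tau> (0, 2)))})
              \<le> \<epsilon>1 * (spider_total N d D 1 (\<lambda>_. 2))" by simp
          qed
          moreover have "\<epsilon>1 * real \<mu> * real \<mu> ^ (\<Sum>i<s. b i) = \<epsilon> / 4"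
            using mu1 by (simp add: \<epsilon>1_def B_def)
          ultimately show False using S(3) by (simp only:)
        next
          case False
          have "\<S> \<noteq> {}" using S(3) T0 by auto
          then obtain \<sigma> where a: "\<sigma> \<in> \<S>" by blast
          have "subdivision_embedded nb (2 * k) s t 1"
            using False less(2) k s by (intro spider_embed[OF S(2,1) a]) (auto simp: w_def)
          then show False using Fnb F by simp
        qed
      qed
      moreover have "C \<le> D" "C \<le> d" using CD by auto
      ultimately show "real (card (heavy_spiders False K M nb s b))
           \<le> \<epsilon> * (spider_total M D d s b)"
        using key_class[rule_format, OF br Fnb] by blast
    qed
    then show "\<exists>K C. heavy_bound \<mu> F False s b \<epsilon> K C" by blast
  qed
qed

section \<open>From spiders to the edge bound\<close>

definition neighbours :: "'a ugraph \<Rightarrow> 'a \<Rightarrow> 'a set" where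
  "neighbours G v = {u. {v, u} \<in> edges G}"

text \<open>In \<open>complete_bipartite s t\<close> the \<open>s\<close> side has the smaller
  numbers, so \<open>Min e\<close> is always on that side and the paths are numbered from
  \<open>x\<close>, just as in \<open>subdivision_embedded\<close>. A vertex \<open>v\<close> of the
  other side goes to \<open>y (v - s)\<close>.\<close>

lemma subdivision_embedded_contains_copy:
  assumes bip: "bipartite_graph G M N" and emb: "subdivision_embedded (neighbours G) l s t r"
    and pos: "0 < l" "0 < s" "0 < t" "0 < r"
  shows "contains_copy G (subdivision l r (complete_bipartite s t))"
proof -
  obtain x y P where ix: "inj_on x {..<s}" and iy: "inj_on y {..<t}" and xy: "x ` {..<s} \<inter> y ` {..<t} = {}"
    and P: "\<forall>i<s. \<forall>j<t. \<forall>h<r. P i j h 0 = x i \<and> P i j h l = y j \<and>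
        (\<forall>m<l. P i j h (Suc m) \<in> neighbours G (P i j h m)) \<and>
        (\<forall>m. 0 < m \<longrightarrow> m < l \<longrightarrow> P i j h m \<notin> x ` {..<s} \<union> y ` {..<t})"
    and iP: "inj_on (\<lambda>(i, j, h, m). P i j h m) ({..<s} \<times> {..<t} \<times> {..<r} \<times> {0<..<l})"
    using emb unfolding subdivision_embedded_def by (elim exE conjE) (rule that)
  define H where "H = complete_bipartite s t"
  have He: "\<exists>u v. u < s \<and> s \<le> v \<and> v < s + t \<and> e = {u, v} \<and> Min e = u \<and> Max e = v" if e: "e \<in> edges H" for e
  proof -
    obtain u v where uv: "u < s" "s \<le> v" "v < s + t" "e = {u, v}" using e by (auto simp: H_def complete_bipartite_def)
    then have "Min e = u" "Max e = v" by auto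
    then show ?thesis using uv by blast
  qed
  define f where "f = (\<lambda>v. case v of Branch u \<Rightarrow> if u < s then x u else y (u - s)
    | Inner e h m \<Rightarrow> P (Min e) (Max e - s) h m)"
  have fB: "f (Branch u) = (if u < s then x u else y (u - s))" for u by (simp add: f_def)
  have fI: "f (Inner e h m) = P (Min e) (Max e - s) h m" for e h m by (simp add: f_def)
  have fp: "f (path_vertex l e h m) = P (Min e) (Max e - s) h m" if e: "e \<in> edges H" and h: "h < r" and m: "m \<le> l" for e h m
  proof -
    obtain u v where uv: "u < s" "s \<le> v" "v < s + t" "e = {u, v}" "Min e = u" "Max e = v" using He[OF e] by blast
    then have "P u (v - s) h 0 = x u" "P u (v - s) h l = y (v - s)" using P h by auto
    then show ?thesis using uv m by (auto simp: path_vertex_def fB fI)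
  qed
  have stepE: "{P i j h m, P i j h (Suc m)} \<in> edges G" if "i < s" "j < t" "h < r" "m < l" for i j h m
    using P that by (auto simp: neighbours_def)
  have inV: "v \<in> verts G" if "e \<in> edges G" "v \<in> e" for e v
  proof -
    have "\<exists>a\<in>M. \<exists>b\<in>N. e = {a, b}" "verts G = M \<union> N" using that(1) bip by (simp_all add: bipartite_graph_def)
    then show ?thesis using that(2) by auto
  qed
  have PV: "P i j h m \<in> verts G" if "i < s" "j < t" "h < r" "m \<le> l" for i j h m
  proof (cases "m < l")
    case True
    then show ?thesis using inV[OF stepE[OF that(1-3) True]] by simp
  next
    case False
    then have "m = Suc (l - 1)" "l - 1 < l" using that pos by auto
    then show ?thesis using inV[OF stepE[OF that(1-3) \<open>l - 1 < l\<close>]] by simp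
  qed
  have V: "verts (subdivision l r H) = Branch ` {..<s + t} \<union> {Inner e h m | e h m. e \<in> edges H \<and> h < r \<and> 0 < m \<and> m < l}"
    by (simp add: subdivision_def H_def complete_bipartite_def)
  have E: "edges (subdivision l r H) = {{path_vertex l e h m, path_vertex l e h (Suc m)} | e h m. e \<in> edges H \<and> h < r \<and> m < l}"
    by (simp add: subdivision_def)
  have branch_in: "f (Branch u) \<in> x ` {..<s} \<union> y ` {..<t}" if "u < s + t" for u
    using that by (auto simp: fB)
  have inner_out: "f (Inner e h m) \<notin> x ` {..<s} \<union> y ` {..<t}" if e: "e \<in> edges H" "h < r" "0 < m" "m < l" for e h m
  proof -
    obtain u v where uv: "u < s" "s \<le> v" "v < s + t" "Min e = u" "Max e = v" using He[OF e(1)] by blast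
    then have "P u (v - s) h m \<notin> x ` {..<s} \<union> y ` {..<t}" using P e by simp
    then show ?thesis using uv by (simp add: fI)
  qed
  have "inj_on f (verts (subdivision l r H))"
  proof (rule inj_onI)
    fix a a' assume a: "a \<in> verts (subdivision l r H)" "a' \<in> verts (subdivision l r H)" "f a = f a'"
    show "a = a'"
    proof (cases a)
      case (Branch u)
      then have u: "u < s + t" using a(1) V by auto
      show ?thesis
      proof (cases a')
        case (Branch u')
        then have u': "u' < s + t" using a(2) V by auto
        have eq: "(if u < s then x u else y (u - s)) = (if u' < s then x u' else y (u' - s))"
          using a(3) \<open>a = Branch u\<close> \<open>a' = Branch u'\<close> fB by simp
        have "u = u'"
        proof (cases "u < s"; cases "u' < s")
          assume "u < s" "u' < s"
          then show ?thesis using eq inj_onD[OF ix] by simp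
        next
          assume c: "u < s" "\<not> u' < s"
          then have "u' - s < t" "x u = y (u' - s)" using eq u' by auto
          moreover have "x u \<in> x ` {..<s}" using c by blast
          ultimately show ?thesis using xy by blast
        next
          assume c: "\<not> u < s" "u' < s"
          then have "u - s < t" "x u' = y (u - s)" using eq u by auto
          moreover have "x u' \<in> x ` {..<s}" using c by blast
          ultimately show ?thesis using xy by blast
        next
          assume c: "\<not> u < s" "\<not> u' < s"
          then have "u - s = u' - s" using eq inj_onD[OF iy, of "u - s" "u' - s"] u u' by simp
          then show ?thesis using c by simp
        qed
        then show ?thesis using \<open>a = Branch u\<close> \<open>a' = Branch u'\<close> by simp
      next
        case (Inner e h m)
        then have e: "e \<in> edges H" "h < r" "0 < m" "m < l" using a(2) V by auto
        have "f a' \<notin> x ` {..<s} \<union> y ` {..<t}" unfolding Inner by (rule inner_out[OF e])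
        then show ?thesis using branch_in[OF u] a(3) \<open>a = Branch u\<close> by simp
      qed
    next
      case (Inner e h m)
      then have e: "e \<in> edges H" "h < r" "0 < m" "m < l" using a(1) V by auto
      show ?thesis
      proof (cases a')
        case (Branch u')
        then have u': "u' < s + t" using a(2) V by auto
        then show ?thesis using branch_in[OF u'] inner_out[OF e] a(3) \<open>a = Inner e h m\<close> Branch by simp
      next
        case (Inner e' h' m')
        then have e': "e' \<in> edges H" "h' < r" "0 < m'" "m' < l" using a(2) V by auto
        obtain u v where uv: "u < s" "s \<le> v" "v < s + t" "e = {u, v}" "Min e = u" "Max e = v" using He[OF e(1)] by blast
        obtain u' v' where uv': "u' < s" "s \<le> v'" "v' < s + t" "e' = {u', v'}" "Min e' = u'" "Max e' = v'" using He[OF e'(1)] by blast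
        have "P u (v - s) h m = P u' (v' - s) h' m'"
          using a(3) \<open>a = Inner e h m\<close> \<open>a' = Inner e' h' m'\<close> uv uv' by (simp add: fI)
        then have "(u, v - s, h, m) = (u', v' - s, h', m')"
          using inj_onD[OF iP, of "(u, v - s, h, m)" "(u', v' - s, h', m')"] uv uv' e e' by simp
        then have "u = u'" "v = v'" "h = h'" "m = m'" using uv uv' by auto
        then show ?thesis using \<open>a = Inner e h m\<close> \<open>a' = Inner e' h' m'\<close> uv uv' by simp
      qed
    qed
  qed
  moreover have "f ` verts (subdivision l r H) \<subseteq> verts G"
  proof
    fix z assume "z \<in> f ` verts (subdivision l r H)"
    then obtain a where a: "a \<in> verts (subdivision l r H)" "z = f a" by auto
    show "z \<in> verts G"
    proof (cases a)
      case (Branch u)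
      then have u: "u < s + t" using a(1) V by auto
      show ?thesis
      proof (cases "u < s")
        case True
        then have "z = P u 0 0 0" using a(2) Branch P pos by (simp add: fB)
        then show ?thesis using PV[of u 0 0 0] True pos by simp
      next
        case False
        then have "z = P 0 (u - s) 0 l" using a(2) Branch P pos u by (simp add: fB)
        then show ?thesis using PV[of 0 "u - s" 0 l] False pos u by simp
      qed
    next
      case (Inner e h m)
      then have e: "e \<in> edges H" "h < r" "0 < m" "m < l" using a(1) V by auto
      obtain u v where uv: "u < s" "s \<le> v" "v < s + t" "Min e = u" "Max e = v" using He[OF e(1)] by blast
      then show ?thesis using a(2) Inner PV[of u "v - s" h m] e by (simp add: fI)
    qed
  qed
  moreover have "f ` e' \<in> edges G" if e': "e' \<in> edges (subdivision l r H)" for e'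
  proof -
    obtain e h m where e: "e' = {path_vertex l e h m, path_vertex l e h (Suc m)}" "e \<in> edges H" "h < r" "m < l"
      using e' E by auto
    obtain u v where uv: "u < s" "s \<le> v" "v < s + t" "Min e = u" "Max e = v" using He[OF e(2)] by blast
    have "f ` e' = {P u (v - s) h m, P u (v - s) h (Suc m)}"
      using e fp[OF e(2,3), of m] fp[OF e(2,3), of "Suc m"] uv by simp
    then show ?thesis using stepE[of u "v - s" h m] uv e by simp
  qed
  ultimately show ?thesis unfolding contains_copy_def H_def by blast
qed

text \<open>With \<open>T\<close> the spider total and \<open>B\<close> the leg sum, there are at
  least \<open>T / 2 ^ B\<close> spiders. The heavy ones are at most half of this bound, and the
  light ones at most \<open>K\<close> per key. Even legs end in \<open>M\<close>, so at most
  \<open>card M ^ card (Keys fx p b)\<close> keys occur.\<close>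

lemma (in bireg) light_count:
  assumes h: "real (card (heavy_spiders fx K M nb p b))
      \<le> 1 / 2 ^ Suc (\<Sum>i<p. b i) * (spider_total M D d p b)"
    and ev: "\<And>i. i < p \<Longrightarrow> even (b i) \<and> 0 < b i"
    and big: "2 * Suc (\<Sum>i<p. b i) \<le> D" "2 * Suc (\<Sum>i<p. b i) \<le> d"
  shows "real (card M) * weight D d p b \<le> 2 ^ Suc (\<Sum>i<p. b i) * real K * real (card M) ^ card (Keys fx p b)"
proof -
  define B where "B = (\<Sum>i<p. b i)"
  define T where "T = real (card M) * weight D d p b"
  define Hv where "Hv = heavy_spiders fx K M nb p b"
  define Lt where "Lt = spiders M nb p b - Hv"
  have finSP: "finite (spiders M nb p b)" by (rule finite_spiders) simp
  have finLP: "finite (Keys fx p b)" by (simp add: Keys_def)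
  define key where "key = (\<lambda>\<sigma> :: nat \<times> nat \<Rightarrow> 'a. restrict \<sigma> (Keys fx p b))"
  have "key ` Lt \<subseteq> (\<Pi>\<^sub>E q\<in>Keys fx p b. M)"
  proof
    fix g assume "g \<in> key ` Lt"
    then obtain \<sigma> where s: "\<sigma> \<in> spiders M nb p b" "g = key \<sigma>" by (auto simp: Lt_def)
    have "\<sigma> q \<in> M" if qL: "q \<in> Keys fx p b" for q
    proof -
      consider i where "i < p" "q = (i, b i)" | "q = (0, 0)" using qL by (auto simp: Keys_def split: if_splits)
      then show ?thesis
      proof cases
        case 1
        then show ?thesis using spiders_side[OF s(1) subset_refl 1(1) order_refl] ev[OF 1(1)] by (simp add: lpos_def)
      next
        case 2
        then show ?thesis using spiders_center[OF s(1)] by simp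
      qed
    qed
    then show "g \<in> (\<Pi>\<^sub>E q\<in>Keys fx p b. M)" using s(2) by (simp add: key_def PiE_def)
  qed
  then have "card (key ` Lt) \<le> card (\<Pi>\<^sub>E q\<in>Keys fx p b. M)"
    using finLP finM by (intro card_mono finite_PiE) auto
  also have "\<dots> = card M ^ card (Keys fx p b)" using finLP by (simp add: card_PiE)
  finally have keys: "card (key ` Lt) \<le> card M ^ card (Keys fx p b)" .
  have "Lt \<subseteq> (\<Union>g\<in>key ` Lt. {\<sigma> \<in> spiders M nb p b. key \<sigma> = g})" by (auto simp: Lt_def)
  then have "card Lt \<le> card (\<Union>g\<in>key ` Lt. {\<sigma> \<in> spiders M nb p b. key \<sigma> = g})"
    using finSP by (intro card_mono) (auto simp: Lt_def)
  also have "\<dots> \<le> card (key ` Lt) * K"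
  proof (rule card_UN_le_bound)
    show "finite (key ` Lt)" using finSP by (simp add: Lt_def)
    fix g assume "g \<in> key ` Lt"
    then obtain \<sigma> where s: "\<sigma> \<in> Lt" "g = key \<sigma>" by auto
    have "{\<sigma>' \<in> spiders M nb p b. key \<sigma>' = g} = key_class fx p b (spiders M nb p b) \<sigma>"
      by (auto simp: s(2) key_def restrict_eq_iff key_class_def)
    then show "card {\<sigma>' \<in> spiders M nb p b. key \<sigma>' = g} \<le> K" using s(1) by (auto simp: Lt_def Hv_def)
  qed
  also have "\<dots> \<le> card M ^ card (Keys fx p b) * K" using keys by (rule mult_right_mono) simp
  finally have Lt: "real (card Lt) \<le> real (card M) ^ card (Keys fx p b) * real K"
    by (metis of_nat_le_iff of_nat_mult of_nat_power)
  have "Hv \<subseteq> spiders M nb p b" by (auto simp: Hv_def)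
  then have "card (spiders M nb p b) = card Hv + card Lt"
    unfolding Lt_def using finSP card_mono[OF finSP, of Hv] finite_subset[of Hv "spiders M nb p b"]
    by (simp add: card_Diff_subset)
  then have "T \<le> 2 ^ B * (real (card Hv) + real (card Lt))"
    using card_spiders_ge[OF big] by (simp add: B_def T_def)
  also have "\<dots> \<le> 2 ^ B * (1 / 2 ^ Suc B * T + real (card M) ^ card (Keys fx p b) * real K)"
    using h Lt by (intro mult_left_mono add_mono) (auto simp: Hv_def T_def B_def)
  also have "\<dots> = T / 2 + 2 ^ B * (real (card M) ^ card (Keys fx p b) * real K)"
    by (simp add: distrib_left)
  finally have "T \<le> 2 * (2 ^ B * (real (card M) ^ card (Keys fx p b) * real K))" by linarith
  then show ?thesis by (simp add: T_def B_def ac_simps)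
qed

text \<open>Applied with \<open>e\<close> the number of edges, \<open>a = card M\<close>,
  \<open>n = card N\<close> and \<open>X = D * d\<close>. Taking \<open>2 * p\<close>-th roots in
  the second assumption bounds the square root of \<open>X\<close> by a power of \<open>a\<close>;
  here \<open>p\<close> is half the total leg length.\<close>

lemma powr_bound:
  fixes e a n X Q m :: real
  assumes e: "e\<^sup>2 \<le> m\<^sup>2 * (a * n * X)" and X: "X ^ p \<le> Q * a ^ c" and p: "0 < p"
    and pos: "0 < a" "0 \<le> n" "0 < X" "0 < Q" "0 \<le> m"
  shows "e \<le> m * Q powr (1 / (2 * real p)) * (a powr (1 / 2 + real c / (2 * real p)) * n powr (1 / 2))"
proof -
  have "X powr (1 / 2) = (X ^ p) powr (1 / (2 * real p))"
    using pos p by (simp add: powr_realpow[symmetric] powr_powr)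
  also have "\<dots> \<le> (Q * a ^ c) powr (1 / (2 * real p))"
    using X pos by (intro powr_mono2) auto
  also have "\<dots> = Q powr (1 / (2 * real p)) * a powr (real c / (2 * real p))"
    using pos by (simp add: powr_mult powr_realpow[symmetric] powr_powr)
  finally have sX: "X powr (1 / 2) \<le> Q powr (1 / (2 * real p)) * a powr (real c / (2 * real p))" .
  have "e \<le> sqrt (m\<^sup>2 * (a * n * X))" using e by (rule real_le_rsqrt)
  also have "\<dots> = m * (a powr (1 / 2) * n powr (1 / 2) * X powr (1 / 2))"
    using pos by (simp add: real_sqrt_mult powr_half_sqrt)
  also have "\<dots> \<le> m * (a powr (1 / 2) * n powr (1 / 2) * (Q powr (1 / (2 * real p)) * a powr (real c / (2 * real p))))"
    using sX pos by (intro mult_left_mono) auto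
  also have "\<dots> = m * Q powr (1 / (2 * real p)) * (a powr (1 / 2 + real c / (2 * real p)) * n powr (1 / 2))"
    by (simp add: powr_add)
  finally show ?thesis .
qed

text \<open>Of the \<open>Suc c\<close> prescribed vertices in \<open>M\<close>, one cancels against
  the factor \<open>card M\<close> for the centres, which leaves \<open>card M ^ c\<close> as bound
  for \<open>(D * d) ^ (k * p)\<close> up to a constant. Both bounds of the theorem are instances:
  \<open>c = p = 1\<close> for paths, \<open>c = s - 1\<close> and \<open>p = s\<close> for
  spiders.\<close>

lemma edge_bound:
  fixes F :: "('a \<Rightarrow> 'a set) \<Rightarrow> bool"
  assumes few: "few_heavy \<mu> F fx p (\<lambda>_. 2 * k)" and pos: "1 \<le> \<mu>" "0 < k" "0 < p"
    and Keys: "card (Keys fx p (\<lambda>_. 2 * k)) = Suc c"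
  shows "\<exists>C>0. \<forall>(G :: 'a ugraph) M N. bipartite_graph G M N \<longrightarrow> almost_biregular \<mu> G M N \<longrightarrow> F (neighbours G) \<longrightarrow>
    real (card (edges G)) \<le> C * (real (card M) powr (1 / 2 + real c / (2 * real (k * p))) * real (card N) powr (1 / 2)
      + real (card M) + real (card N))"
proof -
  define B where "B = (\<Sum>i<p. 2 * k)"
  obtain K C0 where key_class: "heavy_bound \<mu> F fx p (\<lambda>_. 2 * k) (1 / 2 ^ Suc B) K C0"
    using few unfolding few_heavy_def by (meson divide_pos_pos zero_less_numeral zero_less_one zero_less_power)
  \<comment> \<open>If a minimum degree is below \<open>C1\<close>, the number of edges is at most
    \<open>\<mu> * C1\<close> times the size of that side; otherwise the degrees suffice for both
    \<open>heavy_bound\<close> and \<open>light_count\<close>.\<close>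
  define C1 where "C1 = max C0 (2 * Suc B)"
  \<comment> \<open>\<open>K + 1\<close> rather than \<open>K\<close> makes \<open>Q\<close>
    positive.\<close>
  define Q where "Q = 2 ^ Suc B * (real K + 1)"
  define C where "C = real \<mu> * real C1 + real \<mu> * Q powr (1 / (2 * real (k * p)))"
  have Qpos: "0 < Q" by (simp add: Q_def add_nonneg_pos)
  have Cpos: "0 < C" using pos Qpos by (auto simp: C_def C1_def intro!: add_pos_nonneg mult_pos_pos)
  have "real (card (edges G)) \<le> C * (real (card M) powr (1 / 2 + real c / (2 * real (k * p))) * real (card N) powr (1 / 2)
      + real (card M) + real (card N))"
    if bip: "bipartite_graph G M N" and ab: "almost_biregular \<mu> G M N" and F: "F (neighbours G)"
    for G :: "'a ugraph" and M N
  proof -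
    define R where "R = real (card M) powr (1 / 2 + real c / (2 * real (k * p))) * real (card N) powr (1 / 2)"
    have R0: "0 \<le> R" by (simp add: R_def)
    have fin: "finite M" "finite N" "M \<inter> N = {}" and ed: "\<And>e. e \<in> edges G \<Longrightarrow> \<exists>a\<in>M. \<exists>b\<in>N. e = {a, b}"
      using bip by (auto simp: bipartite_graph_def)
    have nbM: "neighbours G v \<subseteq> N" if "v \<in> M" for v
      using ed fin(3) that by (fastforce simp: neighbours_def doubleton_eq_iff)
    have nbN: "neighbours G v \<subseteq> M" if "v \<in> N" for v
      using ed fin(3) that by (fastforce simp: neighbours_def doubleton_eq_iff)
    have sy: "v \<in> neighbours G u" if "u \<in> neighbours G v" for u v using that by (simp add: neighbours_def insert_commute)
    have deg: "vdegree G v = card (neighbours G v)" if v: "v \<in> M \<union> N" for v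
    proof -
      have "inj_on (\<lambda>u. {v, u}) (neighbours G v)" by (auto simp: inj_on_def doubleton_eq_iff)
      moreover have "{e \<in> edges G. v \<in> e} = (\<lambda>u. {v, u}) ` neighbours G v"
      proof -
        have "\<exists>u. e = {v, u}" if "e \<in> edges G" "v \<in> e" for e
          using ed[OF that(1)] that(2) by (metis insertE insert_commute singletonD)
        then show ?thesis by (auto simp: neighbours_def)
      qed
      ultimately show ?thesis by (simp add: vdegree_def card_image)
    qed
    show ?thesis
    proof (cases "M = {} \<or> N = {}")
      case True
      then have "edges G = {}" using ed by blast
      then show ?thesis using R0 Cpos by (simp add: R_def[symmetric])
    next
      case False
      then have ne: "M \<noteq> {}" "N \<noteq> {}" by auto
      define D where "D = min_degree_on G M"
      define d where "d = min_degree_on G N"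
      have degM: "D \<le> card (neighbours G v) \<and> card (neighbours G v) \<le> \<mu> * D" if v: "v \<in> M" for v
      proof -
        have "D \<le> vdegree G v" unfolding D_def min_degree_on_def using fin v by (intro Min_le) auto
        moreover have "vdegree G v \<le> max_degree_on G M" unfolding max_degree_on_def using fin v by (intro Max_ge) auto
        moreover have "max_degree_on G M \<le> \<mu> * D" using ab ne by (simp add: almost_biregular_def D_def)
        ultimately show ?thesis using deg v by simp
      qed
      have degN: "d \<le> card (neighbours G v) \<and> card (neighbours G v) \<le> \<mu> * d" if v: "v \<in> N" for v
      proof -
        have "d \<le> vdegree G v" unfolding d_def min_degree_on_def using fin v by (intro Min_le) auto
        moreover have "vdegree G v \<le> max_degree_on G N" unfolding max_degree_on_def using fin v by (intro Max_ge) auto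
        moreover have "max_degree_on G N \<le> \<mu> * d" using ab ne by (simp add: almost_biregular_def d_def)
        ultimately show ?thesis using deg v by simp
      qed
      have ecount: "card (edges G) \<le> card A * n"
        if A: "finite A" "\<And>v. v \<in> A \<Longrightarrow> finite (neighbours G v) \<and> card (neighbours G v) \<le> n" "\<And>e. e \<in> edges G \<Longrightarrow> \<exists>v\<in>A. v \<in> e" "A \<subseteq> M \<union> N" for A n
      proof -
        have "edges G \<subseteq> (\<Union>v\<in>A. (\<lambda>u. {v, u}) ` neighbours G v)"
        proof
          fix e assume e: "e \<in> edges G"
          obtain v where v: "v \<in> A" "v \<in> e" using A(3)[OF e] by blast
          obtain a b where "e = {a, b}" using ed[OF e] by blast
          then obtain u where "e = {v, u}" using v(2) by blast
          then show "e \<in> (\<Union>v\<in>A. (\<lambda>u. {v, u}) ` neighbours G v)" using v e by (auto simp: neighbours_def)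
        qed
        then have "card (edges G) \<le> card (\<Union>v\<in>A. (\<lambda>u. {v, u}) ` neighbours G v)"
          using A by (intro card_mono) auto
        also have "\<dots> \<le> card A * n"
          using A(1,2) by (intro card_UN_le_bound) (auto intro: le_trans[OF card_image_le])
        finally show ?thesis .
      qed
      have eM: "card (edges G) \<le> card M * (\<mu> * D)"
      proof (rule ecount)
        show "finite (neighbours G v) \<and> card (neighbours G v) \<le> \<mu> * D" if "v \<in> M" for v
          using finite_subset[OF nbM[OF that] fin(2)] degM[OF that] by simp
        show "\<exists>v\<in>M. v \<in> e" if "e \<in> edges G" for e using ed[OF that] by blast
      qed (use fin in auto)
      have eN: "card (edges G) \<le> card N * (\<mu> * d)"
      proof (rule ecount)
        show "finite (neighbours G v) \<and> card (neighbours G v) \<le> \<mu> * d" if "v \<in> N" for v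
          using finite_subset[OF nbN[OF that] fin(1)] degN[OF that] by simp
        show "\<exists>v\<in>N. v \<in> e" if "e \<in> edges G" for e using ed[OF that] by blast
      qed (use fin in auto)
      have eM': "real (card (edges G)) \<le> real (card M) * (real \<mu> * real D)"
        using of_nat_mono[OF eM, where 'a = real] by simp
      have eN': "real (card (edges G)) \<le> real (card N) * (real \<mu> * real d)"
        using of_nat_mono[OF eN, where 'a = real] by simp
      have small: "real (card (edges G)) \<le> C * (R + real (card M) + real (card N))"
        if "real (card (edges G)) \<le> real n * (real \<mu> * real x)" "x \<le> C1" "real n \<le> real (card M) + real (card N)" for n x
      proof -
        have "real \<mu> * real x \<le> real \<mu> * real C1" using that(2) by (intro mult_left_mono) auto
        also have "\<dots> \<le> C" by (simp add: C_def)
        finally have "real \<mu> * real x \<le> C" .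
        then have "real n * (real \<mu> * real x) \<le> real n * C" by (rule mult_left_mono) simp
        also have "\<dots> \<le> (R + real (card M) + real (card N)) * C"
          using that(3) R0 Cpos by (intro mult_right_mono) auto
        finally show ?thesis using that(1) by (simp add: mult.commute)
      qed
      show ?thesis
        unfolding R_def[symmetric]
      proof (cases "C1 \<le> D \<and> C1 \<le> d")
        case False
        then show "real (card (edges G)) \<le> C * (R + real (card M) + real (card N))"
          using small[OF eM'] small[OF eN'] by auto
      next
        case True
        then have CD: "C0 \<le> D" "C0 \<le> d" "2 * Suc B \<le> D" "2 * Suc B \<le> d" by (auto simp: C1_def)
        interpret bireg \<mu> M N "neighbours G" D d
        proof
          show "0 < D" "0 < d" using CD by auto
        qed (use fin nbM nbN sy degM degN pos in auto)
        have "real (card {\<sigma> \<in> spiders M (neighbours G) p (\<lambda>_. 2 * k). K < card (key_class fx p (\<lambda>_. 2 * k) (spiders M (neighbours G) p (\<lambda>_. 2 * k)) \<sigma>)})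
          \<le> 1 / 2 ^ Suc B * (spider_total M D d p (\<lambda>_. 2 * k))"
          using key_class[unfolded heavy_bound_def, rule_format, OF bireg_axioms F CD(1,2)] .
        then have "real (card M) * weight D d p (\<lambda>_. 2 * k) \<le> 2 ^ Suc B * real K * real (card M) ^ card (Keys fx p (\<lambda>_. 2 * k))"
          unfolding B_def using pos CD(3,4) by (intro light_count) (auto simp: B_def)
        also have "\<dots> = real (card M) * ((2 ^ Suc B * real K) * real (card M) ^ c)" by (simp add: Keys)
        finally have "weight D d p (\<lambda>_. 2 * k) \<le> (2 ^ Suc B * real K) * real (card M) ^ c"
          using ne fin by (subst (asm) mult_le_cancel_left_pos) (auto simp: card_gt_0_iff)
        also have "\<dots> \<le> Q * real (card M) ^ c" unfolding Q_def by (intro mult_right_mono) auto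
        also have "weight D d p (\<lambda>_. 2 * k) = (real D * real d) ^ (k * p)"
          by (simp add: weight_def growth_even power_mult)
        finally have X: "(real D * real d) ^ (k * p) \<le> Q * real (card M) ^ c" .
        \<comment> \<open>The product of the edge counts from the two sides brings in
          \<open>D * d\<close>.\<close>
        have "(real (card (edges G)))\<^sup>2 \<le> (real (card M) * (real \<mu> * real D)) * (real (card N) * (real \<mu> * real d))"
          unfolding power2_eq_square using eM' eN' by (intro mult_mono) auto
        also have "\<dots> = (real \<mu>)\<^sup>2 * (real (card M) * real (card N) * (real D * real d))"
          by (simp add: power2_eq_square)
        finally have sq: "(real (card (edges G)))\<^sup>2 \<le> (real \<mu>)\<^sup>2 * (real (card M) * real (card N) * (real D * real d))" .
        have "real (card (edges G)) \<le> real \<mu> * Q powr (1 / (2 * real (k * p))) * R"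
          unfolding R_def
          by (rule powr_bound[OF sq X]) (use pos Qpos ne fin Dpos dpos in \<open>auto simp: card_gt_0_iff\<close>)
        also have "\<dots> \<le> C * (R + real (card M) + real (card N))"
          using R0 Cpos by (intro mult_mono) (auto simp: C_def)
        finally show "real (card (edges G)) \<le> C * (R + real (card M) + real (card N))" .
      qed
    qed
  qed
  then show ?thesis using Cpos by blast
qed

theorem theorem3p12:
  fixes \<mu> k r s t :: nat
  assumes "\<mu> \<ge> 2" and "k \<ge> 1" and "r \<ge> 1" and "s \<ge> 2" and "t \<ge> 2"
  shows "\<exists>C C' :: real. C > 0 \<and> C' > 0 \<and>
    (\<forall>(G :: 'a ugraph) M N.
       bipartite_graph G M N \<longrightarrow> almost_biregular \<mu> G M N \<longrightarrow> card M \<le> card N \<longrightarrow>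
       free_of (subdivision (2 * k) r (complete_bipartite s t)) G \<longrightarrow>
       real (card (edges G)) \<le>
         C * (real (card M) powr (1 / 2 + 1 / (2 * real k)) * real (card N) powr (1 / 2)
              + real (card M) + real (card N))) \<and>
    (\<forall>(G :: 'a ugraph) M N.
       bipartite_graph G M N \<longrightarrow> almost_biregular \<mu> G M N \<longrightarrow> card M \<le> card N \<longrightarrow>
       free_of (subdivision (2 * k) 1 (complete_bipartite s t)) G \<longrightarrow>
       real (card (edges G)) \<le>
         C' * (real (card M) powr (1 / 2 + 1 / (2 * real k) - 1 / (2 * real k * real s))
                 * real (card N) powr (1 / 2)
               + real (card M) + real (card N)))"
proof -
  define F :: "nat \<Rightarrow> ('a \<Rightarrow> 'a set) \<Rightarrow> bool" where "F = (\<lambda>r nb. \<not> subdivision_embedded nb (2 * k) s t r)"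
  have free: "F r (neighbours G)" if "bipartite_graph G M N" "free_of (subdivision (2 * k) r (complete_bipartite s t)) G" "1 \<le> r"
    for r M N and G :: "'a ugraph"
  proof -
    have "0 < 2 * k" "0 < s" "0 < t" "0 < r" using assms that(3) by auto
    from subdivision_embedded_contains_copy[OF that(1) _ this] that(2) show ?thesis unfolding F_def free_of_def by blast
  qed
  have mu: "1 \<le> \<mu>" and k: "0 < k" and s: "0 < s" using assms by auto
  have fh1: "few_heavy \<mu> (F r) True 1 (\<lambda>_. 2 * k)"
    using k by (intro path_claim[OF mu s, of _ k t r]) (auto simp: F_def)
  have lp1: "card (Keys True 1 (\<lambda>_. 2 * k)) = Suc 1"
    using k by (simp add: Keys_def lessThan_Suc)
  obtain C where C: "0 < C" "\<forall>(G :: 'a ugraph) M N. bipartite_graph G M N \<longrightarrow> almost_biregular \<mu> G M N \<longrightarrow> F r (neighbours G) \<longrightarrow>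
    real (card (edges G)) \<le> C * (real (card M) powr (1 / 2 + real 1 / (2 * real (k * 1))) * real (card N) powr (1 / 2)
      + real (card M) + real (card N))"
    using edge_bound[OF fh1 mu k zero_less_one lp1] by (elim exE conjE) (rule that)
  have fh2: "few_heavy \<mu> (F 1) False s (\<lambda>_. 2 * k)"
    using k by (intro spider_claim[OF mu assms(4) k, of _ t]) (auto simp: F_def)
  \<comment> \<open>The centre is left free, so \<open>s\<close> legs have only \<open>s\<close>
    prescribed vertices, one of which is cancelled; this is the source of the gain
    \<open>1 / (2 * k * s)\<close> in the exponent.\<close>
  have lp2: "card (Keys False s (\<lambda>_. 2 * k)) = Suc (s - 1)"
    using s by (simp add: Keys_def card_image inj_on_def)
  obtain C' where C': "0 < C'" "\<forall>(G :: 'a ugraph) M N. bipartite_graph G M N \<longrightarrow> almost_biregular \<mu> G M N \<longrightarrow> F 1 (neighbours G) \<longrightarrow>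
    real (card (edges G)) \<le> C' * (real (card M) powr (1 / 2 + real (s - 1) / (2 * real (k * s))) * real (card N) powr (1 / 2)
      + real (card M) + real (card N))"
    using edge_bound[OF fh2 mu k s lp2] by (elim exE conjE) (rule that)
  have e1: "1 / 2 + real 1 / (2 * real (k * 1)) = 1 / 2 + 1 / (2 * real k)" by simp
  have e2: "1 / 2 + real (s - 1) / (2 * real (k * s)) = 1 / 2 + 1 / (2 * real k) - 1 / (2 * real k * real s)"
    using s k by (simp add: field_simps of_nat_diff)
  show ?thesis
    by (rule exI[of _ C], rule exI[of _ C'], intro conjI allI impI C(1) C'(1))
      (rule C(2)[unfolded e1, rule_format] C'(2)[unfolded e2, rule_format];
        use free assms(3) in blast)+
qed

end
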